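(* Let $q$ be an odd prime power. Let $n,j,i$ be integers with $0\leq i\leq j$ and $i+j\leq n$, such that $n$ is odd and $j$ is even. Let $\delta\in\{0,\pm1\}$ and $\lambda\in\{\pm1\}$ with $j-i-\delta\equiv1\pmod{2}$. For $i$ even (and thus $\delta\in\{\pm1\}$) we have \begin{align*} \gamma_{(i,j,\delta),(n,0),(n-j,0),0}&=q^{\frac{3}{2}jn-\frac{1}{4}n^{2}-\frac{5}{4}j^{2}-\frac{1}{2}n+\frac{1}{2}j-\frac{1}{4}}\Bigg(\sum_{m=0}^{\frac{n-j-i-1}{2}}\chi_{1,\frac{n-j+1}{2}-m}(q)\genfrac{[}{]}{0pt}{}{\frac{n-j-i-1}{2}}{m}_{q^{2}}q^{m(m-j+i+1)}\\ &\qquad+\delta\,q^{\frac{1}{2}(i-j)}\sum_{m=0}^{\frac{n-j-i-1}{2}}\chi_{1,\frac{n-j-1}{2}-m}(q)\genfrac{[}{]}{0pt}{}{\frac{n-j-i-1}{2}}{m}_{q^{2}}q^{m(m-j+i+1)}\Bigg), \end{align*} and for $i$ odd (and thus $\delta=0$) we have \begin{align*} \gamma_{(i,j,0,\lambda),(n,0),(n-j,0),0} &=q^{\frac{3}{2}jn-\frac{1}{4}n^{2}-\frac{5}{4}j^{2}-\frac{1}{2}n+\frac{1}{2}j-\frac{1}{4}}\sum_{m=0}^{\frac{n-j-i}{2}}\chi_{1,\frac{n-j+1}{2}-m}(q)\genfrac{[}{]}{0pt}{}{\frac{n-j-i}{2}}{m}_{q^{2}}q^{m(m-j+i)}. \e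nd{align*}
   Context: Forms and types. $q$ is an odd prime power. A quadratic form $Q$ on $\mathbb{F}_q^m$ has an associated symmetric bilinear form $f$ with $Q(v)=f(v,v)$; its radical is $\{v:\forall w,\ f(v,w)=0\}$, and $Q$ is non-degenerate if its radical is $0$. A non-degenerate quadratic form on $\mathbb{F}_q^m$ has a type: $0$ (parabolic) if $m$ is odd; if $m$ is even, the type is $1$ (hyperbolic) if the maximum dimension of a totally isotropic subspace (one on which $Q$ vanishes) is $m/2$, and $-1$ (elliptic) if it is $m/2-1$. The $0$-dimensional space has type $1$. "A quadratic form of type $\varepsilon$ on $\mathbb{F}_q^n$" always means a non-degenerate one. All subspace dimensions are vector space dimensions. Given such a form, a subspace $\pi$ is $i$-singular if the radical of the form restricted to $\pi$ has dimension $i$; non-singular means $0$-singular. The type of an $i$-singular $j$-space $\pi$ is the type of the non-degenerate form induced on $\pi/\mathrm{rad}(\pi)$. Let $\perp$ be the orthogonal polarity $\pi\mapsto\pi^\perp=\{x: f(x,y)=0\ \forall y\in\pi\}$. If $n$ and $j-i$ are both odd, the perp type of an $i$-singular $j$-space $\pi$ (which has type $0$) is the type, $1$ or $-1$, of the $i$-singular $(n-j)$-space $\pi^\perp$. Counts. Fix a quadratic form of type $\varepsilon$ on $\mathbb{F}_q^n$. If $n(j-i)$ is even or $n=i+j$, fix an $i$-singular $j$-space $\pi$ of type $\delta$; then $\gamma_{(i,j,\delta),(n,\varepsilon),(k,\zeta),\eta}$ is the number of non-singular $k$-spaces $\sigma$ of type $\zeta$ such that $\sigma\cap\pi$ is trivial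 and $\langle\pi,\sigma\rangle$ is a non-singular $(k+j)$-space of type $\eta$. If $n(j-i)$ is odd (so $\varepsilon=\delta=0$), fix an $i$-singular $j$-space $\pi$ of type $0$ and perp type $\lambda$; then $\gamma_{(i,j,0,\lambda),(n,0),(k,\zeta),\eta}$ is the number of non-singular $k$-spaces $\sigma$ of type $\zeta$ such that $\sigma\cap\pi$ is trivial and $\langle\pi,\sigma\rangle$ is a non-singular $(k+j)$-space of type $\eta$. (If moreover $n=i+j$, the perp type is always $1$.) These numbers do not depend on the choice of $\pi$; they are only defined, and the formulae are only asserted, for parameters for which such a $\pi$ exists. Functions. For integers $b\geq a\geq0$: $\psi^{-}_{a,b}(q)=\prod_{k=a}^{b}(q^k-1)$, $\chi_{a,b}(q)=\prod_{k=a}^{b}(q^{2k-1}-1)$, and $\psi^-_{a,a-1}(q)=\chi_{a,a-1}(q)=1$ for $a\ge0$. For integers $b\ge a\ge0$, $\genfrac{[}{]}{0pt}{}{b}{a}_{q}=\psi^-_{b-a+1,b}(q)/\psi^-_{1,a}(q)$; moreover $\genfrac{[}{]}{0pt}{}{b}{a}_{q}=0$ if $a<0$ or $0\leq b<a$, and $\genfrac{[}{]}{0pt}{}{-1}{0}_{q}=1$. *)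

theory Defs
  imports "HOL-Analysis.Cartesian_Space"
begin

text \<open>
  The coefficient field is a type of class \<open>{field, finite}\<close>; the notions below are meant for
  fields in which \<open>2\<close> is invertible.
\<close>

definition assoc_form :: "('a::{field,finite} ^ 'n \<Rightarrow> 'a) \<Rightarrow> 'a ^ 'n \<Rightarrow> 'a ^ 'n \<Rightarrow> 'a" where
  "assoc_form Q u v = (Q (u + v) - Q u - Q v) / 2"

text \<open>
  The normalisation by \<open>2\<close> makes \<open>Q v = assoc_form Q v v\<close>. As \<open>assoc_form Q\<close> is symmetric,
  linearity in one argument is bilinearity.
\<close>

definition quadratic_form :: "('a::{field,finite} ^ 'n \<Rightarrow> 'a) \<Rightarrow> bool" where
  "quadratic_form Q \<longleftrightarrow>
     (\<forall>c v. Q (c *s v) = c ^ 2 * Q v) \<and>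
     (\<forall>u. Vector_Spaces.linear (*s) (*) (assoc_form Q u))"

definition radical :: "('a::{field,finite} ^ 'n \<Rightarrow> 'a) \<Rightarrow> ('a ^ 'n) set \<Rightarrow> ('a ^ 'n) set" where
  "radical Q P = {v \<in> P. \<forall>w\<in>P. assoc_form Q v w = 0}"

definition perp :: "('a::{field,finite} ^ 'n \<Rightarrow> 'a) \<Rightarrow> ('a ^ 'n) set \<Rightarrow> ('a ^ 'n) set" where
  "perp Q P = {x. \<forall>y\<in>P. assoc_form Q x y = 0}"

definition singular_space ::
    "('a::{field,finite} ^ 'n \<Rightarrow> 'a) \<Rightarrow> nat \<Rightarrow> nat \<Rightarrow> ('a ^ 'n) set \<Rightarrow> bool" where
  "singular_space Q i j P \<longleftrightarrow>
     vec.subspace P \<and> vec.dim P = j \<and> vec.dim (radical Q P) = i"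

text \<open>
  The next two definitions concern the non-degenerate form induced by \<open>Q\<close> on the quotient
  \<open>P / R\<close>, where \<open>R = radical Q P\<close>. The subspaces of \<open>P / R\<close> are the \<open>W / R\<close> for subspaces \<open>W\<close>
  with \<open>R \<subseteq> W \<subseteq> P\<close>, and \<open>dim (W / R) = dim W - dim R\<close>. Since \<open>Q\<close> is constant on cosets of \<open>R\<close>
  in \<open>P\<close>, the induced form vanishes on \<open>W / R\<close> iff \<open>Q\<close> vanishes on \<open>W\<close>.
  If \<open>R = {0}\<close>, this is the form \<open>Q\<close> on \<open>P\<close> itself.
\<close>

definition max_isotropic_dim :: "('a::{field,finite} ^ 'n \<Rightarrow> 'a) \<Rightarrow> ('a ^ 'n) set \<Rightarrow> nat" where
  "max_isotropic_dim Q P =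
     Max {vec.dim W - vec.dim (radical Q P) | W.
            vec.subspace W \<and> radical Q P \<subseteq> W \<and> W \<subseteq> P \<and> (\<forall>v\<in>W. Q v = 0)}"

definition has_type :: "('a::{field,finite} ^ 'n \<Rightarrow> 'a) \<Rightarrow> ('a ^ 'n) set \<Rightarrow> int \<Rightarrow> bool" where
  "has_type Q P \<epsilon> \<longleftrightarrow>
     (let m = vec.dim P - vec.dim (radical Q P) in
        (odd m \<and> \<epsilon> = 0) \<or>
        (even m \<and> \<epsilon> = 1 \<and> max_isotropic_dim Q P = m div 2) \<or>
        (even m \<and> \<epsilon> = -1 \<and> int (max_isotropic_dim Q P) = int (m div 2) - 1))"

definition has_perp_type :: "('a::{field,finite} ^ 'n \<Rightarrow> 'a) \<Rightarrow> ('a ^ 'n) set \<Rightarrow> int \<Rightarrow> bool" where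
  "has_perp_type Q P \<mu> \<longleftrightarrow> has_type Q (perp Q P) \<mu>"

definition quadratic_form_of_type :: "('a::{field,finite} ^ 'n \<Rightarrow> 'a) \<Rightarrow> int \<Rightarrow> bool" where
  "quadratic_form_of_type Q \<epsilon> \<longleftrightarrow>
     quadratic_form Q \<and> radical Q UNIV = {0} \<and> has_type Q UNIV \<epsilon>"

text \<open>
  The indices \<open>(i,j,\<delta>)\<close>, respectively \<open>(i,j,0,\<lambda>)\<close>, and \<open>(n,\<epsilon>)\<close> of the usual notation are not
  arguments here: they are the parameters of the given space \<open>P\<close> and of the given form \<open>Q\<close>.
\<close>

definition gamma_count ::
    "('a::{field,finite} ^ 'n \<Rightarrow> 'a) \<Rightarrow> ('a ^ 'n) set \<Rightarrow> nat \<Rightarrow> int \<Rightarrow> int \<Rightarrow> nat" where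
  "gamma_count Q P k \<zeta> \<eta> =
     card {S. singular_space Q 0 k S \<and> has_type Q S \<zeta> \<and> S \<inter> P = {0} \<and>
              singular_space Q 0 (k + vec.dim P) (vec.span (P \<union> S)) \<and>
              has_type Q (vec.span (P \<union> S)) \<eta>}"

definition psi_minus :: "int \<Rightarrow> int \<Rightarrow> real \<Rightarrow> real" where
  "psi_minus a b q = (\<Prod>k = a..b. (q powi k - 1))"

definition chi_prod :: "int \<Rightarrow> int \<Rightarrow> real \<Rightarrow> real" where
  "chi_prod a b q = (\<Prod>k = a..b. (q powi (2 * k - 1) - 1))"

definition gauss_binomial :: "int \<Rightarrow> int \<Rightarrow> real \<Rightarrow> real" where
  "gauss_binomial b a q =
     (if 0 \<le> a \<and> a \<le> b then psi_minus (b - a + 1) b q / psi_minus 1 a q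
      else if b = -1 \<and> a = 0 then 1
      else 0)"

end

theory Submission
  imports Defs
begin

text \<open>
  As \<open>k = n - j\<close>, the span condition says that \<open>S\<close> is a complement of the given space \<open>P\<close>, and \<open>\<gamma>\<close>
  counts the non-singular complements of \<open>P\<close> in \<open>V\<close>. Let \<open>e \<in> P\<^sup>\<bottom>\<close> be anisotropic and
  \<open>V = V' \<bottom> \<langle>e\<rangle>\<close>. A complement of \<open>P\<close> in \<open>V\<close> is \<open>S' + \<langle>e + v\<rangle>\<close> for a unique complement \<open>S'\<close> of \<open>P\<close>
  in \<open>V'\<close> and a unique \<open>v \<in> P\<close>. If \<open>S'\<close> is singular, non-singularity of \<open>S' + \<langle>e + v\<rangle>\<close> is a linear
  condition on \<open>v\<close>; if \<open>S'\<close> is non-singular, it says that the projection of \<open>v\<close> to \<open>V' \<inter> S'\<^sup>\<bottom>\<close>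
  avoids the value \<open>-Q(e)\<close>, and the number of such \<open>v\<close> depends on the discriminant of \<open>S'\<close>. Comparing
  with the same construction for a hyperbolic plane \<open>\<langle>r, r'\<rangle>\<close> in place of \<open>\<langle>e\<rangle>\<close>, with \<open>P + \<langle>r\<rangle>\<close> in
  place of \<open>P\<close>, where the Gram matrix of \<open>S'\<close> is bordered by a uniformly distributed row, expresses
  the count for \<open>(V, P)\<close> by the count for \<open>(V' \<bottom> \<langle>r, r'\<rangle>, P + \<langle>r\<rangle>)\<close> and a count for \<open>(V', P)\<close>
  weighted with the quadratic character of the discriminant. Two such steps eliminate the weighted
  counts and give a recursion that corresponds to Pascal's rule for the Gaussian binomials. It ends
  when \<open>P\<^sup>\<bottom>\<close> is totally isotropic, up to one dimension. As \<open>S \<mapsto> S\<^sup>\<bottom>\<close> maps complements of \<open>P\<close> to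
  complements of \<open>P\<^sup>\<bottom>\<close>, that case reduces to totally isotropic \<open>P\<close>, where Eichler transformations
  show that all \<open>v\<close> contribute equally.
\<close>

section \<open>The quadratic character and diagonal forms\<close>

text \<open>The exponent of q in the theorem is j(n-j) - ((n-j+1)/2)^2: P has q^(j(n-j))
  complements, and the square clears the denominators of 1 - q^(-1), 1 - q^(-3), ..., whose products
  are proportions of invertible symmetric matrices. Whether \<open>adjoin (e + v) S\<close> is
  non-singular depends on the discriminant of S, so a single step does not give a recursion for the
  number of non-singular complements alone. Discriminants, through \<open>disc_char\<close>, replace
  types because the intermediate spaces have dimensions of both parities, and in odd dimension the
  type carries no information. The recursion does not decrease dim V or dim P but the excess dim V -
  dim P - dim rad P; in one of its two branches the space even grows. Both branches preserve dim rad
  P - dim P, which is why i and j enter the exponents inside the sums only through i - j. For odd i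
  the recursion ends at excess 0, for even i at excess 1; the sign delta comes from that last
  anisotropic vector.\<close>

definition quad_char :: "'a::{field,finite} \<Rightarrow> real" where
  "quad_char x = (if x = 0 then 0 else if \<exists>y. x = y ^ 2 then 1 else -1)"

lemma sum_by_fibers:
  fixes g :: "'b \<Rightarrow> 'c::finite" and F :: "'c \<Rightarrow> real"
  assumes "finite A"
  shows "(\<Sum>x\<in>A. F (g x)) = (\<Sum>t\<in>UNIV. real (card {x\<in>A. g x = t}) * F t)"
proof -
  have "(\<Sum>t\<in>UNIV. \<Sum>x\<in>{x\<in>A. g x = t}. F (g x)) = (\<Sum>x\<in>A. F (g x))"
    using assms by (intro sum.group) auto
  moreover have "(\<Sum>x\<in>{x\<in>A. g x = t}. F (g x)) = real (card {x\<in>A. g x = t}) * F t" for t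
    by simp
  ultimately show ?thesis by simp
qed

lemma quad_char_0 [simp]: "quad_char 0 = 0"
  by (simp add: quad_char_def)

lemma quad_char_1 [simp]: "quad_char 1 = 1"
  by (auto simp: quad_char_def intro: exI[of _ 1])

lemma quad_char_eq_0_iff [simp]: "quad_char x = 0 \<longleftrightarrow> x = 0"
  by (simp add: quad_char_def)

lemma quad_char_square: "x \<noteq> 0 \<Longrightarrow> quad_char (x ^ 2) = 1"
  by (auto simp: quad_char_def)

lemma quad_char_nonzero_cases: "x \<noteq> 0 \<Longrightarrow> quad_char x = 1 \<or> quad_char x = -1"
  by (auto simp: quad_char_def)

lemma quad_char_mult_self: "x \<noteq> 0 \<Longrightarrow> quad_char x * quad_char x = 1"
  using quad_char_nonzero_cases by fastforce

text \<open>Otherwise the pairs {x, x + 1} partition the field, whose order is then even.\<close>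

lemma two_neq_0:
  assumes "odd CARD('a::{field,finite})"
  shows "(2::'a) \<noteq> 0"
proof
  assume "(2::'a) = 0"
  hence 1: "x + 1 + 1 = x" for x :: 'a
    by (metis add.assoc add_0_right one_add_one)
  have "even (card (UNIV::'a set))"
  proof -
    define r where "r = (\<lambda>x::'a. {x, x + 1})"
    have c: "card (r x) = 2" for x by (auto simp: r_def)
    have d: "r x = r y" if "r x \<inter> r y \<noteq> {}" for x y
      using that 1[of x] 1[of y] unfolding r_def by auto
    have "2 * card (range r) = card (\<Union>(range r))"
      by (rule card_partition) (use c d in auto)
    moreover have "\<Union>(range r) = UNIV" by (auto simp: r_def)
    ultimately show ?thesis by (metis dvd_triv_left)
  qed
  thus False using assms by simp
qed

section \<open>Squares and sums of the quadratic character\<close>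

context
  assumes two: "(2::'a::{field,finite}) \<noteq> 0"
begin

lemma card_square_roots: "real (card {c::'a. c ^ 2 = t}) = 1 + quad_char t"
proof (cases "t = 0")
  case True
  then show ?thesis by simp
next
  case False
  show ?thesis
  proof (cases "\<exists>y. t = y ^ 2")
    case True
    then obtain y where y: "t = y ^ 2" by blast
    have "{c::'a. c ^ 2 = t} = {y, - y}" using y by (auto simp: power2_eq_iff)
    moreover have "y \<noteq> - y"
      using two False y by (metis add.right_inverse mult_2 mult_eq_0_iff zero_power2)
    ultimately show ?thesis using False True by (simp add: quad_char_def)
  next
    case no: False
    hence "{c::'a. c ^ 2 = t} = {}" by auto
    thus ?thesis using False no by (simp add: quad_char_def)
  qed
qed

text \<open>Every c is a square root of exactly one t, so the numbers 1 + \<open>quad_char t\<close>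
  add up to the order of the field.\<close>

lemma sum_quad_char: "(\<Sum>t\<in>UNIV. quad_char (t::'a)) = 0"
proof -
  have "(\<Sum>t\<in>UNIV. 1 + quad_char (t::'a)) = (\<Sum>t\<in>UNIV. real (card {c\<in>UNIV::'a set. c ^ 2 = t}) * 1)"
    by (simp add: card_square_roots)
  also have "\<dots> = (\<Sum>c\<in>(UNIV::'a set). 1)"
    by (subst sum_by_fibers[symmetric]) auto
  finally show ?thesis by (simp add: sum.distrib)
qed

text \<open>By the vanishing character sum there are as many nonzero squares (\<open>S\<close>) as
  non-squares (\<open>N\<close>). Multiplication by a non-square maps \<open>S\<close> injectively
  into \<open>N\<close>, hence onto \<open>N\<close>, so a product of two non-squares has to be a
  square.\<close>

lemma quad_char_mult: "quad_char (x * y) = quad_char x * quad_char (y::'a)"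
proof -
  define S where "S = {t::'a. quad_char t = 1}"
  define N where "N = {t::'a. quad_char t = -1}"
  have un: "UNIV = insert 0 (S \<union> N)"
    using quad_char_nonzero_cases unfolding S_def N_def by auto
  have SN: "S \<inter> N = {}" "0 \<notin> S \<union> N" by (auto simp: S_def N_def)
  have "(\<Sum>t\<in>UNIV. quad_char (t::'a)) = (\<Sum>t\<in>S. quad_char t) + (\<Sum>t\<in>N. quad_char t)"
    unfolding un using SN by (subst sum.insert) (auto simp: sum.union_disjoint)
  also have "\<dots> = real (card S) - real (card N)"
    by (simp add: S_def N_def)
  finally have cSN: "card S = card N" using sum_quad_char by simp
  have sq: "quad_char (s * z) = quad_char z" if s: "s \<in> S" for s z
  proof (cases "z = 0")
    case False
    have "\<exists>u. s = u ^ 2" "s \<noteq> 0"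
      using s unfolding S_def quad_char_def by (auto split: if_splits)
    then obtain u where u: "s = u ^ 2" "u \<noteq> 0" by auto
    have "(\<exists>y. s * z = y ^ 2) \<longleftrightarrow> (\<exists>y. z = y ^ 2)"
    proof
      assume "\<exists>y. s * z = y ^ 2"
      then obtain y where "s * z = y ^ 2" by blast
      hence "z = (y / u) ^ 2" using u by (simp add: power_divide field_simps)
      thus "\<exists>y. z = y ^ 2" by blast
    next
      assume "\<exists>y. z = y ^ 2"
      then obtain y where "z = y ^ 2" by blast
      hence "s * z = (u * y) ^ 2" using u by (simp add: power_mult_distrib)
      thus "\<exists>y. s * z = y ^ 2" by blast
    qed
    thus ?thesis using False u by (simp add: quad_char_def)
  qed simp
  show ?thesis
  proof (cases "x = 0 \<or> y = 0 \<or> x \<in> S \<or> y \<in> S")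
    case True
    then show ?thesis
    proof (elim disjE)
      assume "x \<in> S" thus ?thesis using sq[of x y] by (simp add: S_def)
    next
      assume "y \<in> S" thus ?thesis using sq[of y x] by (simp add: S_def mult.commute)
    qed auto
  next
    case False
    moreover have "x \<in> insert 0 (S \<union> N)" "y \<in> insert 0 (S \<union> N)"
      unfolding un[symmetric] by simp_all
    ultimately have x: "x \<in> N" "x \<noteq> 0" and y: "y \<in> N" "y \<noteq> 0" by auto
    have "(\<lambda>s. s * x) ` S \<subseteq> N" using sq x by (auto simp: N_def)
    moreover have "card ((\<lambda>s. s * x) ` S) = card S"
      by (rule card_image) (use x in \<open>auto simp: inj_on_def\<close>)
    ultimately have img: "(\<lambda>s. s * x) ` S = N"
      using cSN by (intro card_subset_eq) auto
    have "x * y \<notin> N"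
    proof
      assume "x * y \<in> N"
      then obtain s where "s \<in> S" "x * y = s * x" using img by auto
      hence "y \<in> S" using x by simp
      thus False using y SN by auto
    qed
    moreover have "x * y \<in> insert 0 (S \<union> N)" unfolding un[symmetric] by simp
    ultimately have "x * y \<in> S" using x y by simp
    thus ?thesis using x y by (simp add: S_def N_def)
  qed
qed

lemma quad_char_div: "quad_char (x / y) = quad_char x * quad_char (y::'a)"
proof (cases "y = 0")
  case False
  have "quad_char (x / y) * quad_char (y ^ 2) = quad_char (x * y)"
    using False by (subst quad_char_mult[symmetric]) (simp add: power2_eq_square)
  thus ?thesis using False by (simp add: quad_char_square quad_char_mult)
qed simp

lemma exists_nonsquare: "\<exists>x::'a. quad_char x = -1"
proof (rule ccontr)
  assume "\<nexists>x::'a. quad_char x = -1"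
  hence "quad_char x \<ge> 0" for x :: 'a
    using quad_char_nonzero_cases[of x] by (cases "x = 0") auto
  hence "(\<Sum>t\<in>UNIV. quad_char (t::'a)) \<ge> quad_char (1::'a)"
    by (intro member_le_sum) auto
  thus False using sum_quad_char by simp
qed

lemma sum_quad_char_shift: "(\<Sum>t\<in>UNIV. quad_char (a + t::'a)) = 0"
  using sum.reindex_bij_betw[of "\<lambda>t. a + t" UNIV UNIV quad_char] sum_quad_char
  by (simp add: bij_plus_right)

lemma card_scaled_square_roots:
  assumes "a \<noteq> 0"
  shows "real (card {c::'a. a * c ^ 2 = t}) = 1 + quad_char (a * t)"
proof -
  have "{c::'a. a * c ^ 2 = t} = {c::'a. c ^ 2 = t / a}" using assms by (auto simp: field_simps)
  thus ?thesis by (simp add: card_square_roots quad_char_div quad_char_mult mult.commute)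
qed

text \<open>For nonzero t, grouping by s = a c^2 with multiplicity 1 +
  \<open>quad_char (a * s)\<close> reduces the sum to a Jacobi sum of the quadratic character with
  itself.\<close>

lemma sum_quad_char_sub_square:
  assumes a: "a \<noteq> 0"
  shows "(\<Sum>c\<in>UNIV. quad_char (t - a * c ^ 2 :: 'a)) =
           quad_char (- a) * ((if t = 0 then real CARD('a) else 0) - 1)"
proof (cases "t = 0")
  case True
  have "(\<Sum>c\<in>UNIV. quad_char (t - a * c ^ 2 :: 'a)) = (\<Sum>c\<in>insert 0 (UNIV - {0}). quad_char (- a * c ^ 2))"
    using True by (simp add: insert_absorb)
  also have "\<dots> = (\<Sum>c\<in>UNIV - {0::'a}. quad_char (- a * c ^ 2))"
    by (subst sum.insert) auto
  also have "\<dots> = (\<Sum>c\<in>UNIV - {0::'a}. quad_char (- a))"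
  proof (rule sum.cong)
    fix c :: 'a assume "c \<in> UNIV - {0}"
    hence "quad_char (c ^ 2) = 1" by (simp add: quad_char_square)
    thus "quad_char (- a * c ^ 2) = quad_char (- a)" by (simp only: quad_char_mult mult_1_right)
  qed simp
  also have "\<dots> = quad_char (- a) * (real CARD('a) - 1)"
    by (simp add: card_Diff_subset of_nat_diff Suc_leI)
  finally show ?thesis using True by simp
next
  case t: False
  have "(\<Sum>c\<in>UNIV. quad_char (t - a * c ^ 2 :: 'a)) =
        (\<Sum>s\<in>UNIV. real (card {c\<in>UNIV::'a set. a * c ^ 2 = s}) * quad_char (t - s))"
    using sum_by_fibers[of UNIV "\<lambda>s. quad_char (t - s)" "\<lambda>c. a * c ^ 2"] by simp
  also have "\<dots> = (\<Sum>s\<in>UNIV. quad_char (t - s) + quad_char a * (quad_char s * quad_char (t - s)))"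
    by (simp add: card_scaled_square_roots a quad_char_mult ring_distribs mult.assoc)
  also have "\<dots> = (\<Sum>s\<in>UNIV. quad_char (t - s)) + quad_char a * (\<Sum>s\<in>UNIV. quad_char s * quad_char (t - s))"
    by (simp add: sum.distrib sum_distrib_left)
  also have "(\<Sum>s\<in>UNIV. quad_char (t - s)) = (\<Sum>s\<in>UNIV. quad_char (s::'a))"
    by (rule sum.reindex_bij_witness[of _ "\<lambda>s. t - s" "\<lambda>s. t - s"]) auto
  also have "(\<Sum>s\<in>UNIV. quad_char s * quad_char (t - s)) = (\<Sum>s\<in>UNIV - {0}. quad_char s * quad_char (t - s))"
    by (rule sum.mono_neutral_right) auto
  also have "\<dots> = (\<Sum>s\<in>UNIV - {0}. quad_char (t / s - 1))"
  proof (rule sum.cong)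
    fix s :: 'a assume "s \<in> UNIV - {0}"
    hence "t / s - 1 = (t - s) / s" by (simp add: field_simps)
    thus "quad_char s * quad_char (t - s) = quad_char (t / s - 1)"
      by (simp only: quad_char_div mult.commute)
  qed simp
  \<comment> \<open>The substitution u = t/s - 1 maps the nonzero s bijectively onto everything
    except -1, so what remains is the full character sum, which is 0, without its term at
    -1.\<close>
  also have "\<dots> = (\<Sum>u\<in>UNIV - {-1}. quad_char (u::'a))"
    by (rule sum.reindex_bij_witness[of _ "\<lambda>u. t / (u + 1)" "\<lambda>s. t / s - 1"])
      (use t in \<open>auto simp: field_simps eq_neg_iff_add_eq_0\<close>)
  also have "\<dots> = - quad_char (-1::'a)"
    using sum_quad_char by (simp add: sum.remove[of UNIV "-1"])
  also have "quad_char a * - quad_char (-1::'a) = - quad_char (- a)"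
    using quad_char_mult[of a "-1"] by simp
  finally show ?thesis using t sum_quad_char by simp
qed



end

text \<open>The number of solutions of a_1 c_1^2 + ... + a_r c_r^2 = t.\<close>

fun diag_count :: "'a::{field,finite} list \<Rightarrow> 'a \<Rightarrow> real" where
  "diag_count [] t = (if t = 0 then 1 else 0)"
| "diag_count (a # as) t = (\<Sum>c\<in>UNIV. diag_count as (t - a * c ^ 2))"

lemma sum_delta_real: "(\<Sum>c\<in>UNIV. if P c then y else (0::real)) = real (card {c::'a::finite. P c}) * y"
  by (subst sum.inter_filter[symmetric]) auto

text \<open>The classical point count of a diagonal quadric. The formula for even length is
  multiplied by q, because its terms q^(2k-1) and q^(k-1) would have negative exponents at k = 0.
  The induction alternates between the parities: from odd to even by
  \<open>sum_quad_char_sub_square\<close>, from even to odd by the number of c with a c^2 =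
  t.\<close>

lemma diag_count_formula:
  fixes as :: "'a::{field,finite} list"
  assumes two: "(2::'a) \<noteq> 0" and "0 \<notin> set as"
  defines "q \<equiv> real CARD('a)"
  shows "length as = 2 * k \<Longrightarrow> q * diag_count as t =
           q ^ (2 * k) + quad_char (-1::'a) ^ k * quad_char (prod_list as) * ((if t = 0 then q else 0) - 1) * q ^ k"
    and "length as = 2 * k + 1 \<Longrightarrow> diag_count as t =
           q ^ (2 * k) + quad_char t * (quad_char (-1::'a) ^ k * quad_char (prod_list as)) * q ^ k"
  using \<open>0 \<notin> set as\<close>
proof (induction as arbitrary: k t)
  case Nil
  { case 1 then show ?case by simp }
  { case 2 then show ?case by simp }
next
  case (Cons a as)
  have q0: "q > 0" by (simp add: q_def)
  define s where "s = quad_char (-1::'a)"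
  define p where "p = quad_char (prod_list as)"
  { case 1
    then obtain l where l: "k = Suc l" by (cases k) auto
    have a: "a \<noteq> 0" and as: "0 \<notin> set as" using 1 by auto
    have "diag_count (a # as) t = (\<Sum>c\<in>UNIV. q ^ (2 * l) + (s ^ l * p * q ^ l) * quad_char (t - a * c ^ 2))"
      using 1 l as Cons.IH(2)[of l] by (simp add: s_def p_def algebra_simps)
    also have "\<dots> = q * q ^ (2 * l) + (s ^ l * p * q ^ l) * (quad_char (- a) * ((if t = 0 then q else 0) - 1))"
      using sum_quad_char_sub_square[OF two a]
      by (simp add: sum.distrib sum_distrib_left[symmetric] q_def)
    finally have e: "diag_count (a # as) t = q * q ^ (2 * l) +
        (s ^ l * p * q ^ l) * (quad_char (- a) * ((if t = 0 then q else 0) - 1))" .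
    have "quad_char (- a) = s * quad_char a" "quad_char (prod_list (a # as)) = quad_char a * p"
      using quad_char_mult[OF two, of "-1" a] quad_char_mult[OF two, of a "prod_list as"]
      by (simp_all add: s_def p_def)
    thus ?case unfolding e l s_def[symmetric] by (simp only: power_Suc) (simp add: algebra_simps)
  }
  { case 2
    have a: "a \<noteq> 0" and as: "0 \<notin> set as" using 2 by auto
    have "q * diag_count (a # as) t = (\<Sum>c\<in>UNIV. q * diag_count as (t - a * c ^ 2))"
      by (simp add: sum_distrib_left)
    also have "\<dots> = (\<Sum>c\<in>UNIV. (q ^ (2 * k) - s ^ k * p * q ^ k) + (if a * c ^ 2 = t then s ^ k * p * q ^ k * q else 0))"
      using 2 as Cons.IH(1)[of k] by (intro sum.cong) (auto simp: s_def p_def algebra_simps)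
    also have "\<dots> = q * (q ^ (2 * k) - s ^ k * p * q ^ k) + (1 + quad_char (a * t)) * (s ^ k * p * q ^ k * q)"
      by (simp only: sum.distrib sum_delta_real card_scaled_square_roots[OF two a]) (simp add: q_def)
    finally have "q * diag_count (a # as) t =
        q * (q ^ (2 * k) + quad_char t * (s ^ k * quad_char (prod_list (a # as))) * q ^ k)"
      by (simp add: p_def algebra_simps quad_char_mult[OF two])
    thus ?case using q0 by (simp only: s_def) simp
  }
qed

section \<open>Symmetric bilinear forms on finite vector spaces\<close>

definition adjoin :: "'a::field ^ 'k \<Rightarrow> ('a ^ 'k) set \<Rightarrow> ('a ^ 'k) set" where
  "adjoin x S = vec.span (insert x S)"

lemma subspace_adjoin [simp]: "vec.subspace (adjoin x S)"
  by (simp add: adjoin_def vec.subspace_span)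

lemma adjoin_iff: "vec.subspace S \<Longrightarrow> y \<in> adjoin x S \<longleftrightarrow> (\<exists>c. \<exists>s\<in>S. y = c *s x + s)"
proof -
  assume S: "vec.subspace S"
  have sp: "vec.span S = S" using S by simp
  have "y \<in> adjoin x S \<longleftrightarrow> (\<exists>c. y - c *s x \<in> S)"
    unfolding adjoin_def vec.span_breakdown_eq sp ..
  also have "\<dots> \<longleftrightarrow> (\<exists>c. \<exists>s\<in>S. y = c *s x + s)"
  proof -
    have "y - c *s x \<in> S \<longleftrightarrow> (\<exists>s\<in>S. y = c *s x + s)" for c
      by (auto simp: algebra_simps intro: bexI[of _ "y - c *s x"])
    thus ?thesis by simp
  qed
  finally show ?thesis .
qed

lemma adjoin_self: "x \<in> adjoin x S"
  by (simp add: adjoin_def vec.span_base)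

lemma adjoin_superset: "S \<subseteq> adjoin x S"
  by (auto simp: adjoin_def intro: vec.span_base)

lemma adjoin_memI: "vec.subspace S \<Longrightarrow> s \<in> S \<Longrightarrow> c *s x + s \<in> adjoin x S"
  by (subst adjoin_iff) auto

lemma adjoin_minimal: "x \<in> T \<Longrightarrow> S \<subseteq> T \<Longrightarrow> vec.subspace T \<Longrightarrow> adjoin x S \<subseteq> T"
  unfolding adjoin_def by (rule vec.span_minimal) auto

lemma adjoin_mono: "S \<subseteq> T \<Longrightarrow> adjoin x S \<subseteq> adjoin x T"
  unfolding adjoin_def by (rule vec.span_mono) auto

lemma adjoin_span: "adjoin x (vec.span B) = vec.span (insert x B)"
proof
  have "vec.span B \<subseteq> vec.span (insert x B)" by (rule vec.span_mono) auto
  thus "adjoin x (vec.span B) \<subseteq> vec.span (insert x B)"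
    by (intro adjoin_minimal) (auto simp: vec.span_base vec.subspace_span)
  show "vec.span (insert x B) \<subseteq> adjoin x (vec.span B)"
    unfolding adjoin_def by (intro vec.span_mono) (auto simp: vec.span_base)
qed

lemma adjoin_commute: "adjoin x (adjoin y S) = adjoin y (adjoin (x::'a::field ^ 'k) S)"
proof -
  have "adjoin x (adjoin y S) = vec.span (insert x (insert y S))" for x y :: "'a ^ 'k"
    unfolding adjoin_def[of y] by (rule adjoin_span)
  thus ?thesis by (simp add: insert_commute)
qed

lemma adjoin_shift:
  assumes S: "vec.subspace S" and s: "s \<in> S" and c: "c \<noteq> 0"
  shows "adjoin (c *s x + s) S = adjoin x S"
proof
  show "adjoin (c *s x + s) S \<subseteq> adjoin x S"
    by (rule adjoin_minimal) (auto simp: adjoin_superset[THEN subsetD] adjoin_memI S s)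
  have "inverse c *s (c *s x + s) + (- inverse c) *s s = x"
    using c by (simp add: vec.scale_right_distrib del: vec.scale_minus_left) simp
  moreover have "inverse c *s (c *s x + s) + (- inverse c) *s s \<in> adjoin (c *s x + s) S"
    by (intro adjoin_memI S vec.subspace_scale s)
  ultimately show "adjoin x S \<subseteq> adjoin (c *s x + s) S"
    by (intro adjoin_minimal) (auto simp: adjoin_superset[THEN subsetD])
qed

lemma adjoin_coords_unique:
  assumes "vec.subspace S" "x \<notin> S" "s \<in> S" "t \<in> S" "c *s x + s = d *s x + t"
  shows "c = d \<and> s = t"
proof -
  have "(c - d) *s x = t - s"
    using assms(5) by (simp add: vec.scale_left_diff_distrib algebra_simps)
  hence *: "(c - d) *s x \<in> S" using vec.subspace_diff[OF assms(1,4,3)] by simp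
  have "c = d"
  proof (rule ccontr)
    assume "c \<noteq> d"
    hence "x = inverse (c - d) *s ((c - d) *s x)" by simp
    also have "\<dots> \<in> S" by (rule vec.subspace_scale[OF assms(1) *])
    finally show False using assms(2) by simp
  qed
  thus ?thesis using assms(5) by simp
qed

lemma dim_adjoin: "vec.subspace S \<Longrightarrow> x \<notin> S \<Longrightarrow> vec.dim (adjoin x S) = Suc (vec.dim S)"
  unfolding adjoin_def vec.dim_span vec.dim_insert by (simp add: vec.span_eq_iff[THEN iffD2])

lemma card_adjoin:
  fixes S :: "('a::{field,finite} ^ 'k) set"
  assumes S: "vec.subspace S" and x: "x \<notin> S"
  shows "card (adjoin x S) = CARD('a) * card S"
proof -
  have "bij_betw (\<lambda>(c, s). c *s x + s) (UNIV \<times> S) (adjoin x S)"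
  proof (rule bij_betw_imageI)
    show "inj_on (\<lambda>(c, s). c *s x + s) (UNIV \<times> S)"
      using adjoin_coords_unique[OF S x] by (auto simp: inj_on_def)
    show "(\<lambda>(c, s). c *s x + s) ` (UNIV \<times> S) = adjoin x S"
    proof (intro subset_antisym subsetI)
      fix y assume "y \<in> adjoin x S"
      then obtain c s where "s \<in> S" "y = c *s x + s" by (auto simp: adjoin_iff[OF S])
      thus "y \<in> (\<lambda>(c, s). c *s x + s) ` (UNIV \<times> S)" by (intro image_eqI[of _ _ "(c, s)"]) auto
    qed (auto simp: adjoin_memI[OF S])
  qed
  hence "card (UNIV \<times> S :: ('a \<times> _) set) = card (adjoin x S)"
    by (rule bij_betw_same_card)
  thus ?thesis by (simp add: card_cartesian_product)
qed

lemma subspace_induct [consumes 1, case_names zero adjoin]: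
  fixes S :: "('a::{field,finite} ^ 'k) set"
  assumes "vec.subspace S"
    and "P {0}"
    and step: "\<And>T x. vec.subspace T \<Longrightarrow> T \<subseteq> S \<Longrightarrow> x \<in> S \<Longrightarrow> x \<notin> T \<Longrightarrow> P T \<Longrightarrow> P (adjoin x T)"
  shows "P S"
proof -
  obtain B where B: "B \<subseteq> S" "vec.independent B" "S \<subseteq> vec.span B"
    using vec.maximal_independent_subset by blast
  hence S: "S = vec.span B" using assms(1) vec.span_minimal by blast
  have "finite B" by simp
  hence "B \<subseteq> S \<Longrightarrow> vec.independent B \<Longrightarrow> P (vec.span B)"
  proof (induction B)
    case empty
    then show ?case using assms(2) by simp
  next
    case (insert x B)
    have "vec.span B \<subseteq> S" using insert.prems assms(1) by (intro vec.span_minimal) auto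
    moreover have "x \<notin> vec.span B \<and> vec.independent B"
      using insert.prems(2) insert.hyps(2) unfolding vec.independent_insert by simp
    ultimately show ?case
      using insert.IH insert.prems(1) step[of "vec.span B" x] by (simp add: adjoin_span vec.subspace_span)
  qed
  thus ?thesis using B S by simp
qed

lemma card_subspace:
  fixes S :: "('a::{field,finite} ^ 'k) set"
  assumes "vec.subspace S"
  shows "card S = CARD('a) ^ vec.dim S"
  using assms
proof (induction rule: subspace_induct)
  case zero
  then show ?case by simp
next
  case (adjoin T x)
  then show ?case by (simp add: card_adjoin dim_adjoin)
qed

lemma subspace_eqI:
  fixes S :: "('a::{field,finite} ^ 'k) set"
  assumes "vec.subspace S" "vec.subspace T" "S \<subseteq> T" "vec.dim T \<le> vec.dim S"
  shows "S = T"
  using vec.subspace_dim_equal[of S T] assms by auto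

lemma dim_eqI_card:
  fixes S :: "('a::{field,finite} ^ 'k) set"
  assumes "vec.subspace S" "card S = CARD('a) ^ d"
  shows "vec.dim S = d"
proof -
  have "card {0::'a, 1} \<le> CARD('a)" by (intro card_mono) auto
  hence "1 < CARD('a)" by simp
  thus ?thesis using assms card_subspace[OF assms(1)] by simp
qed

text \<open>The form may be degenerate on the whole space; non-degeneracy is required only of
  individual subspaces. \<open>q\<close> and \<open>sig\<close> are parameters so that forms over
  the same field on different ambient spaces share these constants.\<close>

locale sym_form =
  fixes f :: "'a::{field,finite} ^ 'k \<Rightarrow> 'a ^ 'k \<Rightarrow> 'a" and q sig :: real
  assumes f_sym: "f x y = f y x"
    and f_add: "f (x + y) z = f x z + f y z"
    and f_scale: "f (c *s x) z = c * f x z"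
    and two: "(2::'a) \<noteq> 0"
    and q_eq: "q = real CARD('a)"
    and sig_eq: "sig = quad_char (-1::'a)"
begin

lemma q_pos: "q > 0" by (simp add: q_eq)

lemma sig_sq: "sig * sig = 1"
  unfolding sig_eq by (rule quad_char_mult_self) simp

lemma sig_nonzero: "sig \<noteq> 0"
  by (simp add: sig_eq)

lemmas diag_count_odd_even = diag_count_formula[OF two, folded q_eq sig_eq]

lemma f_add_right: "f z (x + y) = f z x + f z y"
  by (simp only: f_sym[of z] f_add)

lemma f_scale_right: "f z (c *s x) = c * f z x"
  by (simp only: f_sym[of z] f_scale)

lemma f_zero: "f 0 z = 0" "f z 0 = 0"
  using f_scale[of 0 0 z] f_scale_right[of z 0 0] by simp_all

lemma f_minus: "f (- x) z = - f x z" "f z (- x) = - f z x"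
  using f_scale[of "-1" x z] f_scale_right[of z "-1" x] by simp_all

lemma f_diff: "f (x - y) z = f x z - f y z" "f z (x - y) = f z x - f z y"
  using f_add[of x "- y" z] f_add_right[of z x "- y"] by (simp_all add: f_minus)

lemmas f_simps = f_add f_add_right f_scale f_scale_right f_zero f_minus f_diff

lemma Q_orth_sum: "f x s = 0 \<Longrightarrow> f (c *s x + s) (c *s x + s) = f x x * c ^ 2 + f s s"
  using f_sym[of x s] by (simp add: f_simps power2_eq_square algebra_simps)

definition rad :: "('a ^ 'k) set \<Rightarrow> ('a ^ 'k) set" where
  "rad S = {v \<in> S. \<forall>w\<in>S. f v w = 0}"

definition orth :: "('a ^ 'k) set \<Rightarrow> ('a ^ 'k) set" where
  "orth S = {v. \<forall>w\<in>S. f v w = 0}"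

lemma subspace_orth [simp]: "vec.subspace (orth S)"
  by (rule vec.subspaceI) (auto simp: orth_def f_simps)

lemma rad_eq: "rad S = S \<inter> orth S"
  by (auto simp: rad_def orth_def)

lemma subspace_rad: "vec.subspace S \<Longrightarrow> vec.subspace (rad S)"
  by (simp add: rad_eq vec.subspace_inter)

lemma orth_adjoin: "vec.subspace S \<Longrightarrow> orth (adjoin x S) = orth S \<inter> {v. f v x = 0}"
proof -
  assume S: "vec.subspace S"
  have "v \<in> orth (adjoin x S)" if "v \<in> orth S" "f v x = 0" for v
    using that by (auto simp: orth_def adjoin_iff[OF S] f_simps)
  moreover have "v \<in> orth S" "f v x = 0" if "v \<in> orth (adjoin x S)" for v
    using that adjoin_self[of x S] adjoin_superset[of S x] by (auto simp: orth_def)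
  ultimately show ?thesis by blast
qed

text \<open>Translations by multiples of \<open>s0\<close> carry any fibre of the functional onto
  any other, so all q fibres are equally large.\<close>

lemma functional_fibre:
  assumes S: "vec.subspace S" and s0: "s0 \<in> S" "f s0 x \<noteq> 0"
  shows "q * real (card {v\<in>S. f v x = c}) = real (card S)"
proof -
  have eq: "card {v\<in>S. f v x = c} = card {v\<in>S. f v x = 0}" for c
    by (rule bij_betw_same_card[OF bij_betw_byWitness
          [of _ "\<lambda>v. v + (c / f s0 x) *s s0" "\<lambda>v. v - (c / f s0 x) *s s0"]])
      (use s0 S in \<open>auto simp: f_simps vec.subspace_add vec.subspace_diff vec.subspace_scale\<close>)
  have "real (card S) = (\<Sum>v\<in>S. 1)" by simp
  also have "\<dots> = (\<Sum>t\<in>UNIV. real (card {v\<in>S. f v x = t}) * 1)"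
    by (rule sum_by_fibers) simp
  also have "\<dots> = (\<Sum>t\<in>(UNIV::'a set). real (card {v\<in>S. f v x = c}))"
  proof (intro sum.cong refl)
    fix t
    have "card {v\<in>S. f v x = t} = card {v\<in>S. f v x = c}" by (rule trans[OF eq eq[symmetric]])
    thus "real (card {v\<in>S. f v x = t}) * 1 = real (card {v\<in>S. f v x = c})" by simp
  qed
  finally show ?thesis by (simp add: q_eq)
qed

lemma card_level_adjoin:
  assumes S: "vec.subspace S" and x: "x \<notin> S" and o: "\<forall>y\<in>S. f x y = 0"
  shows "card {v \<in> adjoin x S. f v v = t} = (\<Sum>c\<in>UNIV. card {s\<in>S. f s s = t - f x x * c ^ 2})"
proof -
  have "bij_betw (\<lambda>(c, s). c *s x + s) (SIGMA c:UNIV. {s\<in>S. f s s = t - f x x * c ^ 2})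
          {v \<in> adjoin x S. f v v = t}"
  proof (rule bij_betw_imageI)
    show "inj_on (\<lambda>(c, s). c *s x + s) (SIGMA c:UNIV. {s\<in>S. f s s = t - f x x * c ^ 2})"
      using adjoin_coords_unique[OF S x] by (auto simp: inj_on_def)
    show "(\<lambda>(c, s). c *s x + s) ` (SIGMA c:UNIV. {s\<in>S. f s s = t - f x x * c ^ 2}) =
        {v \<in> adjoin x S. f v v = t}" (is "?L = ?R")
    proof
      show "?L \<subseteq> ?R" using o by (auto simp: adjoin_iff[OF S] Q_orth_sum)
      show "?R \<subseteq> ?L"
      proof
        fix v assume "v \<in> ?R"
        then obtain c s where cs: "s \<in> S" "v = c *s x + s" "f v v = t"
          by (auto simp: adjoin_iff[OF S])
        hence "f s s = t - f x x * c ^ 2" using o Q_orth_sum[of x s c] by (simp add: eq_diff_eq add.commute)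
        thus "v \<in> ?L" using cs by (auto intro!: image_eqI[of _ _ "(c, s)"])
      qed
    qed
  qed
  from bij_betw_same_card[OF this] show ?thesis by simp
qed

text \<open>\<open>S\<close> has an orthogonal basis on which \<open>v \<mapsto> f v v\<close> takes the nonzero values \<open>as\<close> and \<open>m\<close>
  times the value \<open>0\<close>.\<close>

inductive diag :: "('a ^ 'k) set \<Rightarrow> 'a list \<Rightarrow> nat \<Rightarrow> bool" where
  zero: "diag {0} [] 0"
| nonsing: "diag S as m \<Longrightarrow> \<forall>y\<in>S. f x y = 0 \<Longrightarrow> f x x \<noteq> 0 \<Longrightarrow> diag (adjoin x S) (f x x # as) m"
| sing: "diag S as m \<Longrightarrow> \<forall>y\<in>S. f x y = 0 \<Longrightarrow> f x x = 0 \<Longrightarrow> x \<notin> S \<Longrightarrow> diag (adjoin x S) as (Suc m)"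

lemma diag_subspace: "diag S as m \<Longrightarrow> vec.subspace S"
  by (induction rule: diag.induct) auto

lemma diag_nonzero: "diag S as m \<Longrightarrow> 0 \<notin> set as"
  by (induction rule: diag.induct) auto

lemma diag_dim: "diag S as m \<Longrightarrow> vec.dim S = length as + m"
proof (induction rule: diag.induct)
  case (nonsing S as m x)
  hence "x \<notin> S" by auto
  with nonsing show ?case by (simp add: dim_adjoin diag_subspace)
qed (simp_all add: dim_adjoin diag_subspace)

lemma rad_adjoin_nonsing:
  assumes S: "vec.subspace S" and o: "\<forall>y\<in>S. f x y = 0" and x: "f x x \<noteq> 0"
  shows "rad (adjoin x S) = rad S"
proof -
  have o': "f y x = 0" if "y \<in> S" for y using o that f_sym[of x y] by simp
  show ?thesis
  proof
    show "rad S \<subseteq> rad (adjoin x S)"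
      using o' by (auto simp: rad_def adjoin_iff[OF S] f_simps) (auto intro: exI[of _ 0])
    show "rad (adjoin x S) \<subseteq> rad S"
    proof
      fix v assume v: "v \<in> rad (adjoin x S)"
      then obtain c s where cs: "s \<in> S" "v = c *s x + s"
        by (auto simp: rad_def adjoin_iff[OF S])
      have "f v x = 0" using v adjoin_self by (auto simp: rad_def)
      hence "c = 0" using cs x o' by (simp add: f_simps)
      thus "v \<in> rad S" using cs v adjoin_superset[of S x] by (auto simp: rad_def)
    qed
  qed
qed

lemma rad_adjoin_sing:
  assumes S: "vec.subspace S" and o: "\<forall>y\<in>S. f x y = 0" and x: "f x x = 0"
  shows "rad (adjoin x S) = adjoin x (rad S)"
proof -
  have o': "f y x = 0" if "y \<in> S" for y using o that f_sym[of x y] by simp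
  show ?thesis
  proof
    have "v \<in> rad (adjoin x S)" if v: "v \<in> adjoin x (rad S)" for v
    proof -
      obtain c s where cs: "s \<in> rad S" "v = c *s x + s"
        using v by (auto simp: adjoin_iff[OF subspace_rad[OF S]])
      have "f v w = 0" if w: "w \<in> adjoin x S" for w
      proof -
        obtain d t where "t \<in> S" "w = d *s x + t" using w by (auto simp: adjoin_iff[OF S])
        thus ?thesis using cs o o' x by (simp add: f_simps rad_def)
      qed
      thus ?thesis using cs by (auto simp: rad_def adjoin_memI[OF S])
    qed
    thus "adjoin x (rad S) \<subseteq> rad (adjoin x S)" by blast
    have "v \<in> adjoin x (rad S)" if v: "v \<in> rad (adjoin x S)" for v
    proof -
      obtain c s where cs: "s \<in> S" "v = c *s x + s"
        using v by (auto simp: rad_def adjoin_iff[OF S])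
      have "f s w = 0" if w: "w \<in> S" for w
      proof -
        have "f v w = 0" using v w adjoin_superset[of S x] by (auto simp: rad_def)
        thus ?thesis using cs w o by (simp add: f_simps)
      qed
      thus ?thesis using cs by (auto simp: rad_def intro!: adjoin_memI subspace_rad[OF S, unfolded rad_def])
    qed
    thus "rad (adjoin x S) \<subseteq> adjoin x (rad S)" by blast
  qed
qed

lemma diag_rad_dim: "diag S as m \<Longrightarrow> vec.dim (rad S) = m"
proof (induction rule: diag.induct)
  case zero
  have "rad {0} = {0}" by (auto simp: rad_def f_simps)
  then show ?case by simp
next
  case (nonsing S as m x)
  then show ?case by (simp add: rad_adjoin_nonsing diag_subspace)
next
  case (sing S as m x)
  hence "x \<notin> rad S" by (auto simp: rad_def)
  with sing show ?case by (simp add: rad_adjoin_sing diag_subspace dim_adjoin subspace_rad)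
qed

lemma diag_level_count:
  "diag S as m \<Longrightarrow> real (card {v\<in>S. f v v = t}) = q ^ m * diag_count as t"
proof (induction arbitrary: t rule: diag.induct)
  case zero
  have "{v \<in> {0}. f v v = t} = (if t = 0 then {0} else {})" by (auto simp: f_simps)
  then show ?case by simp
next
  case (nonsing S as m x)
  hence "x \<notin> S" by auto
  with nonsing show ?case
    by (simp add: card_level_adjoin diag_subspace sum_distrib_left q_eq)
next
  case (sing S as m x)
  thus ?case
    by (simp add: card_level_adjoin diag_subspace q_eq)
qed

lemma diag_isotropic:
  assumes "vec.subspace S" "\<forall>x\<in>S. \<forall>y\<in>S. f x y = 0"
  shows "\<exists>m. diag S [] m"
  using assms
proof (induction rule: subspace_induct)
  case zero
  then show ?case using diag.zero by auto
next
  case (adjoin T x)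
  thus ?case using diag.sing[of T "[]" _ x] adjoin_superset[of T x] adjoin_self[of x T]
    by blast
qed

lemma isotropic_f_zero:
  assumes "vec.subspace S" "\<forall>x\<in>S. f x x = 0" "x \<in> S" "y \<in> S"
  shows "f x y = 0"
proof -
  have "f (x + y) (x + y) = 0" using assms vec.subspace_add by blast
  hence "2 * f x y = 0" using assms by (simp add: f_simps f_sym[of y x])
  thus ?thesis using two by simp
qed

lemma orth_split:
  assumes S: "vec.subspace S" and x: "x \<in> S" "f x x \<noteq> 0"
  shows "S = adjoin x (S \<inter> orth {x})"
proof
  have T: "vec.subspace (S \<inter> orth {x})" by (rule vec.subspace_inter[OF S subspace_orth])
  show "S \<subseteq> adjoin x (S \<inter> orth {x})"
  proof
    fix y assume y: "y \<in> S"
    have "y - (f y x / f x x) *s x \<in> S \<inter> orth {x}"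
      using S x y by (auto simp: orth_def f_simps vec.subspace_diff vec.subspace_scale)
    from adjoin_memI[OF T this, of "f y x / f x x" x] show "y \<in> adjoin x (S \<inter> orth {x})" by simp
  qed
  show "adjoin x (S \<inter> orth {x}) \<subseteq> S" using S x by (intro adjoin_minimal) auto
qed

text \<open>An anisotropic vector is split off as long as there is one. If all norms vanish, the
  subspace is totally isotropic because 2 is invertible.\<close>

lemma diag_exists: "vec.subspace S \<Longrightarrow> \<exists>as m. diag S as m"
proof (induction "vec.dim S" arbitrary: S rule: less_induct)
  case less
  show ?case
  proof (cases "\<forall>x\<in>S. f x x = 0")
    case True
    with less.prems isotropic_f_zero[OF less.prems True] diag_isotropic show ?thesis by blast
  next
    case False
    then obtain x where x: "x \<in> S" "f x x \<noteq> 0" by blast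
    let ?T = "S \<inter> orth {x}"
    have T: "vec.subspace ?T" by (rule vec.subspace_inter[OF less.prems subspace_orth])
    have "x \<notin> ?T" using x by (auto simp: orth_def)
    have S: "S = adjoin x ?T" by (rule orth_split) (use less.prems x in auto)
    have "vec.dim (adjoin x ?T) = Suc (vec.dim ?T)" by (rule dim_adjoin[OF T \<open>x \<notin> ?T\<close>])
    hence "vec.dim ?T < vec.dim S" unfolding S[symmetric] by simp
    then obtain as m where "diag ?T as m" using less.hyps[of ?T] T by auto
    moreover have "\<forall>y\<in>?T. f x y = 0" by (simp add: orth_def f_sym[of x])
    ultimately have "diag (adjoin x ?T) (f x x # as) m" using x by (intro diag.nonsing)
    thus ?thesis unfolding S[symmetric] by blast
  qed
qed

lemma prod_list_nonzero: "0 \<notin> set as \<Longrightarrow> prod_list as \<noteq> (0::'a)"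
  by (induction as) auto

text \<open>The square class of the product is recovered from the number of vectors of norm 1, in
  which it occurs with a nonzero coefficient. This takes the place of the determinant of a change of
  basis.\<close>

lemma diag_unique:
  assumes "diag S as m" "diag S bs l"
  shows "m = l" "length as = length bs" "quad_char (prod_list as) = quad_char (prod_list bs)"
proof -
  show ml: "m = l" using assms diag_rad_dim by blast
  thus len: "length as = length bs" using diag_dim[OF assms(1)] diag_dim[OF assms(2)] by simp
  have "q ^ m * diag_count as 1 = q ^ m * diag_count bs 1"
    using diag_level_count[OF assms(1), of 1] diag_level_count[OF assms(2), of 1]
    unfolding ml by (rule trans[OF sym])
  hence cnt: "diag_count as 1 = diag_count bs 1" using q_pos by simp
  note nz = diag_nonzero[OF assms(1)] diag_nonzero[OF assms(2)]
  show "quad_char (prod_list as) = quad_char (prod_list bs)"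
  proof (cases "even (length as)")
    case True
    then obtain k where k: "length as = 2 * k" by blast
    have "q ^ (2 * k) + sig ^ k * quad_char (prod_list as) * ((if (1::'a) = 0 then q else 0) - 1) * q ^ k =
        q ^ (2 * k) + sig ^ k * quad_char (prod_list bs) * ((if (1::'a) = 0 then q else 0) - 1) * q ^ k"
      using diag_count_odd_even(1)[OF nz(1) k] diag_count_odd_even(1)[OF nz(2) k[unfolded len]] cnt
      by metis
    thus ?thesis using sig_nonzero q_pos by simp
  next
    case False
    then obtain k where k: "length as = 2 * k + 1" by (elim oddE)
    have "q ^ (2 * k) + quad_char (1::'a) * (sig ^ k * quad_char (prod_list as)) * q ^ k =
        q ^ (2 * k) + quad_char (1::'a) * (sig ^ k * quad_char (prod_list bs)) * q ^ k"
      using diag_count_odd_even(2)[OF nz(1) k] diag_count_odd_even(2)[OF nz(2) k[unfolded len]] cnt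
      by metis
    thus ?thesis using sig_nonzero q_pos by simp
  qed
qed

section \<open>Corank, discriminant character and orthogonal decomposition\<close>

definition corank :: "('a ^ 'k) set \<Rightarrow> nat" where "corank S = vec.dim (rad S)"

text \<open>The quadratic character of the discriminant of the form induced on S modulo its radical.
  By \<open>diag_unique\<close> the chosen value is the only possible one.\<close>

definition disc_char :: "('a ^ 'k) set \<Rightarrow> real" where
  "disc_char S = (SOME s. \<exists>as m. diag S as m \<and> s = quad_char (prod_list as))"

lemma diag_disc_char: "diag S as m \<Longrightarrow> disc_char S = quad_char (prod_list as)"
proof -
  assume d: "diag S as m"
  have "(\<lambda>s. \<exists>bs l. diag S bs l \<and> s = quad_char (prod_list bs)) (disc_char S)"
    unfolding disc_char_def by (rule someI[of _ "quad_char (prod_list as)"]) (intro exI conjI, rule d, rule refl)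
  then obtain bs l where "diag S bs l" "disc_char S = quad_char (prod_list bs)" by auto
  thus ?thesis using diag_unique(3)[OF d] by simp
qed

lemma diag_corank: "diag S as m \<Longrightarrow> corank S = m"
  by (simp add: corank_def diag_rad_dim)

lemma disc_char_sq: "vec.subspace S \<Longrightarrow> disc_char S * disc_char S = 1"
proof -
  assume "vec.subspace S"
  then obtain as m where d: "diag S as m" using diag_exists by blast
  show ?thesis
    unfolding diag_disc_char[OF d]
    by (rule quad_char_mult_self[OF prod_list_nonzero[OF diag_nonzero[OF d]]])
qed

lemma corank_0_iff: "vec.subspace S \<Longrightarrow> corank S = 0 \<longleftrightarrow> rad S = {0}"
proof -
  assume S: "vec.subspace S"
  hence "0 \<in> rad S" using subspace_rad vec.subspace_0 by blast
  moreover have "corank S = 0 \<longleftrightarrow> rad S \<subseteq> {0}"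
    unfolding corank_def by (rule vec.dim_eq_0)
  ultimately show ?thesis by blast
qed

lemma disc_char_adjoin_nonsing:
  assumes S: "vec.subspace S" and o: "\<forall>y\<in>S. f x y = 0" and x: "f x x \<noteq> 0"
  shows "disc_char (adjoin x S) = quad_char (f x x) * disc_char S" "corank (adjoin x S) = corank S"
proof -
  obtain as m where d: "diag S as m" using diag_exists S by blast
  from diag.nonsing[OF d o x] d show "disc_char (adjoin x S) = quad_char (f x x) * disc_char S"
      "corank (adjoin x S) = corank S"
    by (simp_all add: diag_disc_char diag_corank quad_char_mult[OF two])
qed

lemma disc_char_adjoin_sing:
  assumes S: "vec.subspace S" and o: "\<forall>y\<in>S. f x y = 0" and x: "f x x = 0" "x \<notin> S"
  shows "disc_char (adjoin x S) = disc_char S" "corank (adjoin x S) = Suc (corank S)"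
proof -
  obtain as m where d: "diag S as m" using diag_exists S by blast
  from diag.sing[OF d o x] d show "disc_char (adjoin x S) = disc_char S"
      "corank (adjoin x S) = Suc (corank S)"
    by (simp_all add: diag_disc_char diag_corank)
qed

text \<open>Induction on an orthogonal basis of T. Non-degeneracy of T is stated as the equation
  \<open>l = 0\<close>, which rules out the case \<open>sing\<close>.\<close>

lemma diag_union:
  assumes "diag T bs l" "l = 0" "diag S as m" "\<forall>x\<in>S. \<forall>y\<in>T. f x y = 0"
  shows "diag (vec.span (S \<union> T)) (bs @ as) m"
  using assms(1,2,4)
proof (induction rule: diag.induct)
  case zero
  have "0 \<in> S" using diag_subspace[OF assms(3)] by (simp add: vec.subspace_0)
  hence "vec.span (S \<union> {0}) = S" using diag_subspace[OF assms(3)] by (simp add: insert_absorb)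
  then show ?case using assms(3) by (simp only: append_Nil)
next
  case (nonsing T bs l x)
  have "adjoin x (vec.span (S \<union> T)) = vec.span (S \<union> adjoin x T)"
  proof
    have "vec.span (S \<union> T) \<subseteq> vec.span (S \<union> adjoin x T)"
      using adjoin_superset[of T x] by (intro vec.span_mono) auto
    thus "adjoin x (vec.span (S \<union> T)) \<subseteq> vec.span (S \<union> adjoin x T)"
      by (intro adjoin_minimal) (auto simp: vec.span_base adjoin_self)
    have "adjoin x T \<subseteq> adjoin x (vec.span (S \<union> T))" by (intro adjoin_mono) (auto simp: vec.span_base)
    moreover have "S \<subseteq> adjoin x (vec.span (S \<union> T))"
      using adjoin_superset[of "vec.span (S \<union> T)" x] by (auto simp: vec.span_base)
    ultimately show "vec.span (S \<union> adjoin x T) \<subseteq> adjoin x (vec.span (S \<union> T))"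
      by (intro vec.span_minimal) auto
  qed
  moreover have "\<forall>y\<in>vec.span (S \<union> T). f x y = 0"
  proof -
    have "f x y = 0" if "y \<in> S \<union> T" for y
    proof (cases "y \<in> T")
      case True
      thus ?thesis using nonsing.hyps(2) by blast
    next
      case False
      hence "f y x = 0" using that nonsing.prems(2) adjoin_self[of x T] by blast
      thus ?thesis by (simp only: f_sym[of x])
    qed
    hence "S \<union> T \<subseteq> orth {x}" by (auto simp: orth_def f_sym[of _ x])
    hence "vec.span (S \<union> T) \<subseteq> orth {x}" by (rule vec.span_minimal[OF _ subspace_orth])
    thus ?thesis by (auto simp: orth_def f_sym[of x])
  qed
  moreover have "diag (vec.span (S \<union> T)) (bs @ as) m"
    using nonsing.prems adjoin_superset[of T x] by (intro nonsing.IH) auto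
  ultimately show ?case using diag.nonsing[of "vec.span (S \<union> T)" "bs @ as" m x] nonsing.hyps by simp
qed auto

lemma projection:
  assumes S: "vec.subspace S" "corank S = 0"
  shows "\<exists>s\<in>S. x - s \<in> orth S"
proof -
  have *: "\<exists>s\<in>S. x - s \<in> orth S" if "diag S as m" "m = 0" for S as m
    using that
  proof (induction rule: diag.induct)
    case zero
    then show ?case by (auto simp: orth_def f_simps)
  next
    case (nonsing S as m y)
    then obtain s where s: "s \<in> S" "x - s \<in> orth S" by blast
    note S = diag_subspace[OF nonsing.hyps(1)]
    define c where "c = f (x - s) y / f y y"
    have "x - (c *s y + s) \<in> orth (adjoin y S)"
    proof -
      have e: "x - (c *s y + s) = (x - s) - c *s y" by simp
      have "(x - s) - c *s y \<in> orth S" using s nonsing.hyps by (auto simp: orth_def f_simps)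
      moreover have "f ((x - s) - c *s y) y = 0" using nonsing.hyps by (simp add: f_simps c_def)
      ultimately show ?thesis unfolding orth_adjoin[OF S] e by blast
    qed
    thus ?case using adjoin_memI[OF S s(1)] by blast
  qed auto
  obtain as m where "diag S as m" using diag_exists S by blast
  with * S diag_corank show ?thesis by blast
qed

lemma orth_decomp:
  assumes V: "vec.subspace V" and S: "vec.subspace S" "corank S = 0" "S \<subseteq> V"
  defines "M \<equiv> V \<inter> orth S"
  shows "vec.subspace M" "V = vec.span (M \<union> S)" "rad V = rad M" "corank V = corank M"
    "disc_char V = disc_char S * disc_char M" "vec.dim V = vec.dim S + vec.dim M" "S \<inter> M = {0}"
proof -
  show M: "vec.subspace M" using V by (simp add: M_def vec.subspace_inter)
  have dec: "\<exists>s\<in>S. v - s \<in> M" if "v \<in> V" for v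
  proof -
    obtain s where s: "s \<in> S" "v - s \<in> orth S" using projection S by blast
    moreover have "v - s \<in> V" using s S that V by (auto simp: vec.subspace_diff)
    ultimately show ?thesis by (auto simp: M_def)
  qed
  show span: "V = vec.span (M \<union> S)"
  proof
    show "V \<subseteq> vec.span (M \<union> S)"
    proof
      fix v assume "v \<in> V"
      then obtain s where "s \<in> S" "v - s \<in> M" using dec by blast
      hence "s + (v - s) \<in> vec.span (M \<union> S)" by (intro vec.span_add) (auto simp: vec.span_base)
      thus "v \<in> vec.span (M \<union> S)" by simp
    qed
    show "vec.span (M \<union> S) \<subseteq> V" using V S by (intro vec.span_minimal) (auto simp: M_def)
  qed
  obtain as l where a: "diag S as l" using diag_exists S by blast
  have l: "l = 0" using a S diag_corank by simp
  obtain bs m where b: "diag M bs m" using diag_exists M by blast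
  have "\<forall>x\<in>M. \<forall>y\<in>S. f x y = 0" by (auto simp: M_def orth_def)
  from diag_union[OF a l b this] have d: "diag V (as @ bs) m" using span by simp
  show "corank V = corank M" "disc_char V = disc_char S * disc_char M" "vec.dim V = vec.dim S + vec.dim M"
    using d a b l by (simp_all add: diag_corank diag_disc_char diag_dim quad_char_mult[OF two])
  have "rad S = {0}" using S corank_0_iff by simp
  thus "S \<inter> M = {0}" using vec.subspace_0[OF M] vec.subspace_0[OF S(1)] by (auto simp: M_def rad_eq)
  show "rad V = rad M"
  proof
    show "rad V \<subseteq> rad M" using S by (auto simp: rad_def M_def orth_def)
    show "rad M \<subseteq> rad V"
    proof
      fix v assume v: "v \<in> rad M"
      have "f v w = 0" if w: "w \<in> V" for w
      proof -
        obtain s where s: "s \<in> S" "w - s \<in> M" using dec w by blast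
        have "f v (w - s) = 0" "f v s = 0" using v s by (auto simp: rad_def M_def orth_def)
        thus ?thesis by (simp add: f_simps)
      qed
      thus "v \<in> rad V" using v by (auto simp: rad_def M_def)
    qed
  qed
qed

lemma level_count:
  assumes "vec.subspace M" "corank M = 0"
  shows "vec.dim M = 2 * k \<Longrightarrow> q * real (card {v\<in>M. f v v = t}) =
           q ^ (2 * k) + sig ^ k * disc_char M * ((if t = 0 then q else 0) - 1) * q ^ k"
    and "vec.dim M = 2 * k + 1 \<Longrightarrow> real (card {v\<in>M. f v v = t}) =
           q ^ (2 * k) + quad_char t * (sig ^ k * disc_char M) * q ^ k"
proof -
  obtain as m where d: "diag M as m" using diag_exists assms by blast
  have m: "m = 0" using d assms diag_corank by simp
  have nz: "0 \<notin> set as" using d diag_nonzero by blast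
  show "q * real (card {v\<in>M. f v v = t}) =
           q ^ (2 * k) + sig ^ k * disc_char M * ((if t = 0 then q else 0) - 1) * q ^ k" if "vec.dim M = 2 * k"
  proof -
    have "length as = 2 * k" using that diag_dim[OF d] m by simp
    thus ?thesis using diag_level_count[OF d, of t] diag_count_odd_even(1)[OF nz, of k t] m
      by (simp add: diag_disc_char[OF d])
  qed
  show "real (card {v\<in>M. f v v = t}) =
           q ^ (2 * k) + quad_char t * (sig ^ k * disc_char M) * q ^ k" if "vec.dim M = 2 * k + 1"
  proof -
    have "length as = 2 * k + 1" using that diag_dim[OF d] m by simp
    thus ?thesis using diag_level_count[OF d, of t] diag_count_odd_even(2)[OF nz, of k t] m
      by (simp add: diag_disc_char[OF d])
  qed
qed

end

section \<open>Complements of a subspace\<close>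

definition complements :: "('a::field ^ 'k) set \<Rightarrow> ('a ^ 'k) set \<Rightarrow> ('a ^ 'k) set set" where
  "complements V P = {S. vec.subspace S \<and> S \<subseteq> V \<and> S \<inter> P = {0} \<and> (\<forall>v\<in>V. \<exists>s\<in>S. v - s \<in> P)}"

lemma complementsD:
  assumes "S \<in> complements V P"
  shows "vec.subspace S" "S \<subseteq> V" "S \<inter> P = {0}" "v \<in> V \<Longrightarrow> \<exists>s\<in>S. v - s \<in> P"
  using assms by (auto simp: complements_def)

lemma dim_complements:
  fixes V :: "('a::{field,finite} ^ 'k) set"
  assumes V: "vec.subspace V" and P: "vec.subspace P" "P \<subseteq> V" and S: "S \<in> complements V P"
  shows "vec.dim S + vec.dim P = vec.dim V"
proof -
  note S = complementsD[OF S]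
  have "bij_betw (\<lambda>(s, p). s + p) (S \<times> P) V"
  proof (rule bij_betw_imageI)
    show "inj_on (\<lambda>(s, p). s + p) (S \<times> P)"
    proof (rule inj_onI, clarify)
      fix s p s' p' assume a: "s \<in> S" "p \<in> P" "s' \<in> S" "p' \<in> P" "s + p = s' + p'"
      hence "s - s' = p' - p" by (simp add: algebra_simps)
      hence "s - s' \<in> S \<inter> P" using a vec.subspace_diff[OF S(1), of s s'] vec.subspace_diff[OF P(1), of p' p]
        by auto
      hence "s = s'" using S(3) by auto
      thus "s = s' \<and> p = p'" using a by simp
    qed
    show "(\<lambda>(s, p). s + p) ` (S \<times> P) = V"
    proof (intro subset_antisym subsetI)
      fix v assume "v \<in> V"
      then obtain s where "s \<in> S" "v - s \<in> P" using S(4) by blast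
      thus "v \<in> (\<lambda>(s, p). s + p) ` (S \<times> P)" by (intro image_eqI[of _ _ "(s, v - s)"]) auto
    next
      fix v assume "v \<in> (\<lambda>(s, p). s + p) ` (S \<times> P)"
      then obtain s p where "v = s + p" "s \<in> V" "p \<in> V" using S(2) P(2) by auto
      thus "v \<in> V" using vec.subspace_add[OF V] by simp
    qed
  qed
  from bij_betw_same_card[OF this] have "card S * card P = card V" by (simp add: card_cartesian_product)
  hence "CARD('a) ^ vec.dim V = CARD('a) ^ (vec.dim S + vec.dim P)"
    using card_subspace[OF V] card_subspace[OF P(1)] card_subspace[OF S(1)] by (simp add: power_add)
  moreover have "card {0::'a, 1} \<le> CARD('a)" by (intro card_mono) auto
  ultimately show ?thesis by simp
qed

text \<open>A complement R of P in \<open>adjoin e V\<close> contains exactly one vector e + v of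
  the coset e + P, and it is spanned by this vector and R \<inter> V, a complement of P in
  V.\<close>

lemma adjoin_complements_bij:
  fixes V :: "('a::{field,finite} ^ 'k) set"
  assumes V: "vec.subspace V" and P: "vec.subspace P" "P \<subseteq> V" and e: "e \<notin> V"
  shows "bij_betw (\<lambda>(S, v). adjoin (e + v) S) (complements V P \<times> P) (complements (adjoin e V) P)"
proof (rule bij_betw_imageI)
  have ev: "e + v \<notin> V" if "v \<in> P" for v
    using e that P vec.subspace_diff[OF V, of "e + v" v] by auto
  have cut: "adjoin (e + v) S \<inter> V = S" if S: "S \<in> complements V P" and v: "v \<in> P" for S v
  proof (intro subset_antisym subsetI)
    fix y assume y: "y \<in> adjoin (e + v) S \<inter> V"
    then obtain c s where cs: "s \<in> S" "y = c *s (e + v) + s"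
      using adjoin_iff[OF complementsD(1)[OF S]] by auto
    have "0 *s (e + v) + y = c *s (e + v) + s" using cs by simp
    hence "0 = c \<and> y = s"
      using adjoin_coords_unique[OF V ev[OF v], of y s 0 c] y cs complementsD(2)[OF S] by auto
    thus "y \<in> S" using cs by simp
  next
    fix y assume "y \<in> S" thus "y \<in> adjoin (e + v) S \<inter> V"
      using complementsD(2)[OF S] adjoin_superset by blast
  qed
  have zero: "S \<inter> P = {0}" if "vec.subspace S" "\<And>y. y \<in> S \<Longrightarrow> y \<in> P \<Longrightarrow> y = 0" for S
    using that vec.subspace_0[OF P(1)] vec.subspace_0[of S] by auto
  have mem: "adjoin (e + v) S \<in> complements (adjoin e V) P" if S: "S \<in> complements V P" and v: "v \<in> P" for S v
    unfolding complements_def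
  proof (intro CollectI conjI ballI)
    have v': "v \<in> V" using v P by blast
    show "vec.subspace (adjoin (e + v) S)" by simp
    have "1 *s e + v \<in> adjoin e V" using adjoin_memI[OF V v'] .
    thus "adjoin (e + v) S \<subseteq> adjoin e V"
      using complementsD(2)[OF S] adjoin_superset[of V e] by (intro adjoin_minimal) auto
    show "adjoin (e + v) S \<inter> P = {0}"
    proof (rule zero)
      fix y assume "y \<in> adjoin (e + v) S" "y \<in> P"
      hence "y \<in> S \<inter> P" using cut[OF S v] P by blast
      thus "y = 0" using complementsD(3)[OF S] by simp
    qed simp
    fix x assume "x \<in> adjoin e V"
    then obtain c w where cw: "w \<in> V" "x = c *s e + w" using adjoin_iff[OF V] by auto
    hence "w - c *s v \<in> V" using V v' by (auto intro: vec.subspace_diff vec.subspace_scale)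
    then obtain s where s: "s \<in> S" "w - c *s v - s \<in> P" using complementsD(4)[OF S] by blast
    have "x - (c *s (e + v) + s) = w - c *s v - s" using cw by (simp add: vec.scale_right_distrib)
    hence "x - (c *s (e + v) + s) \<in> P" using s(2) by (simp only:)
    thus "\<exists>s\<in>adjoin (e + v) S. x - s \<in> P"
      by (rule bexI[OF _ adjoin_memI[OF complementsD(1)[OF S] s(1)]])
  qed
  show "inj_on (\<lambda>(S, v). adjoin (e + v) S) (complements V P \<times> P)"
  proof (rule inj_onI, clarify)
    fix S v S' v' assume a: "S \<in> complements V P" "v \<in> P" "S' \<in> complements V P" "v' \<in> P"
      and eq: "adjoin (e + v) S = adjoin (e + v') S'"
    have "S = S'" using cut[OF a(1,2)] cut[OF a(3,4)] eq by simp
    have "(e + v) - (e + v') \<in> adjoin (e + v) S"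
      using adjoin_self[of "e + v" S] adjoin_self[of "e + v'" S'] eq by (intro vec.subspace_diff) auto
    hence "v - v' \<in> adjoin (e + v) S \<inter> P" using vec.subspace_diff[OF P(1) a(2,4)] by simp
    hence "v = v'" using complementsD(3)[OF mem[OF a(1,2)]] by simp
    thus "S = S' \<and> v = v'" using \<open>S = S'\<close> by simp
  qed
  show "(\<lambda>(S, v). adjoin (e + v) S) ` (complements V P \<times> P) = complements (adjoin e V) P"
  proof (intro subset_antisym subsetI)
    fix S assume S: "S \<in> complements (adjoin e V) P"
    obtain s0 where s0: "s0 \<in> S" "e - s0 \<in> P" using complementsD(4)[OF S adjoin_self] by blast
    define v where "v = - (e - s0)"
    have v: "v \<in> P" "e + v = s0" using s0 vec.subspace_neg[OF P(1) s0(2)] by (auto simp: v_def)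
    note S1 = complementsD(1)[OF S]
    have T1: "vec.subspace (S \<inter> V)" using vec.subspace_inter[OF S1 V] .
    have "S \<inter> V \<in> complements V P"
      unfolding complements_def
    proof (intro CollectI conjI ballI)
      show "S \<inter> V \<inter> P = {0}" using complementsD(3)[OF S] vec.subspace_0[OF V] by auto
      fix w assume w: "w \<in> V"
      then obtain s where s: "s \<in> S" "w - s \<in> P" using complementsD(4)[OF S, of w] adjoin_superset[of V e] by auto
      have "w - s \<in> V" using s P by blast
      hence "w - (w - s) \<in> V" by (rule vec.subspace_diff[OF V w])
      thus "\<exists>s\<in>S \<inter> V. w - s \<in> P" using s by auto
    qed (use T1 in auto)
    moreover have "S = adjoin (e + v) (S \<inter> V)"
    proof (intro subset_antisym subsetI)
      fix y assume y: "y \<in> S"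
      then obtain c w where cw: "w \<in> V" "y = c *s e + w" using complementsD(2)[OF S] adjoin_iff[OF V] by blast
      have "y - c *s (e + v) = w - c *s v" using cw by (simp add: vec.scale_right_distrib)
      moreover have "w - c *s v \<in> V" using cw v P by (intro vec.subspace_diff[OF V] vec.subspace_scale[OF V]) auto
      moreover have "y - c *s (e + v) \<in> S" using y s0 v by (intro vec.subspace_diff[OF S1] vec.subspace_scale[OF S1]) auto
      ultimately have "c *s (e + v) + (y - c *s (e + v)) \<in> adjoin (e + v) (S \<inter> V)"
        by (intro adjoin_memI[OF T1]) auto
      thus "y \<in> adjoin (e + v) (S \<inter> V)" by simp
    next
      fix y assume "y \<in> adjoin (e + v) (S \<inter> V)"
      moreover have "adjoin (e + v) (S \<inter> V) \<subseteq> S" using s0 v S1 by (intro adjoin_minimal) auto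
      ultimately show "y \<in> S" by blast
    qed
    ultimately show "S \<in> (\<lambda>(S, v). adjoin (e + v) S) ` (complements V P \<times> P)"
      using v by (intro image_eqI[of _ _ "(S \<inter> V, v)"]) auto
  qed (use mem in auto)
qed

lemma sum_complements_adjoin:
  fixes V :: "('a::{field,finite} ^ 'k) set" and g :: "_ \<Rightarrow> real"
  assumes "vec.subspace V" "vec.subspace P" "P \<subseteq> V" "e \<notin> V"
  shows "(\<Sum>S\<in>complements (adjoin e V) P. g S) = (\<Sum>S\<in>complements V P. \<Sum>v\<in>P. g (adjoin (e + v) S))"
proof -
  have "(\<Sum>S\<in>complements V P. \<Sum>v\<in>P. g (adjoin (e + v) S)) = (\<Sum>x\<in>complements V P \<times> P. g ((\<lambda>(S, v). adjoin (e + v) S) x))"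
    by (simp add: sum.cartesian_product case_prod_beta)
  also have "\<dots> = (\<Sum>S\<in>complements (adjoin e V) P. g S)"
    by (rule sum.reindex_bij_betw[OF adjoin_complements_bij[OF assms]])
  finally show ?thesis by simp
qed

text \<open>The complements of the line are the graphs of the linear maps from S to it. They are
  counted one dimension at a time: by \<open>sum_complements_adjoin\<close> each new basis vector of
  S contributes a factor q, the number of vectors on the line.\<close>

lemma card_complements_line:
  fixes S :: "('a::{field,finite} ^ 'k) set"
  assumes "vec.subspace S" "r \<notin> S"
  shows "card (complements (adjoin r S) (adjoin r {0})) = CARD('a) ^ vec.dim S"
  using assms(1)
proof (induction rule: subspace_induct)
  case zero
  have "complements (adjoin r {0}) (adjoin r {0}) = {{0}}"
  proof (intro subset_antisym subsetI)
    fix T assume T: "T \<in> complements (adjoin r {0}) (adjoin r {0})"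
    hence "T = {0}" using complementsD(2,3)[OF T] by blast
    thus "T \<in> {{0}}" by simp
  qed (use vec.subspace_0[OF subspace_adjoin[of r "{0}"]] in \<open>auto simp: complements_def\<close>)
  then show ?case by simp
next
  case (adjoin T x)
  have r: "r \<notin> adjoin x T" using assms adjoin.hyps adjoin_minimal by blast
  have rT: "r \<notin> T" using r adjoin_superset by blast
  have x: "x \<notin> adjoin r T"
  proof
    assume "x \<in> adjoin r T"
    then obtain c s where cs: "s \<in> T" "x = c *s r + s" using adjoin_iff[OF adjoin.hyps(1)] by auto
    hence "c \<noteq> 0" using adjoin.hyps by auto
    hence "r = inverse c *s (c *s r)" by simp
    also have "c *s r = x - s" using cs by simp
    also have "inverse c *s (x - s) \<in> adjoin x T"
      using cs adjoin_self[of x T] adjoin_superset[of T x]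
      by (intro vec.subspace_scale vec.subspace_diff) auto
    finally show False using r by simp
  qed
  have r0: "r \<noteq> 0" using assms vec.subspace_0 by blast
  have "real (card (complements (adjoin x (adjoin r T)) (adjoin r {0}))) =
      (\<Sum>S\<in>complements (adjoin r T) (adjoin r {0}). \<Sum>v\<in>adjoin r {0}. 1)"
    using x vec.subspace_0[OF adjoin.hyps(1)] adjoin_mono[of "{0}" T r]
    by (subst sum_complements_adjoin[symmetric]) auto
  also have "\<dots> = real (card (adjoin r {0}) * card (complements (adjoin r T) (adjoin r {0})))" by simp
  also have "card (adjoin r {0}) = CARD('a)" using r0 by (simp add: card_adjoin)
  finally have "card (complements (adjoin x (adjoin r T)) (adjoin r {0})) = CARD('a) * card (complements (adjoin r T) (adjoin r {0}))"
    by (simp only: of_nat_eq_iff)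
  thus ?case using adjoin dim_adjoin[OF adjoin.hyps(1,4)] by (simp add: adjoin_commute[of r])
qed

lemma sum_if_zero:
  assumes "finite P"
  shows "(\<Sum>v\<in>P. if A v then 0 else (y::real)) = real (card P) * y - real (card {v\<in>P. A v}) * y"
proof -
  have "(\<Sum>v\<in>P. if A v then 0 else y) = (\<Sum>v\<in>P. y - (if A v then y else 0))"
    by (intro sum.cong) auto
  thus ?thesis using assms by (simp add: sum_subtractf sum.inter_filter[symmetric])
qed

section \<open>Adjoining a vector to a singular complement\<close>

context sym_form
begin

lemma corank_pos: "vec.subspace S \<Longrightarrow> t \<in> rad S \<Longrightarrow> t \<noteq> 0 \<Longrightarrow> corank S > 0"
  using corank_0_iff[of S] by auto

text \<open>A complement of the radical carries the form induced on the quotient. Omitting the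
  vectors adjoined by the rule \<open>sing\<close> produces one with the same diagonal
  entries.\<close>

lemma nondegenerate_part:
  "diag S as m \<Longrightarrow> \<exists>S0\<subseteq>S. diag S0 as 0 \<and> (\<forall>v\<in>S. \<exists>s\<in>S0. v - s \<in> rad S)"
proof (induction rule: diag.induct)
  case zero
  then show ?case using diag.zero by (auto simp: rad_def f_simps)
next
  case (nonsing S as m x)
  then obtain S0 where S0: "S0 \<subseteq> S" "diag S0 as 0" "\<forall>v\<in>S. \<exists>s\<in>S0. v - s \<in> rad S" by blast
  note sub = diag_subspace[OF nonsing.hyps(1)] diag_subspace[OF S0(2)]
  have "diag (adjoin x S0) (f x x # as) 0" using S0 nonsing.hyps by (intro diag.nonsing) auto
  moreover have "\<exists>s\<in>adjoin x S0. v - s \<in> rad (adjoin x S)" if v: "v \<in> adjoin x S" for v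
  proof -
    obtain c s where cs: "s \<in> S" "v = c *s x + s" using v adjoin_iff[OF sub(1)] by auto
    obtain s0 where "s0 \<in> S0" "s - s0 \<in> rad S" using S0(3) cs by blast
    moreover have "v - (c *s x + s0) = s - s0" using cs by simp
    ultimately show ?thesis
      using adjoin_memI[OF sub(2), of s0 c x] rad_adjoin_nonsing[OF sub(1) nonsing.hyps(2,3)] by metis
  qed
  ultimately show ?case using adjoin_mono[OF S0(1)] by blast
next
  case (sing S as m x)
  then obtain S0 where S0: "S0 \<subseteq> S" "diag S0 as 0" "\<forall>v\<in>S. \<exists>s\<in>S0. v - s \<in> rad S" by blast
  note sub = diag_subspace[OF sing.hyps(1)]
  have "\<exists>s\<in>S0. v - s \<in> rad (adjoin x S)" if v: "v \<in> adjoin x S" for v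
  proof -
    obtain c s where cs: "s \<in> S" "v = c *s x + s" using v adjoin_iff[OF sub(1)] by auto
    obtain s0 where s0: "s0 \<in> S0" "s - s0 \<in> rad S" using S0(3) cs by blast
    have "v - s0 = c *s x + (s - s0)" using cs by simp
    thus ?thesis
      using adjoin_memI[OF subspace_rad[OF sub(1)] s0(2), of c x] s0
        rad_adjoin_sing[OF sub(1) sing.hyps(2,3)] by metis
  qed
  thus ?case using S0 adjoin_superset[of S x] by blast
qed

text \<open>The radical is the line through t. After correction by a vector of a complement
  \<open>S0\<close> of the radical, x is orthogonal to \<open>S0\<close> and spans with t a
  hyperbolic plane; the discriminant of this plane is -1, up to squares.\<close>

lemma adjoin_hyperbolic:
  assumes S: "vec.subspace S" "corank S = 1" and t: "t \<in> rad S" "f x t \<noteq> 0"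
  shows "corank (adjoin x S) = 0" "disc_char (adjoin x S) = sig * disc_char S"
proof -
  obtain as m where d: "diag S as m" using diag_exists S by blast
  obtain S0 where S0: "S0 \<subseteq> S" "diag S0 as 0" "\<forall>v\<in>S. \<exists>s\<in>S0. v - s \<in> rad S"
    using nondegenerate_part[OF d] by blast
  note sub0 = diag_subspace[OF S0(2)]
  have t0: "t \<noteq> 0" using t by (auto simp: f_simps)
  have "adjoin t {0} = rad S"
    using S t t0 subspace_rad[OF S(1)] vec.subspace_0[OF subspace_rad[OF S(1)]]
    by (intro subspace_eqI adjoin_minimal) (auto simp: corank_def dim_adjoin)
  hence rad: "\<exists>c. v = c *s t" if "v \<in> rad S" for v using that adjoin_iff[of "{0}" v t] by auto
  have Seq: "S = adjoin t S0"
  proof (intro subset_antisym subsetI)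
    fix v assume "v \<in> S"
    then obtain s c where "s \<in> S0" "v - s = c *s t" using S0(3) rad by blast
    hence "v = c *s t + s" by (simp add: algebra_simps)
    thus "v \<in> adjoin t S0" using adjoin_memI[OF sub0 \<open>s \<in> S0\<close>] by simp
  next
    fix v assume "v \<in> adjoin t S0"
    moreover have "adjoin t S0 \<subseteq> S" using t S0 S by (intro adjoin_minimal) (auto simp: rad_def)
    ultimately show "v \<in> S" by blast
  qed
  have ft: "f t s = 0" "f s t = 0" if "s \<in> S" for s
    using t that f_sym[of s t] by (auto simp: rad_def)
  obtain s0 where s0: "s0 \<in> S0" "x - s0 \<in> orth S0"
    using projection[OF sub0] S0(2) diag_corank by blast
  define m where "m = x - s0"
  have mt: "f m t = f x t" using s0 S0 ft[of s0] by (auto simp: m_def f_simps)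
  have mt0: "f m t \<noteq> 0" "f t m = f m t" using mt t f_sym by auto
  \<comment> \<open>Chosen so that y = m + c t has norm 1.\<close>
  define c where "c = (1 - f m m) / (2 * f m t)"
  define y where "y = m + c *s t"
  have tt: "f t t = 0" using t ft by (auto simp: rad_def)
  have "f y y = f m m + 2 * c * f m t"
    using tt mt0 by (simp add: y_def f_simps)
  moreover have "2 * c * f m t = 1 - f m m" using mt0 two by (simp add: c_def)
  ultimately have yy: "f y y = 1" by simp
  have yt: "f t y = f m t" "f y t = f m t" using tt mt0 by (auto simp: y_def f_simps)
  \<comment> \<open>The vectors y and z form an orthogonal basis of the plane spanned by m and t;
    their norms are 1 and minus a nonzero square.\<close>
  define z where "z = t - f m t *s y"
  have zy: "f z y = 0" using yt yy by (simp add: z_def f_simps)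
  have zz: "f z z = - (f m t ^ 2)"
    using yt yy tt by (simp add: z_def f_simps power2_eq_square)
  have y0: "f y s = 0" if "s \<in> S0" for s
    using that s0 S0 ft[of s] by (auto simp: y_def m_def orth_def f_simps)
  have z0: "f z s = 0" if "s \<in> S0" for s
    using that y0 S0 ft[of s] by (auto simp: z_def f_simps)
  have d1: "diag (adjoin y S0) (1 # as) 0" using diag.nonsing[OF S0(2), of y] y0 yy by simp
  have "\<forall>w\<in>adjoin y S0. f z w = 0" using z0 zy adjoin_iff[OF sub0] by (auto simp: f_simps)
  moreover have "f z z \<noteq> 0" using zz mt0 by simp
  ultimately have d2: "diag (adjoin z (adjoin y S0)) (f z z # 1 # as) 0" using d1 diag.nonsing by blast
  have "adjoin z (adjoin y S0) = adjoin t (adjoin y S0)"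
    using adjoin_shift[OF subspace_adjoin, of "(- f m t) *s y" y S0 1 t]
      vec.subspace_scale[OF subspace_adjoin adjoin_self[of y S0], of "- f m t"] by (simp add: z_def)
  also have "\<dots> = adjoin y S" by (simp only: adjoin_commute[of t] Seq[symmetric])
  also have "\<dots> = adjoin x S"
  proof -
    have "y = 1 *s x + (c *s t - s0)" by (simp add: y_def m_def)
    moreover have "c *s t - s0 \<in> S"
      using t s0 S0 S by (intro vec.subspace_diff[OF S(1)] vec.subspace_scale[OF S(1)]) (auto simp: rad_def)
    ultimately show ?thesis using adjoin_shift[OF S(1), of "c *s t - s0" 1 x] by simp
  qed
  finally have d3: "diag (adjoin x S) (f z z # 1 # as) 0" using d2 by simp
  thus "corank (adjoin x S) = 0" by (rule diag_corank)
  have "quad_char (f z z) = sig"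
    using quad_char_mult[OF two, of "-1" "f m t ^ 2"] quad_char_square[OF mt0(1)] zz by (simp add: sig_eq)
  thus "disc_char (adjoin x S) = sig * disc_char S"
    using diag_disc_char[OF d3] diag_disc_char[OF d] by (simp add: quad_char_mult[OF two])
qed

lemma adjoin_singular:
  assumes S: "vec.subspace S" and t: "t \<in> rad S" "t \<noteq> 0" "f x t = 0"
  shows "corank (adjoin x S) > 0"
proof (rule corank_pos[OF subspace_adjoin _ t(2)])
  have "f t v = 0" if "v \<in> adjoin x S" for v
    using that t adjoin_iff[OF S] f_sym[of x t] by (auto simp: rad_def f_simps)
  thus "t \<in> rad (adjoin x S)" using t adjoin_superset[of S x] by (auto simp: rad_def)
qed

text \<open>Orthogonality to x is one linear condition, so a radical of dimension at least 2
  contains a nonzero vector that satisfies it and therefore stays in the radical.\<close>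

lemma adjoin_corank_ge_2:
  assumes S: "vec.subspace S" "corank S > 1"
  shows "corank (adjoin x S) > 0"
proof -
  have "rad S \<noteq> {0}" using S corank_0_iff[of S] by auto
  then obtain t where t: "t \<in> rad S" "t \<noteq> 0" using vec.subspace_0[OF subspace_rad[OF S(1)]] by blast
  show ?thesis
  proof (cases "f x t = 0")
    case True
    then show ?thesis using adjoin_singular[OF S(1) t] by simp
  next
    case False
    have "vec.dim (adjoin t {0}) = 1" using t by (simp add: dim_adjoin)
    hence "\<not> rad S \<subseteq> adjoin t {0}" using vec.dim_subset[of "rad S" "adjoin t {0}"] S by (auto simp: corank_def)
    then obtain u where u: "u \<in> rad S" "u \<notin> adjoin t {0}" by blast
    define c where "c = f x u / f x t"
    have "u - c *s t \<in> rad S" using u t subspace_rad[OF S(1)] by (intro vec.subspace_diff vec.subspace_scale)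
    moreover have "u - c *s t \<noteq> 0"
    proof
      assume "u - c *s t = 0"
      hence "u = c *s t + 0" by simp
      thus False using u(2) adjoin_memI[of "{0}" 0 c t] by simp
    qed
    moreover have "f x (u - c *s t) = 0" using False by (simp add: f_simps c_def)
    ultimately show ?thesis using adjoin_singular[OF S(1)] by blast
  qed
qed

definition nonsing_ind :: "('a ^ 'k) set \<Rightarrow> real" where "nonsing_ind S = (if corank S = 0 then 1 else 0)"
definition signed_ind :: "('a ^ 'k) set \<Rightarrow> real" where "signed_ind S = (if corank S = 0 then disc_char S else 0)"
text \<open>Up to the factor \<open>1 - 1/q\<close>, the next two functions are the averages of \<open>nonsing_ind\<close> and
  \<open>signed_ind\<close> over all forms whose Gram matrix borders that of \<open>S\<close> by one row.\<close>

definition border_ind :: "('a ^ 'k) set \<Rightarrow> real" where "border_ind S = (if corank S \<le> 1 then 1 else 0)"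
definition signed_border_ind :: "('a ^ 'k) set \<Rightarrow> real" where "signed_border_ind S = (if corank S = 1 then sig * disc_char S else 0)"

text \<open>If the radical is a line through t, then \<open>adjoin (e + v) S\<close> is non-singular
  unless \<open>f (e + v) t = 0\<close>, which holds for a proportion 1/q of the v in P; a larger
  radical survives every single vector. The result does not depend on e, and this makes the
  anisotropic and the hyperbolic construction comparable.\<close>

lemma sum_adjoin_singular:
  assumes S: "vec.subspace S" "corank S > 0" and P: "vec.subspace P"
    and np: "\<And>t. t \<in> rad S \<Longrightarrow> t \<noteq> 0 \<Longrightarrow> \<exists>p\<in>P. f p t \<noteq> 0"
  shows "q * (\<Sum>v\<in>P. nonsing_ind (adjoin (e + v) S)) = real (card P) * (q - 1) * border_ind S"
    and "q * (\<Sum>v\<in>P. signed_ind (adjoin (e + v) S)) = real (card P) * (q - 1) * signed_border_ind S"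
proof -
  have "q * (\<Sum>v\<in>P. nonsing_ind (adjoin (e + v) S)) = real (card P) * (q - 1) * border_ind S \<and>
        q * (\<Sum>v\<in>P. signed_ind (adjoin (e + v) S)) = real (card P) * (q - 1) * signed_border_ind S"
  proof (cases "corank S = 1")
    case False
    hence "nonsing_ind (adjoin (e + v) S) = 0" "signed_ind (adjoin (e + v) S) = 0" for v
      using adjoin_corank_ge_2[of S "e + v"] S by (auto simp: nonsing_ind_def signed_ind_def)
    moreover have "\<not> corank S \<le> 1" using False S by simp
    ultimately show ?thesis using False by (simp add: border_ind_def signed_border_ind_def)
  next
    case True
    have "rad S \<noteq> {0}" using S corank_0_iff[of S] by auto
    then obtain t where t: "t \<in> rad S" "t \<noteq> 0" using vec.subspace_0[OF subspace_rad[OF S(1)]] by blast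
    obtain p where p: "p \<in> P" "f p t \<noteq> 0" using np t by blast
    have e0: "nonsing_ind (adjoin (e + v) S) = (if f v t = - f e t then 0 else 1)"
      and e1: "signed_ind (adjoin (e + v) S) = (if f v t = - f e t then 0 else sig * disc_char S)" for v
    proof -
      have "f v t = - f e t \<longleftrightarrow> f (e + v) t = 0" by (auto simp: f_simps add_eq_0_iff)
      thus "nonsing_ind (adjoin (e + v) S) = (if f v t = - f e t then 0 else 1)"
          "signed_ind (adjoin (e + v) S) = (if f v t = - f e t then 0 else sig * disc_char S)"
        using adjoin_singular[OF S(1) t, of "e + v"] adjoin_hyperbolic[OF S(1) True t(1), of "e + v"]
        by (auto simp: nonsing_ind_def signed_ind_def)
    qed
    have "q * (\<Sum>v\<in>P. if f v t = - f e t then 0 else y) =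
        q * real (card P) * y - q * real (card {v\<in>P. f v t = - f e t}) * y" for y
      by (simp only: sum_if_zero[OF finite]) (simp add: algebra_simps)
    hence "q * (\<Sum>v\<in>P. if f v t = - f e t then 0 else y) = real (card P) * (q - 1) * y" for y
      by (simp add: functional_fibre[OF P p] algebra_simps)
    thus ?thesis using True by (simp add: e0 e1 border_ind_def signed_border_ind_def)
  qed
  thus "q * (\<Sum>v\<in>P. nonsing_ind (adjoin (e + v) S)) = real (card P) * (q - 1) * border_ind S"
    "q * (\<Sum>v\<in>P. signed_ind (adjoin (e + v) S)) = real (card P) * (q - 1) * signed_border_ind S" by auto
qed

end

section \<open>Peeling off an anisotropic vector or a hyperbolic plane\<close>

lemma complements_dimI:
  fixes V :: "('a::{field,finite} ^ 'k) set"
  assumes V: "vec.subspace V" and P: "vec.subspace P" "P \<subseteq> V" and S: "vec.subspace S" "S \<subseteq> V"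
    and SP: "S \<inter> P \<subseteq> {0}" and d: "vec.dim S + vec.dim P = vec.dim V"
  shows "S \<in> complements V P"
proof -
  have "inj_on (\<lambda>(s, p). s + p) (S \<times> P)"
  proof (rule inj_onI, clarify)
    fix s p s' p' assume a: "s \<in> S" "p \<in> P" "s' \<in> S" "p' \<in> P" "s + p = s' + p'"
    hence "s - s' = p' - p" by (simp add: algebra_simps)
    hence "s - s' \<in> S \<inter> P" using a vec.subspace_diff[OF S(1), of s s'] vec.subspace_diff[OF P(1), of p' p]
      by auto
    hence "s = s'" using SP by auto
    thus "s = s' \<and> p = p'" using a by simp
  qed
  hence "card ((\<lambda>(s, p). s + p) ` (S \<times> P)) = card S * card P"
    by (simp add: card_image card_cartesian_product)
  also have "\<dots> = card V"
    using d by (simp add: card_subspace V P S power_add[symmetric])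
  finally have c: "card ((\<lambda>(s, p). s + p) ` (S \<times> P)) = card V" .
  have "(\<lambda>(s, p). s + p) ` (S \<times> P) \<subseteq> V"
    using S(2) P(2) by (auto intro: vec.subspace_add[OF V])
  hence img: "(\<lambda>(s, p). s + p) ` (S \<times> P) = V" using c by (intro card_subset_eq) auto
  have "\<exists>s\<in>S. v - s \<in> P" if "v \<in> V" for v
  proof -
    have "v \<in> (\<lambda>(s, p). s + p) ` (S \<times> P)" using img that by simp
    then obtain s p where "s \<in> S" "p \<in> P" "v = s + p" by auto
    thus ?thesis by (intro bexI[of _ s]) auto
  qed
  moreover have "S \<inter> P = {0}" using SP vec.subspace_0[OF S(1)] vec.subspace_0[OF P(1)] by blast
  ultimately show ?thesis using S by (simp add: complements_def)
qed

section \<open>Adjoining a vector to a non-singular complement\<close>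

context sym_form
begin

lemma nondeg_witness:
  assumes "vec.subspace V" "corank V = 0" "x \<in> V" "x \<noteq> 0"
  shows "\<exists>y\<in>V. f x y \<noteq> 0"
  using assms corank_0_iff[of V] by (auto simp: rad_def)

text \<open>V is the sum of S and P, and t is orthogonal to S but not to all of V.\<close>

lemma complements_rad_witness:
  assumes V: "vec.subspace V" "corank V = 0" and S: "S \<in> complements V P" and t: "t \<in> rad S" "t \<noteq> 0"
  shows "\<exists>p\<in>P. f p t \<noteq> 0"
proof -
  have "t \<in> V" using t complementsD(2)[OF S] by (auto simp: rad_def)
  then obtain y where y: "y \<in> V" "f t y \<noteq> 0" using nondeg_witness[OF V] t by blast
  obtain s where s: "s \<in> S" "y - s \<in> P" using complementsD(4)[OF S y(1)] by blast
  have "f t s = 0" using t s by (auto simp: rad_def)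
  hence "f (y - s) t \<noteq> 0" using y f_sym[of "y - s" t] by (simp add: f_simps)
  thus ?thesis using s by blast
qed

text \<open>Both P and the orthogonal complement of S in V are complements of S, so projection along
  S maps the one bijectively onto the other.\<close>

lemma complements_projection_bij:
  assumes V: "vec.subspace V" and P: "vec.subspace P" "P \<subseteq> V" and S: "S \<in> complements V P" "corank S = 0"
  shows "\<exists>\<pi>. bij_betw \<pi> P (V \<inter> orth S) \<and> (\<forall>v\<in>P. v - \<pi> v \<in> S)"
proof -
  note S1 = complementsD(1)[OF S(1)]
  define s where "s = (\<lambda>v. SOME s. s \<in> S \<and> v - s \<in> orth S)"
  have s: "s v \<in> S" "v - s v \<in> orth S" for v
  proof -
    have "s v \<in> S \<and> v - s v \<in> orth S"
      unfolding s_def by (rule someI_ex) (use projection[OF S1 S(2)] in blast)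
    thus "s v \<in> S" "v - s v \<in> orth S" by auto
  qed
  have uniq: "s v = t" if t: "t \<in> S" "v - t \<in> orth S" for v t
  proof -
    have "(v - t) - (v - s v) \<in> orth S" by (rule vec.subspace_diff[OF subspace_orth t(2) s(2)])
    moreover have "s v - t \<in> S" using s t by (intro vec.subspace_diff[OF S1])
    ultimately have "s v - t \<in> rad S" by (simp add: rad_eq)
    thus ?thesis using S1 S(2) corank_0_iff by auto
  qed
  have "bij_betw (\<lambda>v. v - s v) P (V \<inter> orth S)"
  proof (rule bij_betw_imageI)
    show "inj_on (\<lambda>v. v - s v) P"
    proof (rule inj_onI)
      fix v w assume a: "v \<in> P" "w \<in> P" "v - s v = w - s w"
      hence "v - w = s v - s w" by (simp add: algebra_simps)
      moreover have "s v - s w \<in> S" by (rule vec.subspace_diff[OF S1 s(1) s(1)])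
      moreover have "v - w \<in> P" by (rule vec.subspace_diff[OF P(1) a(1,2)])
      ultimately have "v - w \<in> S \<inter> P" by simp
      thus "v = w" using complementsD(3)[OF S(1)] by auto
    qed
    show "(\<lambda>v. v - s v) ` P = V \<inter> orth S"
    proof (intro subset_antisym subsetI)
      fix m assume m: "m \<in> V \<inter> orth S"
      then obtain t where t: "t \<in> S" "m - t \<in> P" using complementsD(4)[OF S(1)] by blast
      have "s (m - t) = - t"
        using t m by (intro uniq) (auto intro: vec.subspace_neg[OF S1])
      thus "m \<in> (\<lambda>v. v - s v) ` P" using t by (intro image_eqI[of _ _ "m - t"]) auto
    next
      fix m assume "m \<in> (\<lambda>v. v - s v) ` P"
      then obtain v where v: "v \<in> P" "m = v - s v" by blast
      have "v \<in> V" "s v \<in> V" using v P(2) s(1) complementsD(2)[OF S(1)] by auto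
      hence "v - s v \<in> V" by (rule vec.subspace_diff[OF V])
      thus "m \<in> V \<inter> orth S" using v s(2) by simp
    qed
  qed
  thus ?thesis using s(1) by (intro exI[of _ "\<lambda>v. v - s v"]) auto
qed

lemma h_adjoin_orth:
  assumes S: "vec.subspace S" "corank S = 0" and w: "w \<in> orth S" "w \<notin> S"
  shows "nonsing_ind (adjoin w S) = (if f w w = 0 then 0 else 1)"
    and "signed_ind (adjoin w S) = quad_char (f w w) * disc_char S"
proof -
  have o: "\<forall>y\<in>S. f w y = 0" using w by (auto simp: orth_def)
  show "nonsing_ind (adjoin w S) = (if f w w = 0 then 0 else 1)" "signed_ind (adjoin w S) = quad_char (f w w) * disc_char S"
    using disc_char_adjoin_nonsing[OF S(1) o] disc_char_adjoin_sing[OF S(1) o _ w(2)] S(2)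
    by (cases "f w w = 0"; simp add: nonsing_ind_def signed_ind_def)+
qed

lemma orth_vector_notin:
  assumes "e \<in> orth V" "f e e \<noteq> 0" shows "e \<notin> V"
  using assms by (auto simp: orth_def)

text \<open>Modulo S, the vector e + v may be replaced by e + m, where m is the projection of v.
  This vector is orthogonal to S and has norm \<open>f e e + f m m\<close>.\<close>

lemma sum_adjoin_nonsingular:
  assumes V: "vec.subspace V" and P: "vec.subspace P" "P \<subseteq> V" and S: "S \<in> complements V P" "corank S = 0"
    and e: "e \<in> orth V" "f e e \<noteq> 0"
  shows "(\<Sum>v\<in>P. nonsing_ind (adjoin (e + v) S)) = (\<Sum>m\<in>V \<inter> orth S. if f m m = - f e e then 0 else 1)"
    and "(\<Sum>v\<in>P. signed_ind (adjoin (e + v) S)) = (\<Sum>m\<in>V \<inter> orth S. quad_char (f e e + f m m) * disc_char S)"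
proof -
  note S1 = complementsD(1)[OF S(1)]
  obtain \<pi> where bij: "bij_betw \<pi> P (V \<inter> orth S)" and \<pi>: "\<And>v. v \<in> P \<Longrightarrow> v - \<pi> v \<in> S"
    using complements_projection_bij[OF V P S] by blast
  have key: "nonsing_ind (adjoin (e + v) S) = (if f (\<pi> v) (\<pi> v) = - f e e then 0 else 1) \<and>
      signed_ind (adjoin (e + v) S) = quad_char (f e e + f (\<pi> v) (\<pi> v)) * disc_char S" if v: "v \<in> P" for v
  proof -
    define m where "m = \<pi> v"
    have m: "m \<in> V" "m \<in> orth S" using bij v by (auto simp: m_def dest: bij_betwE)
    have em: "f e m = 0" "f m e = 0" using e m f_sym[of m e] by (auto simp: orth_def)
    have "e + v = 1 *s (e + m) + (v - m)" by simp
    hence x: "adjoin (e + v) S = adjoin (e + m) S"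
      using adjoin_shift[OF S1 \<pi>[OF v], of 1 "e + m"] by (simp add: m_def)
    have "e + m \<in> orth S"
      using e m complementsD(2)[OF S(1)] by (intro vec.subspace_add[OF subspace_orth]) (auto simp: orth_def)
    moreover have "e + m \<notin> S"
    proof
      assume "e + m \<in> S"
      hence "(e + m) - m \<in> V" using complementsD(2)[OF S(1)] m by (intro vec.subspace_diff[OF V]) auto
      thus False using orth_vector_notin[OF e] by simp
    qed
    moreover have "f (e + m) (e + m) = f e e + f m m" using em by (simp add: f_simps)
    ultimately show ?thesis
      using h_adjoin_orth[OF S1 S(2), of "e + m"] unfolding x m_def[symmetric]
      by (simp add: add_eq_0_iff)
  qed
  show "(\<Sum>v\<in>P. nonsing_ind (adjoin (e + v) S)) = (\<Sum>m\<in>V \<inter> orth S. if f m m = - f e e then 0 else 1)"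
    using key by (subst sum.reindex_bij_betw[OF bij, symmetric]) (auto intro: sum.cong)
  show "(\<Sum>v\<in>P. signed_ind (adjoin (e + v) S)) = (\<Sum>m\<in>V \<inter> orth S. quad_char (f e e + f m m) * disc_char S)"
    using key by (subst sum.reindex_bij_betw[OF bij, symmetric]) (auto intro: sum.cong)
qed

lemma real_card_subspace:
  fixes S :: "('a ^ 'k) set"
  shows "vec.subspace S \<Longrightarrow> real (card S) = q ^ vec.dim S"
  by (simp add: card_subspace q_eq)

text \<open>In even dimension all levels except t = 0 have the same size. As the character sums to
  0, only the deviation at t = 0 contributes.\<close>

lemma sum_quad_char_level:
  assumes M: "vec.subspace M" "corank M = 0" "vec.dim M = 2 * k"
  shows "(\<Sum>m\<in>M. quad_char (a + f m m)) = sig ^ k * disc_char M * q ^ k * quad_char a"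
proof -
  define X where "X = sig ^ k * disc_char M * q ^ k"
  have "q * (\<Sum>m\<in>M. quad_char (a + f m m)) =
      q * (\<Sum>t\<in>UNIV. real (card {m\<in>M. f m m = t}) * quad_char (a + t))"
    using sum_by_fibers[of M "\<lambda>t. quad_char (a + t)" "\<lambda>m. f m m"] by simp
  also have "\<dots> = (\<Sum>t\<in>UNIV. (q * real (card {m\<in>M. f m m = t})) * quad_char (a + t))"
    by (simp add: sum_distrib_left mult.assoc)
  also have "\<dots> = (\<Sum>t\<in>UNIV. (q ^ (2 * k) - X) * quad_char (a + t) + (if t = 0 then X * q * quad_char a else 0))"
    by (intro sum.cong refl) (auto simp: level_count(1)[OF M(1,2,3)] X_def algebra_simps)
  also have "\<dots> = X * q * quad_char a"
    by (simp add: sum.distrib sum_distrib_left[symmetric] sum_quad_char_shift[OF two])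
  finally show ?thesis using q_pos by (simp add: X_def)
qed

text \<open>For non-singular S, the orthogonal complement of S in V has the dimension of P, and its
  discriminant is that of V times that of S; this is how \<open>signed_ind\<close> arises. In even
  dimension all nonzero levels are equally large, so the first sum does not see the square class of
  \<open>f e e\<close>, whereas the second one does.\<close>

lemma peel_even:
  assumes V: "vec.subspace V" "corank V = 0" and P: "vec.subspace P" "P \<subseteq> V" and S: "S \<in> complements V P"
    and e: "e \<in> orth V" "f e e \<noteq> 0" and d: "vec.dim P = 2 * k"
  shows "q * (\<Sum>v\<in>P. nonsing_ind (adjoin (e + v) S)) =
           q ^ (2 * k) * (q - 1) * border_ind S + q ^ k * sig ^ k * disc_char V * signed_ind S"
    and "q * (\<Sum>v\<in>P. signed_ind (adjoin (e + v) S)) =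
           q ^ (2 * k) * (q - 1) * signed_border_ind S + q ^ (k + 1) * sig ^ k * quad_char (f e e) * disc_char V * nonsing_ind S"
proof -
  note S1 = complementsD(1)[OF S]
  have "q * (\<Sum>v\<in>P. nonsing_ind (adjoin (e + v) S)) =
           q ^ (2 * k) * (q - 1) * border_ind S + q ^ k * sig ^ k * disc_char V * signed_ind S \<and>
        q * (\<Sum>v\<in>P. signed_ind (adjoin (e + v) S)) =
           q ^ (2 * k) * (q - 1) * signed_border_ind S + q ^ (k + 1) * sig ^ k * quad_char (f e e) * disc_char V * nonsing_ind S"
  proof (cases "corank S = 0")
    case False
    thus ?thesis
      using sum_adjoin_singular[OF S1 _ P(1) complements_rad_witness[OF V S], of e]
      by (simp add: nonsing_ind_def signed_ind_def real_card_subspace[OF P(1)] d)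
  next
    case True
    define M where "M = V \<inter> orth S"
    note M = orth_decomp[OF V(1) S1 True complementsD(2)[OF S], folded M_def]
    have dM: "vec.dim M = 2 * k" using M(6) dim_complements[OF V(1) P S] d by simp
    have cM: "corank M = 0" using M(4) V by simp
    have sM: "disc_char M = disc_char V * disc_char S" using M(5) disc_char_sq[OF S1] by (simp add: mult.commute mult.assoc)
    have "q * (\<Sum>m\<in>M. if f m m = - f e e then 0 else 1) =
        q * real (card M) - q * real (card {m\<in>M. f m m = - f e e})"
      by (simp only: sum_if_zero[OF finite]) (simp add: algebra_simps)
    also have "\<dots> = q ^ (2 * k) * (q - 1) + sig ^ k * disc_char M * q ^ k"
      using e by (simp add: level_count(1)[OF M(1) cM dM] real_card_subspace[OF M(1)] dM algebra_simps)
    finally show ?thesis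
      using sum_adjoin_nonsingular[OF V(1) P S True e, folded M_def] True sum_quad_char_level[OF M(1) cM dM, of "f e e"]
        disc_char_sq[OF S1]
      by (simp add: sM nonsing_ind_def signed_ind_def border_ind_def signed_border_ind_def sum_distrib_right[symmetric])
  qed
  thus "q * (\<Sum>v\<in>P. nonsing_ind (adjoin (e + v) S)) =
           q ^ (2 * k) * (q - 1) * border_ind S + q ^ k * sig ^ k * disc_char V * signed_ind S"
    "q * (\<Sum>v\<in>P. signed_ind (adjoin (e + v) S)) =
           q ^ (2 * k) * (q - 1) * signed_border_ind S + q ^ (k + 1) * sig ^ k * quad_char (f e e) * disc_char V * nonsing_ind S"
    by auto
qed

text \<open>In odd dimension the size of a level depends on its square class. The level here is
  \<open>- f e e\<close>, which explains the factor \<open>quad_char (f e e)\<close> and the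
  exponent k + 1 of \<open>sig\<close>.\<close>

lemma peel_odd:
  assumes V: "vec.subspace V" "corank V = 0" and P: "vec.subspace P" "P \<subseteq> V" and S: "S \<in> complements V P"
    and e: "e \<in> orth V" "f e e \<noteq> 0" and d: "vec.dim P = 2 * k + 1"
  shows "q * (\<Sum>v\<in>P. nonsing_ind (adjoin (e + v) S)) =
           q ^ (2 * k + 1) * (q - 1) * border_ind S - q ^ (k + 1) * sig ^ (k + 1) * quad_char (f e e) * disc_char V * signed_ind S"
proof -
  note S1 = complementsD(1)[OF S]
  show ?thesis
  proof (cases "corank S = 0")
    case False
    thus ?thesis
      using sum_adjoin_singular[OF S1 _ P(1) complements_rad_witness[OF V S], of e]
      by (simp add: nonsing_ind_def signed_ind_def real_card_subspace[OF P(1)] d)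
  next
    case True
    define M where "M = V \<inter> orth S"
    note M = orth_decomp[OF V(1) S1 True complementsD(2)[OF S], folded M_def]
    have dM: "vec.dim M = 2 * k + 1" using M(6) dim_complements[OF V(1) P S] d by simp
    have cM: "corank M = 0" using M(4) V by simp
    have sM: "disc_char M = disc_char V * disc_char S" using M(5) disc_char_sq[OF S1] by (simp add: mult.commute mult.assoc)
    have qm: "quad_char (- f e e) = sig * quad_char (f e e)"
      using quad_char_mult[OF two, of "-1" "f e e"] by (simp add: sig_eq)
    have "q * (\<Sum>m\<in>M. if f m m = - f e e then 0 else 1) =
        q * real (card M) - q * real (card {m\<in>M. f m m = - f e e})"
      by (simp only: sum_if_zero[OF finite]) (simp add: algebra_simps)
    also have "\<dots> = q ^ (2 * k + 1) * (q - 1) - q ^ (k + 1) * sig ^ (k + 1) * quad_char (f e e) * disc_char M"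
      by (simp add: level_count(2)[OF M(1) cM dM] real_card_subspace[OF M(1)] dM qm algebra_simps)
    finally show ?thesis
      using sum_adjoin_nonsingular(1)[OF V(1) P S True e, folded M_def] True
      by (simp add: sM nonsing_ind_def signed_ind_def border_ind_def)
  qed
qed

section \<open>Sums over all complements: anisotropic and hyperbolic steps\<close>

definition nonsing_count :: "('a ^ 'k) set \<Rightarrow> ('a ^ 'k) set \<Rightarrow> real" where "nonsing_count V P = (\<Sum>S\<in>complements V P. nonsing_ind S)"
definition signed_count :: "('a ^ 'k) set \<Rightarrow> ('a ^ 'k) set \<Rightarrow> real" where "signed_count V P = (\<Sum>S\<in>complements V P. signed_ind S)"
definition border_count :: "('a ^ 'k) set \<Rightarrow> ('a ^ 'k) set \<Rightarrow> real" where "border_count V P = (\<Sum>S\<in>complements V P. border_ind S)"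
definition signed_border_count :: "('a ^ 'k) set \<Rightarrow> ('a ^ 'k) set \<Rightarrow> real" where "signed_border_count V P = (\<Sum>S\<in>complements V P. signed_border_ind S)"

lemma step_even:
  assumes V: "vec.subspace V" "corank V = 0" and P: "vec.subspace P" "P \<subseteq> V"
    and e: "e \<in> orth V" "f e e \<noteq> 0" and d: "vec.dim P = 2 * k"
  shows "q * nonsing_count (adjoin e V) P = q ^ (2 * k) * (q - 1) * border_count V P + q ^ k * sig ^ k * disc_char V * signed_count V P"
    and "q * signed_count (adjoin e V) P = q ^ (2 * k) * (q - 1) * signed_border_count V P +
           q ^ (k + 1) * sig ^ k * quad_char (f e e) * disc_char V * nonsing_count V P"
  unfolding nonsing_count_def signed_count_def border_count_def signed_border_count_def sum_complements_adjoin[OF V(1) P orth_vector_notin[OF e]]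
    sum_distrib_left sum.distrib[symmetric]
  unfolding sum_distrib_left[symmetric]
  using peel_even[OF V P _ e d] by (auto intro!: sum.cong simp: sum_distrib_left)

lemma step_odd:
  assumes V: "vec.subspace V" "corank V = 0" and P: "vec.subspace P" "P \<subseteq> V"
    and e: "e \<in> orth V" "f e e \<noteq> 0" and d: "vec.dim P = 2 * k + 1"
  shows "q * nonsing_count (adjoin e V) P = q ^ (2 * k + 1) * (q - 1) * border_count V P -
           q ^ (k + 1) * sig ^ (k + 1) * quad_char (f e e) * disc_char V * signed_count V P"
  unfolding nonsing_count_def signed_count_def border_count_def sum_complements_adjoin[OF V(1) P orth_vector_notin[OF e]]
    sum_distrib_left sum_subtractf[symmetric]
  unfolding sum_distrib_left[symmetric]
  using peel_odd[OF V P _ e d] by (auto intro!: sum.cong simp: sum_distrib_left)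


lemma sum_over_line:
  fixes P :: "('a ^ 'k) set"
  assumes P: "vec.subspace P" "r \<in> P"
  shows "q * (\<Sum>v\<in>P. F v) = (\<Sum>v\<in>P. \<Sum>c\<in>UNIV. (F (v + c *s r) :: real))"
proof -
  have "(\<Sum>v\<in>P. F (v + c *s r)) = (\<Sum>v\<in>P. F v)" for c
    by (rule sum.reindex_bij_witness[of _ "\<lambda>v. v - c *s r" "\<lambda>v. v + c *s r"])
      (use P in \<open>auto intro: vec.subspace_add vec.subspace_diff vec.subspace_scale\<close>)
  hence "(\<Sum>c\<in>(UNIV::'a set). \<Sum>v\<in>P. F (v + c *s r)) = q * (\<Sum>v\<in>P. F v)" by (simp add: q_eq)
  thus ?thesis using sum.swap[of "\<lambda>c v. F (v + c *s r)" P UNIV] by simp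
qed

text \<open>Shifting \<open>v\<close> by multiples of \<open>r\<close> shows that the norm of the new basis vector is uniformly
  distributed.\<close>

lemma border_nonsingular:
  assumes V: "vec.subspace V" and P: "vec.subspace P" "P \<subseteq> V" and S: "S \<in> complements V P" "corank S = 0"
    and r: "r \<in> P" "r \<in> orth V" "f r' r = 1"
  shows "q * (\<Sum>v\<in>P. nonsing_ind (adjoin (r' + v) S)) = real (card P) * (q - 1) * border_ind S"
    and "q * (\<Sum>v\<in>P. signed_ind (adjoin (r' + v) S)) = real (card P) * (q - 1) * signed_border_ind S"
proof -
  note S1 = complementsD(1)[OF S(1)]
  have orthS: "r \<in> orth S" using r complementsD(2)[OF S(1)] by (auto simp: orth_def)
  have rV: "f y r = 0" if "y \<in> V" for y using r(2) that f_sym[of y r] by (auto simp: orth_def)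
  have "(\<Sum>c\<in>UNIV. nonsing_ind (adjoin (r' + (v + c *s r)) S)) = q - 1 \<and>
        (\<Sum>c\<in>UNIV. signed_ind (adjoin (r' + (v + c *s r)) S)) = 0" if v: "v \<in> P" for v
  proof -
    obtain s where s: "s \<in> S" "(r' + v) - s \<in> orth S" using projection[OF S1 S(2)] by blast
    define w where "w = (r' + v) - s"
    have "v \<in> V" "s \<in> V" using v P s complementsD(2)[OF S(1)] by auto
    hence wr: "f w r = 1" using rV r by (simp add: w_def f_simps)
    have rr: "f r r = 0" using rV r P by auto
    have x: "adjoin (r' + (v + c *s r)) S = adjoin (w + c *s r) S" for c
    proof -
      have eq: "r' + (v + c *s r) = 1 *s (w + c *s r) + s" by (simp add: w_def)
      show ?thesis unfolding eq by (rule adjoin_shift[OF S1 s(1)]) simp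
    qed
    have o: "w + c *s r \<in> orth S" for c
      using s orthS by (auto simp: w_def intro!: vec.subspace_add vec.subspace_scale)
    have n: "w + c *s r \<notin> S" for c
    proof
      assume "w + c *s r \<in> S"
      hence "f (w + c *s r) r = 0" using rV complementsD(2)[OF S(1)] by blast
      thus False using wr rr by (simp add: f_simps)
    qed
    have Q: "f (w + c *s r) (w + c *s r) = f w w + 2 * c" for c
      using wr rr f_sym[of r w] by (simp add: f_simps)
    have b: "bij (\<lambda>c::'a. f w w + 2 * c)"
    proof (rule o_bij[of "\<lambda>t. (t - f w w) / 2"])
      have "2 * ((t - f w w) / 2) = t - f w w" for t using two by simp
      thus "(\<lambda>c. f w w + 2 * c) \<circ> (\<lambda>t. (t - f w w) / 2) = id" by (simp only: fun_eq_iff o_apply) simp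
    qed (use two in \<open>simp add: fun_eq_iff\<close>)
    have "(\<Sum>c\<in>UNIV. nonsing_ind (adjoin (w + c *s r) S)) = (\<Sum>c\<in>UNIV. (\<lambda>t. if t = 0 then 0 else 1) (f w w + 2 * c))"
      by (simp add: h_adjoin_orth[OF S1 S(2) o n] Q)
    also have "\<dots> = (\<Sum>t\<in>(UNIV::'a set). if t = 0 then 0 else 1)"
      by (rule sum.reindex_bij_betw[OF b])
    also have "\<dots> = q - 1" by (subst sum_if_zero) (simp_all add: q_eq)
    finally have 1: "(\<Sum>c\<in>UNIV. nonsing_ind (adjoin (w + c *s r) S)) = q - 1" .
    have "(\<Sum>c\<in>UNIV. signed_ind (adjoin (w + c *s r) S)) = (\<Sum>c\<in>UNIV. (\<lambda>t. quad_char t * disc_char S) (f w w + 2 * c))"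
      by (simp add: h_adjoin_orth[OF S1 S(2) o n] Q)
    also have "\<dots> = (\<Sum>t\<in>(UNIV::'a set). quad_char t * disc_char S)"
      by (rule sum.reindex_bij_betw[OF b])
    also have "\<dots> = 0" by (simp add: sum_distrib_right[symmetric] sum_quad_char[OF two])
    finally show ?thesis using 1 by (simp add: x)
  qed
  thus "q * (\<Sum>v\<in>P. nonsing_ind (adjoin (r' + v) S)) = real (card P) * (q - 1) * border_ind S"
    "q * (\<Sum>v\<in>P. signed_ind (adjoin (r' + v) S)) = real (card P) * (q - 1) * signed_border_ind S"
    using S by (simp_all add: sum_over_line[OF P(1) r(1)] border_ind_def signed_border_ind_def)
qed

text \<open>Both S and T are mapped isometrically onto the quotient of \<open>adjoin r S\<close> by
  the line through r, which lies in the radical.\<close>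

lemma c_adjoin_isotropic:
  assumes S: "vec.subspace S" "r \<notin> S" and T: "vec.subspace T" "r \<notin> T" and eq: "adjoin r S = adjoin r T"
    and o: "\<forall>y\<in>adjoin r S. f r y = 0"
  shows "border_ind S = border_ind T" "signed_border_ind S = signed_border_ind T"
proof -
  have r: "f r r = 0" using o adjoin_self[of r S] by blast
  have oS: "\<forall>y\<in>S. f r y = 0" using o adjoin_superset[of S r] by blast
  have oT: "\<forall>y\<in>T. f r y = 0" using o adjoin_superset[of T r] unfolding eq by blast
  have "corank S = corank T" "disc_char S = disc_char T"
    using disc_char_adjoin_sing[OF S(1) oS r S(2)] disc_char_adjoin_sing[OF T(1) oT r T(2)] by (simp_all add: eq)
  thus "border_ind S = border_ind T" "signed_border_ind S = signed_border_ind T" by (simp_all add: border_ind_def signed_border_ind_def)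
qed

text \<open>The complements R of \<open>adjoin r P\<close> are grouped by S =
  \<open>adjoin r R \<inter> V\<close>, a complement of P in V. The group of S consists of the
  complements of the line through r in \<open>adjoin r S\<close>; there are q^(dim S) of them, and
  all have the border values of S.\<close>

lemma sum_complements_isotropic_adjoin:
  assumes V: "vec.subspace V" and P: "vec.subspace P" "P \<subseteq> V"
    and r: "r \<notin> V" "\<forall>y\<in>adjoin r V. f r y = 0"
  shows "(\<Sum>S\<in>complements (adjoin r V) (adjoin r P). border_ind S) = q ^ (vec.dim V - vec.dim P) * border_count V P"
    and "(\<Sum>S\<in>complements (adjoin r V) (adjoin r P). signed_border_ind S) = q ^ (vec.dim V - vec.dim P) * signed_border_count V P"
proof -
  define L where "L = adjoin r {0}"
  have L: "y \<in> L \<longleftrightarrow> (\<exists>c. y = c *s r)" for y unfolding L_def by (subst adjoin_iff) auto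
  have rn: "c *s r + w \<in> V \<longleftrightarrow> c = 0" if "w \<in> V" for c w
    using adjoin_coords_unique[OF V r(1), of "c *s r + w" w 0 c] that by (cases "c = 0") auto
  have part: "S \<in> complements V P \<Longrightarrow> R \<in> complements (adjoin r S) L \<Longrightarrow>
      R \<in> complements (adjoin r V) (adjoin r P) \<and> adjoin r R = adjoin r S \<and> S = adjoin r R \<inter> V" for S R
  proof -
    assume S: "S \<in> complements V P" and R: "R \<in> complements (adjoin r S) L"
    note S' = complementsD[OF S] and R' = complementsD[OF R]
    have eq: "adjoin r R = adjoin r S"
    proof
      show "adjoin r R \<subseteq> adjoin r S" using R'(2) by (intro adjoin_minimal) (auto simp: adjoin_self)
      have "y \<in> adjoin r R" if y: "y \<in> S" for y
      proof -
        have "y \<in> adjoin r S" using y adjoin_superset by blast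
        then obtain u c where "u \<in> R" "y - u = c *s r" using R'(4) L by blast
        hence "y = c *s r + u" by (simp add: algebra_simps)
        thus ?thesis using adjoin_memI[OF R'(1) \<open>u \<in> R\<close>] by simp
      qed
      thus "adjoin r S \<subseteq> adjoin r R" by (intro adjoin_minimal) (auto simp: adjoin_self)
    qed
    have cut: "S = adjoin r R \<inter> V"
    proof (intro subset_antisym subsetI)
      fix y assume y: "y \<in> adjoin r R \<inter> V"
      then obtain c s where cs: "s \<in> S" "y = c *s r + s" using adjoin_iff[OF S'(1)] eq by auto
      hence "c = 0" using rn[of s c] y S'(2) by auto
      thus "y \<in> S" using cs by simp
    next
      fix y assume "y \<in> S" thus "y \<in> adjoin r R \<inter> V" using eq adjoin_superset S'(2) by blast
    qed
    have "R \<in> complements (adjoin r V) (adjoin r P)"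
      unfolding complements_def
    proof (intro CollectI conjI ballI)
      show "vec.subspace R" by (rule R')
      show "R \<subseteq> adjoin r V" using R'(2) adjoin_mono[OF S'(2)] by blast
      have "y = 0" if y: "y \<in> R" "y \<in> adjoin r P" for y
      proof -
        obtain c s where cs: "s \<in> S" "y = c *s r + s" using y R'(2) adjoin_iff[OF S'(1)] by blast
        obtain d p where dp: "p \<in> P" "y = d *s r + p" using y adjoin_iff[OF P(1)] by blast
        have "c = d \<and> s = p"
          using cs dp S'(2) P(2) by (intro adjoin_coords_unique[OF V r(1)]) auto
        hence "s = 0" using cs dp S'(3) by auto
        hence "y \<in> R \<inter> L" using y cs L by auto
        thus "y = 0" using R'(3) by auto
      qed
      thus "R \<inter> adjoin r P = {0}" using vec.subspace_0[OF R'(1)] vec.subspace_0[OF subspace_adjoin[of r P]] by auto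
      fix x assume "x \<in> adjoin r V"
      then obtain c w where cw: "w \<in> V" "x = c *s r + w" using adjoin_iff[OF V] by blast
      obtain s where s: "s \<in> S" "w - s \<in> P" using S'(4) cw by blast
      obtain u d where u: "u \<in> R" "s - u = d *s r" using R'(4)[of s] s L adjoin_superset[of S r] by blast
      have "x - u = (c + d) *s r + (w - s)"
        using cw u by (simp add: vec.scale_left_distrib algebra_simps)
      thus "\<exists>s\<in>R. x - s \<in> adjoin r P" using adjoin_memI[OF P(1) s(2)] u by (intro bexI[of _ u]) auto
    qed
    thus ?thesis by (intro conjI eq cut)
  qed
  have cover: "adjoin r R \<inter> V \<in> complements V P \<and> R \<in> complements (adjoin r (adjoin r R \<inter> V)) L"
    if R: "R \<in> complements (adjoin r V) (adjoin r P)" for R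
  proof -
    note R' = complementsD[OF R]
    define S where "S = adjoin r R \<inter> V"
    have S1: "vec.subspace S" unfolding S_def by (rule vec.subspace_inter[OF subspace_adjoin V])
    have "S \<in> complements V P"
      unfolding complements_def
    proof (intro CollectI conjI ballI)
      show "vec.subspace S" "S \<subseteq> V" using S1 by (auto simp: S_def)
      have "y = 0" if y: "y \<in> S" "y \<in> P" for y
      proof -
        obtain c u where cu: "u \<in> R" "y = c *s r + u" using y adjoin_iff[OF R'(1)] by (auto simp: S_def)
        have "u = (- c) *s r + y" using cu by simp
        hence "u \<in> adjoin r P" using adjoin_memI[OF P(1) y(2)] by metis
        hence "u = 0" using cu R'(3) by blast
        thus "y = 0" using rn[of 0 c] cu y vec.subspace_0[OF V] by (auto simp: S_def)
      qed
      thus "S \<inter> P = {0}" using vec.subspace_0[OF S1] vec.subspace_0[OF P(1)] by auto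
      fix w assume w: "w \<in> V"
      then obtain u where u: "u \<in> R" "w - u \<in> adjoin r P" using R'(4) adjoin_superset by blast
      obtain c p where cp: "p \<in> P" "w - u = c *s r + p" using u adjoin_iff[OF P(1)] by blast
      have "c *s r + u = w - p" using cp by (simp add: algebra_simps)
      moreover have "w - p \<in> V" using w cp P by (intro vec.subspace_diff[OF V]) auto
      ultimately have "w - p \<in> S" using adjoin_memI[OF R'(1) u(1), of c r] by (simp add: S_def)
      thus "\<exists>s\<in>S. w - s \<in> P" using cp by (intro bexI[of _ "w - p"]) auto
    qed
    moreover have "R \<in> complements (adjoin r S) L"
      unfolding complements_def
    proof (intro CollectI conjI ballI)
      show "vec.subspace R" by (rule R')
      show "R \<subseteq> adjoin r S"
      proof
        fix u assume u: "u \<in> R"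
        then obtain c w where cw: "w \<in> V" "u = c *s r + w" using R'(2) adjoin_iff[OF V] by blast
        have "w = (- c) *s r + u" using cw by simp
        hence "w \<in> S" using adjoin_memI[OF R'(1) u, of "- c" r] cw by (simp add: S_def)
        thus "u \<in> adjoin r S" using adjoin_memI[OF S1] cw by simp
      qed
      have "L \<subseteq> adjoin r P" using adjoin_mono[of "{0}" P r] vec.subspace_0[OF P(1)] by (simp add: L_def)
      thus "R \<inter> L = {0}" using R'(3) vec.subspace_0[OF R'(1)] vec.subspace_0[OF subspace_adjoin[of r "{0}"]]
        by (auto simp: L_def)
      fix x assume "x \<in> adjoin r S"
      moreover have "adjoin r S \<subseteq> adjoin r R" by (intro adjoin_minimal) (auto simp: S_def adjoin_self)
      ultimately obtain c u where "u \<in> R" "x = c *s r + u" using adjoin_iff[OF R'(1)] by blast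
      thus "\<exists>s\<in>R. x - s \<in> L" using L by (intro bexI[of _ u]) auto
    qed
    ultimately show ?thesis unfolding S_def by blast
  qed
  have union: "complements (adjoin r V) (adjoin r P) = (\<Union>S\<in>complements V P. complements (adjoin r S) L)"
    using part cover by blast
  have gen: "(\<Sum>S\<in>complements (adjoin r V) (adjoin r P). g S) = q ^ (vec.dim V - vec.dim P) * (\<Sum>S\<in>complements V P. g S)"
    if g: "\<And>S T. vec.subspace S \<Longrightarrow> r \<notin> S \<Longrightarrow> vec.subspace T \<Longrightarrow> r \<notin> T \<Longrightarrow> adjoin r S = adjoin r T \<Longrightarrow>
        \<forall>y\<in>adjoin r S. f r y = 0 \<Longrightarrow> g S = (g T :: real)" for g
  proof -
    have "(\<Sum>S\<in>complements (adjoin r V) (adjoin r P). g S) = (\<Sum>S\<in>complements V P. \<Sum>R\<in>complements (adjoin r S) L. g R)"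
      unfolding union
    proof (rule sum.UNION_disjoint)
      show "\<forall>S\<in>complements V P. \<forall>T\<in>complements V P. S \<noteq> T \<longrightarrow> complements (adjoin r S) L \<inter> complements (adjoin r T) L = {}"
      proof (intro ballI impI equals0I)
        fix S T R assume a: "S \<in> complements V P" "T \<in> complements V P" "S \<noteq> T" "R \<in> complements (adjoin r S) L \<inter> complements (adjoin r T) L"
        have "S = adjoin r R \<inter> V" "T = adjoin r R \<inter> V" using part[of S R] part[of T R] a by blast+
        thus False using a(3) by blast
      qed
    qed auto
    also have "\<dots> = (\<Sum>S\<in>complements V P. q ^ (vec.dim V - vec.dim P) * g S)"
    proof (rule sum.cong[OF refl])
      fix S assume S: "S \<in> complements V P"
      have rS: "r \<notin> S" using complementsD(2)[OF S] r(1) by blast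
      have "g R = g S" if R: "R \<in> complements (adjoin r S) L" for R
      proof (rule g)
        have "R \<inter> L = {0}" "r \<in> L" using complementsD(3)[OF R] L by (auto intro: exI[of _ 1])
        moreover have "r \<noteq> 0" using r(1) vec.subspace_0[OF V] by blast
        ultimately show "r \<notin> R" by blast
        have "adjoin r R = adjoin r S" using part[OF S R] by blast
        thus "adjoin r R = adjoin r S" "\<forall>y\<in>adjoin r R. f r y = 0" using r(2) adjoin_mono[OF complementsD(2)[OF S]] by auto
      qed (use complementsD(1)[OF R] complementsD(1)[OF S] rS in auto)
      hence "(\<Sum>R\<in>complements (adjoin r S) L. g R) = real (card (complements (adjoin r S) L)) * g S" by simp
      also have "card (complements (adjoin r S) L) = CARD('a) ^ vec.dim S"
        unfolding L_def by (rule card_complements_line[OF complementsD(1)[OF S] rS])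
      also have "vec.dim S = vec.dim V - vec.dim P" using dim_complements[OF V P S] by simp
      finally show "(\<Sum>R\<in>complements (adjoin r S) L. g R) = q ^ (vec.dim V - vec.dim P) * g S"
        by (simp add: q_eq)
    qed
    finally show ?thesis by (simp add: sum_distrib_left)
  qed
  show "(\<Sum>S\<in>complements (adjoin r V) (adjoin r P). border_ind S) = q ^ (vec.dim V - vec.dim P) * border_count V P"
    unfolding border_count_def by (rule gen[OF c_adjoin_isotropic(1)])
  show "(\<Sum>S\<in>complements (adjoin r V) (adjoin r P). signed_border_ind S) = q ^ (vec.dim V - vec.dim P) * signed_border_count V P"
    unfolding signed_border_count_def by (rule gen[OF c_adjoin_isotropic(2)])
qed

text \<open>For every complement S of \<open>adjoin r P\<close> in \<open>adjoin r V\<close>,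
  singular or not, the sum over v is a multiple of the border value of S. Hence no discriminant term
  occurs, in contrast to \<open>step_even\<close>: border counts for (V, P) become counts of
  complements in a larger space.\<close>

lemma step_hyperbolic:
  assumes V: "vec.subspace V" "corank V = 0" and P: "vec.subspace P" "P \<subseteq> V"
    and r: "r \<in> orth V" "r' \<in> orth V" "f r r = 0" "f r' r = 1"
  shows "nonsing_count (adjoin r' (adjoin r V)) (adjoin r P) = q ^ vec.dim V * (q - 1) * border_count V P"
    and "signed_count (adjoin r' (adjoin r V)) (adjoin r P) = q ^ vec.dim V * (q - 1) * signed_border_count V P"
proof -
  have rV: "\<forall>y\<in>V. f r y = 0" "\<forall>y\<in>V. f r' y = 0" using r by (auto simp: orth_def)
  have r0: "r \<noteq> 0" using r by (auto simp: f_simps)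
  have rn: "r \<notin> V" using nondeg_witness[OF V _ r0] rV by blast
  have ro: "\<forall>y\<in>adjoin r V. f r y = 0" using rV r by (auto simp: adjoin_iff[OF V(1)] f_simps)
  have rn': "r' \<notin> adjoin r V" using ro r f_sym[of r r'] by auto
  have P1: "adjoin r P \<subseteq> adjoin r V" by (rule adjoin_mono[OF P(2)])
  have dP: "vec.dim P \<le> vec.dim V" by (rule vec.dim_subset[OF P(2)])
  have rnP: "r \<notin> P" using rn P by blast
  have cP: "real (card (adjoin r P)) = q * q ^ vec.dim P"
    by (simp add: card_adjoin[OF P(1) rnP] card_subspace[OF P(1)] q_eq)
  have key: "q * (\<Sum>v\<in>adjoin r P. nonsing_ind (adjoin (r' + v) S)) = real (card (adjoin r P)) * (q - 1) * border_ind S \<and>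
      q * (\<Sum>v\<in>adjoin r P. signed_ind (adjoin (r' + v) S)) = real (card (adjoin r P)) * (q - 1) * signed_border_ind S"
    if S: "S \<in> complements (adjoin r V) (adjoin r P)" for S
  proof (cases "corank S = 0")
    case True
    have "r \<in> orth (adjoin r V)" using ro by (auto simp: orth_def)
    thus ?thesis using border_nonsingular[OF subspace_adjoin subspace_adjoin P1 S True adjoin_self _ r(4)] by blast
  next
    case False
    note S1 = complementsD(1)[OF S]
    \<comment> \<open>\<open>adjoin r V\<close> is degenerate, so the witness has to come from V,
      through the component w of t in V. This component is nonzero, since otherwise t would be a
      multiple of r and so lie in \<open>adjoin r P\<close>.\<close>
    have "\<exists>p\<in>adjoin r P. f p t \<noteq> 0" if t: "t \<in> rad S" "t \<noteq> 0" for t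
    proof -
      have tS: "t \<in> S" using t by (auto simp: rad_def)
      then obtain c w where cw: "w \<in> V" "t = c *s r + w" using complementsD(2)[OF S] adjoin_iff[OF V(1)] by blast
      have ft: "f y t = f y w" if "y \<in> V" for y
        using that cw rV f_sym[of y r] by (simp add: f_simps)
      have w0: "w \<noteq> 0"
      proof
        assume "w = 0"
        hence "t = c *s r + 0" using cw by simp
        hence "t \<in> S \<inter> adjoin r P" using tS adjoin_memI[OF P(1) vec.subspace_0[OF P(1)]] by simp
        thus False using t complementsD(3)[OF S] by blast
      qed
      then obtain y where y: "y \<in> V" "f w y \<noteq> 0" using nondeg_witness[OF V cw(1)] by blast
      have "y \<in> adjoin r V" using y adjoin_superset by blast
      then obtain s where s: "s \<in> S" "y - s \<in> adjoin r P" using complementsD(4)[OF S] by blast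
      have "f s t = 0" using t s f_sym[of s t] by (auto simp: rad_def)
      moreover have "f y t \<noteq> 0" using y ft f_sym[of w y] by simp
      ultimately have "f (y - s) t \<noteq> 0" by (simp add: f_simps)
      thus ?thesis using s by blast
    qed
    thus ?thesis using sum_adjoin_singular[OF S1 _ subspace_adjoin, of r P r'] False by blast
  qed
  have "q * nonsing_count (adjoin r' (adjoin r V)) (adjoin r P) = real (card (adjoin r P)) * (q - 1) * (q ^ (vec.dim V - vec.dim P) * border_count V P)"
    unfolding nonsing_count_def sum_complements_adjoin[OF subspace_adjoin subspace_adjoin P1 rn'] sum_complements_isotropic_adjoin(1)[OF V(1) P rn ro, symmetric]
    using key by (simp add: sum_distrib_left)
  moreover have "q * signed_count (adjoin r' (adjoin r V)) (adjoin r P) = real (card (adjoin r P)) * (q - 1) * (q ^ (vec.dim V - vec.dim P) * signed_border_count V P)"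
    unfolding signed_count_def sum_complements_adjoin[OF subspace_adjoin subspace_adjoin P1 rn'] sum_complements_isotropic_adjoin(2)[OF V(1) P rn ro, symmetric]
    using key by (simp add: sum_distrib_left)
  moreover have "q ^ vec.dim V = q ^ vec.dim P * q ^ (vec.dim V - vec.dim P)"
    using dP by (simp add: power_add[symmetric])
  ultimately have "q * nonsing_count (adjoin r' (adjoin r V)) (adjoin r P) = q * (q ^ vec.dim V * (q - 1) * border_count V P)"
    "q * signed_count (adjoin r' (adjoin r V)) (adjoin r P) = q * (q ^ vec.dim V * (q - 1) * signed_border_count V P)"
    using cP by (simp_all add: algebra_simps)
  thus "nonsing_count (adjoin r' (adjoin r V)) (adjoin r P) = q ^ vec.dim V * (q - 1) * border_count V P"
    "signed_count (adjoin r' (adjoin r V)) (adjoin r P) = q ^ vec.dim V * (q - 1) * signed_border_count V P"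
    using q_pos by simp_all
qed

end

section \<open>Isometries and duality\<close>

lemma image_adjoin:
  fixes T :: "'a::{field,finite} ^ 'k \<Rightarrow> 'a ^ 'l"
  assumes T: "\<And>x y. T (x + y) = T x + T y" "\<And>c x. T (c *s x) = c *s T x" and S: "vec.subspace S"
  shows "vec.subspace (T ` S)" "T ` adjoin x S = adjoin (T x) (T ` S)"
proof -
  have z: "T 0 = 0" using T(2)[of 0 0] by simp
  show sub: "vec.subspace (T ` S)"
  proof (rule vec.subspaceI)
    show "0 \<in> T ` S" using z vec.subspace_0[OF S] by (metis imageI)
    show "x + y \<in> T ` S" if "x \<in> T ` S" "y \<in> T ` S" for x y
      using that T(1) vec.subspace_add[OF S] by (metis (no_types, lifting) image_iff)
    show "c *s x \<in> T ` S" if "x \<in> T ` S" for c x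
      using that T(2) vec.subspace_scale[OF S] by (metis (no_types, lifting) image_iff)
  qed
  show "T ` adjoin x S = adjoin (T x) (T ` S)"
  proof (intro subset_antisym subsetI)
    fix y assume "y \<in> T ` adjoin x S"
    then obtain c s where "s \<in> S" "y = T (c *s x + s)" by (auto simp: adjoin_iff[OF S])
    thus "y \<in> adjoin (T x) (T ` S)" using adjoin_memI[OF sub, of "T s" c "T x"] by (simp add: T)
  next
    fix y assume "y \<in> adjoin (T x) (T ` S)"
    then obtain c s where s: "s \<in> S" "y = c *s T x + T s" using adjoin_iff[OF sub] by blast
    hence "y = T (c *s x + s)" by (simp add: T)
    thus "y \<in> T ` adjoin x S" using adjoin_memI[OF S s(1)] by blast
  qed
qed

lemma image_complements:
  fixes T :: "'a::{field,finite} ^ 'k \<Rightarrow> 'a ^ 'l"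
  assumes T: "\<And>x y. T (x + y) = T x + T y" "\<And>c x. T (c *s x) = c *s T x" and inj: "inj_on T V"
    and V: "vec.subspace V" and P: "vec.subspace P" "P \<subseteq> V"
  shows "bij_betw (image T) (complements V P) (complements (T ` V) (T ` P))"
proof (rule bij_betw_imageI)
  note sub = image_adjoin(1)[of T, OF T]
  have z: "T 0 = 0" using T(2)[of 0 0] by simp
  have d: "T (x - y) = T x - T y" for x y
    using T(1)[of "x - y" y] by simp
  show "inj_on (image T) (complements V P)"
    using inj by (auto intro!: inj_onI simp: complements_def dest: inj_on_image_eq_iff[OF inj])
  show "image T ` complements V P = complements (T ` V) (T ` P)"
  proof (intro subset_antisym subsetI)
    fix R assume "R \<in> image T ` complements V P"
    then obtain S where R: "R = T ` S" and S: "S \<in> complements V P" by blast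
    note S' = complementsD[OF S]
    have "T ` S \<inter> T ` P = T ` (S \<inter> P)" using inj S'(2) P(2) by (intro inj_on_image_Int[symmetric])
    hence "T ` S \<inter> T ` P = {0}" using S'(3) z by simp
    moreover have "\<exists>s\<in>T ` S. v - s \<in> T ` P" if v: "v \<in> T ` V" for v
    proof -
      obtain w where w: "w \<in> V" "v = T w" using v by blast
      obtain s where "s \<in> S" "w - s \<in> P" using S'(4)[OF w(1)] by blast
      thus ?thesis using w d by (intro bexI[of _ "T s"]) (auto simp flip: d)
    qed
    ultimately show "R \<in> complements (T ` V) (T ` P)" using sub[OF S'(1)] S'(2) R by (auto simp: complements_def)
  next
    fix R assume R: "R \<in> complements (T ` V) (T ` P)"
    note R' = complementsD[OF R]
    define S where "S = {x \<in> V. T x \<in> R}"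
    have RS: "R = T ` S" using R'(2) by (auto simp: S_def)
    have S1: "vec.subspace S"
      by (rule vec.subspaceI)
        (use z T vec.subspace_0[OF V] vec.subspace_add[OF V] vec.subspace_scale[OF V]
          vec.subspace_0[OF R'(1)] vec.subspace_add[OF R'(1)] vec.subspace_scale[OF R'(1)] in \<open>auto simp: S_def\<close>)
    have "S \<in> complements V P"
      unfolding complements_def
    proof (intro CollectI conjI ballI)
      show "vec.subspace S" "S \<subseteq> V" using S1 by (auto simp: S_def)
      have "x = 0" if x: "x \<in> S" "x \<in> P" for x
      proof -
        have "T x \<in> R \<inter> T ` P" using x by (auto simp: S_def)
        hence "T x = T 0" using R'(3) z by simp
        thus "x = 0" using inj_onD[OF inj] x vec.subspace_0[OF V] P by blast
      qed
      thus "S \<inter> P = {0}" using vec.subspace_0[OF S1] vec.subspace_0[OF P(1)] by auto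
      fix v assume v: "v \<in> V"
      then obtain s where "s \<in> S" "T v - T s \<in> T ` P" using R'(4)[of "T v"] RS by blast
      then obtain p where s: "s \<in> S" and p: "p \<in> P" "T (v - s) = T p" using d by auto
      have "v - s \<in> V" using v s by (intro vec.subspace_diff[OF V]) (auto simp: S_def)
      hence "v - s = p" using inj_onD[OF inj] p P by blast
      thus "\<exists>s\<in>S. v - s \<in> P" using s p by blast
    qed
    thus "R \<in> image T ` complements V P" using RS by blast
  qed
qed

context sym_form
begin

lemma diag_isometry:
  fixes g :: "'a ^ 'l \<Rightarrow> 'a ^ 'l \<Rightarrow> 'a" and T :: "'a ^ 'k \<Rightarrow> 'a ^ 'l"
  assumes g: "sym_form g q sig"
    and T: "\<And>x y. T (x + y) = T x + T y" "\<And>c x. T (c *s x) = c *s T x" and inj: "inj_on T V"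
    and iso: "\<And>x y. x \<in> V \<Longrightarrow> y \<in> V \<Longrightarrow> g (T x) (T y) = f x y"
  shows "diag S as m \<Longrightarrow> S \<subseteq> V \<Longrightarrow> sym_form.diag g (T ` S) as m"
proof (induction rule: diag.induct)
  interpret G: sym_form g q sig by (rule g)
  have z: "T 0 = 0" using T(2)[of 0 0] by simp
  {
    case zero
    then show ?case using G.diag.zero by (simp add: z)
  next
    case (nonsing S as m x)
    have x: "x \<in> V" "S \<subseteq> V" using nonsing.prems adjoin_self adjoin_superset by blast+
    have "G.diag (adjoin (T x) (T ` S)) (g (T x) (T x) # as) m"
      using nonsing x by (intro G.diag.nonsing) (auto simp: iso subsetD)
    thus ?case using iso[OF x(1) x(1)] image_adjoin(2)[of T, OF T diag_subspace[OF nonsing.hyps(1)]] by simp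
  next
    case (sing S as m x)
    have x: "x \<in> V" "S \<subseteq> V" using sing.prems adjoin_self adjoin_superset by blast+
    have "T x \<notin> T ` S" using inj_on_image_mem_iff[OF inj x] sing.hyps by simp
    hence "G.diag (adjoin (T x) (T ` S)) as (Suc m)"
      using sing x by (intro G.diag.sing) (auto simp: iso subsetD)
    thus ?case using image_adjoin(2)[of T, OF T diag_subspace[OF sing.hyps(1)]] by simp
  }
qed

lemma h_isometry:
  fixes g :: "'a ^ 'l \<Rightarrow> 'a ^ 'l \<Rightarrow> 'a" and T :: "'a ^ 'k \<Rightarrow> 'a ^ 'l"
  assumes g: "sym_form g q sig"
    and T: "\<And>x y. T (x + y) = T x + T y" "\<And>c x. T (c *s x) = c *s T x" and inj: "inj_on T V"
    and iso: "\<And>x y. x \<in> V \<Longrightarrow> y \<in> V \<Longrightarrow> g (T x) (T y) = f x y"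
    and S: "vec.subspace S" "S \<subseteq> V"
  shows "sym_form.corank g (T ` S) = corank S" "sym_form.disc_char g (T ` S) = disc_char S"
    "sym_form.nonsing_ind g (T ` S) = nonsing_ind S" "sym_form.signed_ind g (T ` S) = signed_ind S"
proof -
  interpret G: sym_form g q sig by (rule g)
  obtain as m where d: "diag S as m" using diag_exists S by blast
  have d': "G.diag (T ` S) as m" by (rule diag_isometry[OF g T inj iso d S(2)])
  show *: "G.corank (T ` S) = corank S" "G.disc_char (T ` S) = disc_char S"
    using diag_corank[OF d] G.diag_corank[OF d'] diag_disc_char[OF d] G.diag_disc_char[OF d'] by auto
  show "G.nonsing_ind (T ` S) = nonsing_ind S" "G.signed_ind (T ` S) = signed_ind S"
    using * by (simp_all add: nonsing_ind_def G.nonsing_ind_def signed_ind_def G.signed_ind_def)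
qed

lemma nonsing_count_isometry:
  fixes g :: "'a ^ 'l \<Rightarrow> 'a ^ 'l \<Rightarrow> 'a" and T :: "'a ^ 'k \<Rightarrow> 'a ^ 'l"
  assumes g: "sym_form g q sig"
    and T: "\<And>x y. T (x + y) = T x + T y" "\<And>c x. T (c *s x) = c *s T x" and inj: "inj_on T V"
    and iso: "\<And>x y. x \<in> V \<Longrightarrow> y \<in> V \<Longrightarrow> g (T x) (T y) = f x y"
    and V: "vec.subspace V" and P: "vec.subspace P" "P \<subseteq> V"
  shows "sym_form.nonsing_count g (T ` V) (T ` P) = nonsing_count V P"
proof -
  interpret G: sym_form g q sig by (rule g)
  have "G.nonsing_count (T ` V) (T ` P) = (\<Sum>S\<in>complements V P. G.nonsing_ind (T ` S))"
    unfolding G.nonsing_count_def by (rule sum.reindex_bij_betw[OF image_complements[OF T inj V P], symmetric])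
  also have "\<dots> = nonsing_count V P"
    unfolding nonsing_count_def
    by (intro sum.cong refl h_isometry(3)[OF g T inj iso]) (auto dest: complementsD)
  finally show ?thesis .
qed

text \<open>For \<open>P\<close> totally isotropic, the Eichler transformation attached to \<open>v \<in> P\<close> fixes \<open>P\<close> pointwise and
  maps \<open>e\<close> to \<open>e + v\<close>, so all vectors of the coset \<open>e + P\<close> contribute equally.\<close>

definition eichler :: "'a ^ 'k \<Rightarrow> 'a ^ 'k \<Rightarrow> 'a ^ 'k \<Rightarrow> 'a ^ 'k" where
  "eichler e v x = x + (f x e / f e e) *s v - (f x v / f e e) *s e - (f x v / (2 * f e e)) *s v"

lemma eichler_linear:
  "eichler e v (x + y) = eichler e v x + eichler e v y" "eichler e v (c *s x) = c *s eichler e v x"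
  by (simp_all add: eichler_def f_simps add_divide_distrib vec.scale_left_distrib
      vec.scale_right_distrib vec.scale_right_diff_distrib)

lemma eichler_props:
  assumes e: "f e e \<noteq> 0" and v: "f v v = 0" "f e v = 0"
  shows "f (eichler e v x) (eichler e v y) = f x y" and "eichler e v e = e + v"
    and "eichler e (- v) (eichler e v x) = x"
proof -
  have ve: "f v e = 0" using v f_sym[of v e] by simp
  \<comment> \<open>With the coefficients written as multiples of d, the identities below are free
    of division.\<close>
  define d where "d = 1 / (2 * f e e)"
  have d: "(d + d) * f e e = 1"
    using e two by (simp add: d_def mult_2[symmetric])
  have dd: "z / f e e = z * (d + d)" "z / (2 * f e e) = z * d" for z
    using e two by (simp_all add: d_def mult_2[symmetric])
  have E: "eichler e u x = x + (f x e * (d + d)) *s u - (f x u * (d + d)) *s e - (f x u * d) *s u" for u x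
    unfolding eichler_def dd ..
  show "eichler e v e = e + v" using e v ve by (simp add: eichler_def f_simps)
  have fe: "f (eichler e v x) e = f x e - f x v" "f (eichler e v x) v = f x v" for x
    using e v ve by (simp_all add: eichler_def f_simps)
  have "f (eichler e v x) (eichler e v y) =
      f (eichler e v x) y + f y e * (d + d) * f x v - f y v * (d + d) * (f x e - f x v) - f y v * d * f x v"
    unfolding E[of v y] by (simp only: f_simps fe)
  also have "f (eichler e v x) y = f x y + f x e * (d + d) * f y v - f x v * (d + d) * f y e - f x v * d * f y v"
    unfolding E[of v x] by (simp only: f_simps f_sym[of v y] f_sym[of e y])
  finally show "f (eichler e v x) (eichler e v y) = f x y" by (simp add: algebra_simps)
  define A B C D C' where "A = f x e * (d + d)" and "B = f x v * (d + d)" and "C = f x v * d"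
    and "D = (f x e - f x v) * (d + d)" and "C' = f x v * d"
  have "eichler e (- v) (eichler e v x) = eichler e v x - D *s v + B *s e - C' *s v"
    unfolding E[of "- v"] f_minus fe by (simp add: B_def C'_def D_def)
  also have "\<dots> = x + (A - C - D - C') *s v"
    unfolding E[of v] A_def[symmetric] B_def[symmetric] C_def[symmetric]
    by (simp add: vec.scale_left_diff_distrib)
  also have "A - C - D - C' = 0" by (simp add: A_def C_def C'_def D_def algebra_simps)
  finally show "eichler e (- v) (eichler e v x) = x" by simp
qed

lemma step_isotropic_coset:
  assumes V: "vec.subspace V" and P: "vec.subspace P" "P \<subseteq> V" "\<forall>x\<in>P. \<forall>y\<in>P. f x y = 0"
    and e: "e \<in> orth V" "f e e \<noteq> 0" and v: "v \<in> P"
    and h: "h = nonsing_ind \<or> h = signed_ind"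
  shows "(\<Sum>S\<in>complements V P. h (adjoin (e + v) S)) = (\<Sum>S\<in>complements V P. h (adjoin e S))"
proof -
  define W where "W = adjoin e V"
  define T where "T = eichler e v"
  have eV: "e \<notin> V" by (rule orth_vector_notin[OF e])
  have VW: "V \<subseteq> W" "e \<in> W" unfolding W_def by (auto simp: adjoin_self adjoin_superset[THEN subsetD])
  have W: "vec.subspace W" "P \<subseteq> W" using P VW by (auto simp: W_def)
  have vv: "f v v = 0" "f e v = 0" using P v e by (auto simp: orth_def)
  hence vv': "f (- v) (- v) = 0" "f e (- v) = 0" by (simp_all add: f_minus)
  have TW: "eichler e u x \<in> W" if "u \<in> P" "x \<in> W" for u x
    unfolding eichler_def using that VW W P(2)
    by (intro vec.subspace_diff[OF W(1)] vec.subspace_add[OF W(1)] vec.subspace_scale[OF W(1)]) auto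
  have inv: "eichler e (- v) (T x) = x" "T (eichler e (- v) x) = x" for x
    using eichler_props(3)[OF e(2) vv] eichler_props(3)[OF e(2) vv'] by (simp_all add: T_def)
  have inj: "inj T" by (rule inj_on_inverseI[of _ "eichler e (- v)"]) (rule inv)
  have TWW: "T ` W = W"
  proof
    show "T ` W \<subseteq> W" using TW[OF v] by (auto simp: T_def)
    have "eichler e (- v) x \<in> W" if "x \<in> W" for x using TW[OF vec.subspace_neg[OF P(1) v] that] .
    thus "W \<subseteq> T ` W" using inv(2) by (metis imageI subsetI)
  qed
  have "T x = x" if "x \<in> P" for x
  proof -
    have "f x e = 0" using e that P(2) f_sym[of x e] by (auto simp: orth_def)
    moreover have "f x v = 0" using that v P(3) by blast
    ultimately show ?thesis by (simp add: T_def eichler_def)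
  qed
  hence TP: "T ` P = P" by simp
  have axioms: "sym_form f q sig" by unfold_locales
  note lin = eichler_linear[of e v, folded T_def]
  have iso: "f (T x) (T y) = f x y" for x y
    unfolding T_def by (rule eichler_props(1)[OF e(2) vv])
  have Te: "T e = e + v" unfolding T_def by (rule eichler_props(2)[OF e(2) vv])
  have injW: "inj_on T W" using inj by (rule inj_on_subset) simp
  have hT: "h (T ` S) = h S" if "S \<in> complements W P" for S
    using h h_isometry(3,4)[OF axioms lin injW iso complementsD(1,2)[OF that]] by auto
  \<comment> \<open>A complement of P in W contains e + u for exactly one u in P, so the condition
    \<open>e + u \<in> S\<close> selects a single term of the inner sum in
    \<open>sum_complements_adjoin\<close>.\<close>
  have coset: "(\<Sum>S\<in>complements W P. if e + u \<in> S then h S else 0) = (\<Sum>S\<in>complements V P. h (adjoin (e + u) S))"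
    if u: "u \<in> P" for u
  proof -
    have mem: "e + u \<in> adjoin (e + w) S \<longleftrightarrow> w = u" if S: "S \<in> complements V P" and w: "w \<in> P" for S w
    proof
      assume m: "e + u \<in> adjoin (e + w) S"
      have "adjoin (e + w) S \<in> complements W P"
        using bij_betwE[OF adjoin_complements_bij[OF V P(1,2) eV]] S w by (auto simp: W_def)
      hence "adjoin (e + w) S \<inter> P = {0}" by (rule complementsD)
      moreover have "(e + u) - (e + w) \<in> adjoin (e + w) S"
        by (intro vec.subspace_diff subspace_adjoin m adjoin_self)
      moreover have "(e + u) - (e + w) \<in> P" using vec.subspace_diff[OF P(1) u w] by simp
      ultimately have "(e + u) - (e + w) = 0" by blast
      thus "w = u" by simp
    qed (simp add: adjoin_self)
    have "(\<Sum>S\<in>complements W P. if e + u \<in> S then h S else 0) =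
        (\<Sum>S\<in>complements V P. \<Sum>w\<in>P. if e + u \<in> adjoin (e + w) S then h (adjoin (e + w) S) else 0)"
      unfolding W_def by (rule sum_complements_adjoin[OF V P(1,2) eV])
    also have "\<dots> = (\<Sum>S\<in>complements V P. \<Sum>w\<in>P. if w = u then h (adjoin (e + w) S) else 0)"
      using mem by (intro sum.cong refl) auto
    also have "\<dots> = (\<Sum>S\<in>complements V P. h (adjoin (e + u) S))"
      using u by (simp add: sum.delta)
    finally show ?thesis .
  qed
  have "(\<Sum>S\<in>complements W P. if e + v \<in> S then h S else 0) = (\<Sum>S\<in>complements W P. if e + v \<in> T ` S then h (T ` S) else 0)"
    using sum.reindex_bij_betw[OF image_complements[OF lin injW W(1) P(1) W(2)], unfolded TWW TP,
        of "\<lambda>S. if e + v \<in> S then h S else 0"] by simp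
  also have "\<dots> = (\<Sum>S\<in>complements W P. if e + 0 \<in> S then h S else 0)"
  proof (rule sum.cong[OF refl])
    fix S assume S: "S \<in> complements W P"
    have "e + v \<in> T ` S \<longleftrightarrow> e \<in> S" unfolding Te[symmetric] by (rule inj_image_mem_iff[OF inj])
    thus "(if e + v \<in> T ` S then h (T ` S) else 0) = (if e + 0 \<in> S then h S else 0)" using hT[OF S] by simp
  qed
  finally show ?thesis using coset[OF v] coset[OF vec.subspace_0[OF P(1)]] by simp
qed

text \<open>A second evaluation of the sums in \<open>step_even\<close> and \<open>step_odd\<close>.
  Comparing the two yields linear relations between the counts for (V, P).\<close>

lemma step_isotropic:
  assumes V: "vec.subspace V" and P: "vec.subspace P" "P \<subseteq> V" "\<forall>x\<in>P. \<forall>y\<in>P. f x y = 0"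
    and e: "e \<in> orth V" "f e e \<noteq> 0"
  shows "nonsing_count (adjoin e V) P = real (card P) * nonsing_count V P"
    and "signed_count (adjoin e V) P = real (card P) * quad_char (f e e) * signed_count V P"
proof -
  have gen: "(\<Sum>S\<in>complements (adjoin e V) P. h S) = real (card P) * (\<Sum>S\<in>complements V P. h (adjoin e S))" if h: "h = nonsing_ind \<or> h = signed_ind" for h
  proof -
    have "(\<Sum>S\<in>complements (adjoin e V) P. h S) = (\<Sum>v\<in>P. \<Sum>S\<in>complements V P. h (adjoin (e + v) S))"
      unfolding sum_complements_adjoin[OF V P(1,2) orth_vector_notin[OF e]] by (rule sum.swap)
    also have "\<dots> = (\<Sum>v\<in>P. \<Sum>S\<in>complements V P. h (adjoin e S))"
      by (intro sum.cong refl step_isotropic_coset[OF V P e _ h])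
    finally show ?thesis by simp
  qed
  have e1: "nonsing_ind (adjoin e S) = nonsing_ind S \<and> signed_ind (adjoin e S) = quad_char (f e e) * signed_ind S" if S: "S \<in> complements V P" for S
  proof -
    have "\<forall>y\<in>S. f e y = 0" using e complementsD(2)[OF S] by (auto simp: orth_def)
    from disc_char_adjoin_nonsing[OF complementsD(1)[OF S] this e(2)] show ?thesis by (simp add: nonsing_ind_def signed_ind_def)
  qed
  show "nonsing_count (adjoin e V) P = real (card P) * nonsing_count V P"
    unfolding nonsing_count_def gen[OF disjI1[OF refl]] using e1 by simp
  show "signed_count (adjoin e V) P = real (card P) * quad_char (f e e) * signed_count V P"
    unfolding signed_count_def gen[OF disjI2[OF refl]] using e1 by (simp add: sum_distrib_left mult.assoc)
qed

text \<open>Double counting of the orthogonal pairs in P and V: a nonzero functional vanishes on a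
  proportion 1/q of its domain, the zero functional everywhere.\<close>

lemma dim_orth:
  assumes V: "vec.subspace V" "corank V = 0" and P: "vec.subspace P" "P \<subseteq> V"
  shows "vec.dim (V \<inter> orth P) + vec.dim P = vec.dim V"
proof -
  define A where "A = V \<inter> orth P"
  have A: "vec.subspace A" unfolding A_def by (rule vec.subspace_inter[OF V(1) subspace_orth])
  have "(\<Sum>p\<in>P. \<Sum>v\<in>V. if f v p = 0 then 1 else 0) = (\<Sum>v\<in>V. \<Sum>p\<in>P. if f v p = 0 then 1 else (0::real))"
    by (rule sum.swap)
  hence "(\<Sum>p\<in>P. q * real (card {v\<in>V. f v p = 0})) = (\<Sum>v\<in>V. q * real (card {p\<in>P. f v p = 0}))"
    by (simp add: sum.inter_filter[symmetric] sum_distrib_left[symmetric])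
  moreover have "(\<Sum>p\<in>P. q * real (card {v\<in>V. f v p = 0})) =
      (\<Sum>p\<in>P. real (card V) + (if p = 0 then (q - 1) * real (card V) else 0))"
  proof (rule sum.cong[OF refl])
    fix p assume p: "p \<in> P"
    show "q * real (card {v\<in>V. f v p = 0}) = real (card V) + (if p = 0 then (q - 1) * real (card V) else 0)"
    proof (cases "p = 0")
      case True thus ?thesis by (simp add: f_zero algebra_simps)
    next
      case False
      then obtain y where "y \<in> V" "f y p \<noteq> 0" using nondeg_witness[OF V, of p] p P f_sym[of p] by auto
      thus ?thesis using functional_fibre[OF V(1)] False by simp
    qed
  qed
  moreover have "(\<Sum>v\<in>V. q * real (card {p\<in>P. f v p = 0})) =
      (\<Sum>v\<in>V. real (card P) + (if v \<in> A then (q - 1) * real (card P) else 0))"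
  proof (rule sum.cong[OF refl])
    fix v assume v: "v \<in> V"
    show "q * real (card {p\<in>P. f v p = 0}) = real (card P) + (if v \<in> A then (q - 1) * real (card P) else 0)"
    proof (cases "v \<in> A")
      case True
      hence "{p\<in>P. f v p = 0} = P" by (auto simp: A_def orth_def)
      thus ?thesis using True by (simp add: algebra_simps)
    next
      case False
      then obtain p where "p \<in> P" "f p v \<noteq> 0" using v f_sym[of v] by (auto simp: A_def orth_def)
      thus ?thesis using functional_fibre[OF P(1), of p v 0] False f_sym[of v] by simp
    qed
  qed
  moreover have "A \<inter> V = A" "A \<subseteq> V" by (auto simp: A_def)
  ultimately have "real (card P) * real (card V) + (q - 1) * real (card V) =
      real (card V) * real (card P) + real (card A) * ((q - 1) * real (card P))"
    using vec.subspace_0[OF P(1)]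
    by (simp add: sum.distrib sum.inter_restrict[symmetric] Int_absorb1)
  hence "(q - 1) * (real (card A) * real (card P)) = (q - 1) * real (card V)" by (simp add: algebra_simps)
  moreover have "q - 1 \<noteq> 0"
  proof -
    have "card {0::'a, 1} \<le> CARD('a)" by (intro card_mono) auto
    thus ?thesis by (simp add: q_eq)
  qed
  ultimately have "real (card A * card P) = real (card V)" by simp
  hence "card A * card P = card V" by (simp only: of_nat_eq_iff)
  hence "CARD('a) ^ (vec.dim A + vec.dim P) = CARD('a) ^ vec.dim V"
    by (simp add: card_subspace A P V power_add)
  moreover have "card {0::'a, 1} \<le> CARD('a)" by (intro card_mono) auto
  ultimately show ?thesis by (simp add: A_def)
qed

lemma double_orth:
  assumes V: "vec.subspace V" "corank V = 0" and P: "vec.subspace P" "P \<subseteq> V"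
  shows "V \<inter> orth (V \<inter> orth P) = P"
proof (rule sym, rule subspace_eqI[OF P(1)])
  have A: "vec.subspace (V \<inter> orth P)" by (rule vec.subspace_inter[OF V(1) subspace_orth])
  show "vec.subspace (V \<inter> orth (V \<inter> orth P))" by (rule vec.subspace_inter[OF V(1) subspace_orth])
  show "P \<subseteq> V \<inter> orth (V \<inter> orth P)"
  proof
    fix p assume "p \<in> P"
    thus "p \<in> V \<inter> orth (V \<inter> orth P)" using P(2) f_sym[of p] by (auto simp: orth_def)
  qed
  show "vec.dim (V \<inter> orth (V \<inter> orth P)) \<le> vec.dim P"
    using dim_orth[OF V P] dim_orth[OF V A] by simp
qed

text \<open>A vector of V orthogonal to S and to P is orthogonal to S + P = V, so the two orthogonal
  complements meet trivially. Non-singular S split off orthogonally, whence the discriminants of S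
  and of its orthogonal complement differ by the factor \<open>disc_char V\<close>.\<close>

lemma dual:
  assumes V: "vec.subspace V" "corank V = 0" and P: "vec.subspace P" "P \<subseteq> V"
  shows "nonsing_count V P = nonsing_count V (V \<inter> orth P)" "signed_count V P = disc_char V * signed_count V (V \<inter> orth P)"
proof -
  define D where "D = (\<lambda>S. V \<inter> orth S)"
  define N where "N = (\<lambda>P. {S \<in> complements V P. corank S = 0})"
  have DP: "vec.subspace (D P)" "D P \<subseteq> V" for P unfolding D_def using vec.subspace_inter[OF V(1) subspace_orth] by auto
  have main: "D S \<in> N (D P) \<and> D (D S) = S \<and> disc_char S = disc_char V * disc_char (D S)"
    if P: "vec.subspace P" "P \<subseteq> V" and S: "S \<in> N P" for S P
  proof -
    have S1: "S \<in> complements V P" "corank S = 0" using S by (auto simp: N_def)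
    note dec = orth_decomp[OF V(1) complementsD(1)[OF S1(1)] S1(2) complementsD(2)[OF S1(1)], folded fun_cong[OF D_def]]
    have "D S \<in> complements V (D P)"
    proof (rule complements_dimI[OF V(1) DP DP])
      show "D S \<inter> D P \<subseteq> {0}"
      proof
        fix x assume x: "x \<in> D S \<inter> D P"
        have "f x y = 0" if y: "y \<in> V" for y
        proof -
          obtain s where "s \<in> S" "y - s \<in> P" using complementsD(4)[OF S1(1) y] by blast
          hence "f x s = 0" "f x (y - s) = 0" using x by (auto simp: D_def orth_def)
          thus ?thesis by (simp add: f_simps)
        qed
        thus "x \<in> {0}" using nondeg_witness[OF V, of x] x by (auto simp: D_def)
      qed
      show "vec.dim (D S) + vec.dim (D P) = vec.dim V"
        using dec(6) dim_complements[OF V(1) P S1(1)] dim_orth[OF V P] by (simp add: D_def)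
    qed
    moreover have "corank (D S) = 0" using dec(4) V by simp
    moreover have "D (D S) = S"
      unfolding D_def by (rule double_orth[OF V complementsD(1,2)[OF S1(1)]])
    moreover have "disc_char S = disc_char V * disc_char (D S)"
      using dec(5) disc_char_sq[OF DP(1), of S] by (simp add: mult.assoc)
    ultimately show ?thesis by (simp add: N_def)
  qed
  have DDP: "D (D P) = P" unfolding D_def by (rule double_orth[OF V P])
  have e0: "nonsing_count V P = (\<Sum>S\<in>N P. 1)" for P
    unfolding nonsing_count_def N_def nonsing_ind_def by (simp add: sum.inter_filter[symmetric])
  have e1: "signed_count V P = (\<Sum>S\<in>N P. disc_char S)" for P
    unfolding signed_count_def N_def signed_ind_def by (simp add: sum.inter_filter)
  have r: "(\<Sum>S\<in>N P. g (D S)) = (\<Sum>S\<in>N (D P). g S)" for g :: "_ \<Rightarrow> real"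
    by (rule sum.reindex_bij_witness[of _ D D])
      (use main[OF P] main[OF DP[of P]] DDP in auto)
  show "nonsing_count V P = nonsing_count V (V \<inter> orth P)"
    unfolding e0 using r[of "\<lambda>_. 1"] by (simp add: D_def)
  have "signed_count V P = (\<Sum>S\<in>N P. disc_char V * disc_char (D S))"
    unfolding e1 using main[OF P] by (intro sum.cong) auto
  thus "signed_count V P = disc_char V * signed_count V (V \<inter> orth P)"
    unfolding e1 r[of "\<lambda>S. disc_char V * disc_char S"] by (simp add: sum_distrib_left D_def)
qed

end

section \<open>Totally isotropic subspaces and the two-step recursion\<close>

text \<open>The proportion of invertible matrices among the symmetric i x i matrices over the field
  with q elements.\<close>

definition nonsing_prob :: "real \<Rightarrow> nat \<Rightarrow> real" where
  "nonsing_prob q i = (\<Prod>l<(i + 1) div 2. 1 - 1 / q ^ (2 * l + 1))"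

text \<open>The function chi_{1,k}(q) of the statement, with a natural number as index.\<close>

definition odd_prod :: "real \<Rightarrow> nat \<Rightarrow> real" where
  "odd_prod q k = (\<Prod>l<k. q ^ (2 * l + 1) - 1)"

text \<open>The exponent k^2 is the sum of the first k odd numbers, one for each
  denominator.\<close>

lemma odd_prod_nonsing_prob:
  assumes "q > 0"
  shows "q ^ (k ^ 2) * (\<Prod>l<k. 1 - 1 / q ^ (2 * l + 1)) = odd_prod q k"
proof (induction k)
  case (Suc k)
  have "(Suc k) ^ 2 = k ^ 2 + (2 * k + 1)" by (simp add: power2_eq_square)
  hence "q ^ ((Suc k) ^ 2) = q ^ (k ^ 2) * q ^ (2 * k + 1)" by (simp only: power_add)
  hence "q ^ ((Suc k) ^ 2) * (\<Prod>l<Suc k. 1 - 1 / q ^ (2 * l + 1)) =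
      (q ^ (k ^ 2) * (\<Prod>l<k. 1 - 1 / q ^ (2 * l + 1))) * (q ^ (2 * k + 1) * (1 - 1 / q ^ (2 * k + 1)))"
    by (simp only: prod.lessThan_Suc) (simp only: ac_simps)
  also have "q ^ (2 * k + 1) * (1 - 1 / q ^ (2 * k + 1)) = q ^ (2 * k + 1) - 1"
    using assms by (simp add: right_diff_distrib)
  finally show ?case by (simp only: Suc odd_prod_def prod.lessThan_Suc)
qed (simp add: odd_prod_def)

context sym_form
begin

lemma hyperbolic_adjoin:
  assumes V: "vec.subspace V" "corank V = 0"
    and r: "r \<in> orth V" "r' \<in> orth V" "f r r = 0" "f r' r = 1"
  shows "corank (adjoin r' (adjoin r V)) = 0" "disc_char (adjoin r' (adjoin r V)) = sig * disc_char V"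
    "vec.dim (adjoin r' (adjoin r V)) = vec.dim V + 2" "r \<notin> V"
proof -
  have rV: "\<forall>y\<in>V. f r y = 0" using r by (auto simp: orth_def)
  have r0: "r \<noteq> 0" using r by (auto simp: f_simps)
  show rn: "r \<notin> V" using nondeg_witness[OF V _ r0] rV by blast
  have ro: "\<forall>y\<in>adjoin r V. f r y = 0" using rV r by (auto simp: adjoin_iff[OF V(1)] f_simps)
  have rn': "r' \<notin> adjoin r V" using ro r f_sym[of r r'] by auto
  have c: "corank (adjoin r V) = 1" "disc_char (adjoin r V) = disc_char V" using disc_char_adjoin_sing[OF V(1) rV r(3) rn] V by auto
  have rr: "r \<in> rad (adjoin r V)" using ro adjoin_self by (auto simp: rad_def)
  have "f r' r \<noteq> 0" using r by simp
  from adjoin_hyperbolic[OF subspace_adjoin c(1) rr this] show "corank (adjoin r' (adjoin r V)) = 0"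
    "disc_char (adjoin r' (adjoin r V)) = sig * disc_char V" by (simp_all add: c)
  show "vec.dim (adjoin r' (adjoin r V)) = vec.dim V + 2"
    using rn rn' by (simp add: dim_adjoin V)
qed

lemma disc_char_zero: "disc_char {0} = 1"
  using diag_disc_char[OF diag.zero] by simp

lemma corank_zero: "corank {0} = 0"
  using diag_corank[OF diag.zero] .

text \<open>A vector r of P is completed to a hyperbolic plane by some r'; V0 is the orthogonal
  complement of the plane, and P0 consists of the vectors of P orthogonal to r'. This puts (V, P)
  into the shape to which \<open>step_hyperbolic\<close> applies.\<close>

lemma isotropic_split:
  assumes V: "vec.subspace V" "corank V = 0"
    and P: "vec.subspace P" "P \<subseteq> V" "\<forall>x\<in>P. \<forall>y\<in>P. f x y = 0" "vec.dim P = Suc i"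
  obtains r r' V0 P0 where "vec.subspace V0" "corank V0 = 0" "V = adjoin r' (adjoin r V0)"
    "r \<in> orth V0" "r' \<in> orth V0" "f r r = 0" "f r' r = 1"
    "vec.subspace P0" "P0 \<subseteq> V0" "\<forall>x\<in>P0. \<forall>y\<in>P0. f x y = 0" "vec.dim P0 = i" "P = adjoin r P0"
proof -
  have "\<not> P \<subseteq> {0}" using P(4) vec.dim_eq_0[of P] by simp
  then obtain r where r: "r \<in> P" "r \<noteq> 0" by blast
  obtain y where y: "y \<in> V" "f r y \<noteq> 0" using nondeg_witness[OF V, of r] r P by blast
  define r' where "r' = (1 / f r y) *s y"
  have r': "r' \<in> V" "f r r' = 1" "f r' r = 1"
    using y vec.subspace_scale[OF V(1)] f_sym[of y r] by (auto simp: r'_def f_simps)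
  have rr: "f r r = 0" using P r by blast
  have z: "vec.subspace {0 :: 'a ^ 'k}" by simp
  define W where "W = adjoin r' (adjoin r {0})"
  have o0: "r \<in> orth {0}" "r' \<in> orth {0}" by (auto simp: orth_def f_simps)
  note hyp0 = hyperbolic_adjoin[OF z corank_zero o0 rr r'(3), folded W_def]
  have W: "vec.subspace W" by (simp add: W_def)
  have WV: "W \<subseteq> V" unfolding W_def
    using r r'(1) P(2) V(1) vec.subspace_0[OF V(1)] by (intro adjoin_minimal) auto
  have orthW: "v \<in> orth W \<longleftrightarrow> f v r = 0 \<and> f v r' = 0" for v
    unfolding W_def orth_adjoin[OF subspace_adjoin] orth_adjoin[OF z] by (auto simp: orth_def f_simps)
  define V0 where "V0 = V \<inter> orth W"
  note dec = orth_decomp[OF V(1) W hyp0(1) WV, folded V0_def]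
  have rW: "r \<in> W" "r' \<in> W" unfolding W_def using adjoin_self adjoin_superset by blast+
  have oV0: "r \<in> orth V0" "r' \<in> orth V0"
    using rW by (auto simp: orth_def V0_def f_sym[of r] f_sym[of r'])
  have Veq: "V = adjoin r' (adjoin r V0)"
  proof
    have "V0 \<union> W \<subseteq> adjoin r' (adjoin r V0)"
      unfolding W_def using adjoin_mono[OF adjoin_mono[of "{0}" V0 r], of r'] vec.subspace_0[OF dec(1)]
        adjoin_superset[of V0 r] adjoin_superset[of "adjoin r V0" r'] by auto
    hence "vec.span (V0 \<union> W) \<subseteq> adjoin r' (adjoin r V0)" by (rule vec.span_minimal) simp
    thus "V \<subseteq> adjoin r' (adjoin r V0)" unfolding dec(2)[symmetric] .
    show "adjoin r' (adjoin r V0) \<subseteq> V" using r r' P V by (intro adjoin_minimal) (auto simp: V0_def)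
  qed
  define P0 where "P0 = P \<inter> orth {r'}"
  have P0: "vec.subspace P0" unfolding P0_def by (rule vec.subspace_inter[OF P(1) subspace_orth])
  have PV0: "P0 \<subseteq> V0"
  proof
    fix p assume p: "p \<in> P0"
    hence "p \<in> V" "f p r' = 0" "f p r = 0" using P(2,3) r(1) by (auto simp: P0_def orth_def)
    thus "p \<in> V0" by (simp add: V0_def orthW)
  qed
  have Peq: "P = adjoin r P0"
  proof
    show "adjoin r P0 \<subseteq> P" using r P by (intro adjoin_minimal) (auto simp: P0_def)
    show "P \<subseteq> adjoin r P0"
    proof
      fix p assume p: "p \<in> P"
      have "p - f p r' *s r \<in> P0"
        using vec.subspace_diff[OF P(1) p vec.subspace_scale[OF P(1) r(1)]] r'
        by (simp add: P0_def orth_def f_simps)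
      from adjoin_memI[OF P0 this, of "f p r'" r] show "p \<in> adjoin r P0" by simp
    qed
  qed
  have "r \<notin> P0" using r' by (auto simp: P0_def orth_def)
  hence "vec.dim P = Suc (vec.dim P0)" unfolding arg_cong[OF Peq, of vec.dim] by (rule dim_adjoin[OF P0])
  hence d: "vec.dim P0 = i" using P by simp
  have iso: "\<forall>x\<in>P0. \<forall>y\<in>P0. f x y = 0" using P(3) by (auto simp: P0_def)
  have cV0: "corank V0 = 0" using dec(4) V by simp
  show thesis by (rule that[OF dec(1) cV0 Veq oV0 rr r'(3) P0 PV0 iso d Peq])
qed

text \<open>The norm of r' + c r is affine in c with slope 2, so it takes every value.\<close>

lemma plane_value:
  assumes "r \<in> orth V" "r' \<in> orth V" "f r r = 0" "f r' r = 1"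
  shows "\<exists>e\<in>orth V. f e e = a"
proof -
  define c where "c = (a - f r' r') / 2"
  have c: "c + c = a - f r' r'" using two by (simp add: c_def mult_2[symmetric])
  have "f (r' + c *s r) (r' + c *s r) = f r' r' + (c + c)"
    using assms f_sym[of r r'] by (simp add: f_simps)
  hence "f (r' + c *s r) (r' + c *s r) = a" using c by simp
  moreover have "r' + c *s r \<in> orth V"
    using assms by (intro vec.subspace_add vec.subspace_scale subspace_orth)
  ultimately show ?thesis by blast
qed

lemma square_classes:
  assumes "\<And>a. \<exists>e\<in>orth V. f e e = a"
  obtains e e' where "e \<in> orth V" "f e e \<noteq> 0" "quad_char (f e e) = 1"
    "e' \<in> orth V" "f e' e' \<noteq> 0" "quad_char (f e' e') = -1"
proof -
  obtain b :: 'a where b: "quad_char b = -1" using exists_nonsquare[OF two] by blast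
  obtain e where e: "e \<in> orth V" "f e e = 1" using assms by blast
  obtain e' where e': "e' \<in> orth V" "f e' e' = b" using assms by blast
  show thesis by (rule that[of e e']) (use e e' b in auto)
qed

text \<open>Evaluating the signed count of V extended by an anisotropic vector in two ways, by
  \<open>step_even\<close> and by \<open>step_isotropic\<close>, gives one equation for each square
  class of its norm. Their difference eliminates \<open>signed_border_count\<close> and expresses
  \<open>signed_count\<close> by \<open>nonsing_count\<close>; the unsigned equation then yields
  \<open>border_count\<close>.\<close>

lemma isotropic_even:
  assumes V: "vec.subspace V" "corank V = 0"
    and P: "vec.subspace P" "P \<subseteq> V" "\<forall>x\<in>P. \<forall>y\<in>P. f x y = 0" "vec.dim P = 2 * k"
    and ex: "\<And>a. \<exists>e\<in>orth V. f e e = a"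
  shows "q ^ k * signed_count V P = sig ^ k * disc_char V * nonsing_count V P"
    and "q ^ (2 * k) * (q - 1) * border_count V P = (q ^ (2 * k + 1) - 1) * nonsing_count V P"
proof -
  obtain e e' where e: "e \<in> orth V" "f e e \<noteq> 0" "quad_char (f e e) = 1"
    and e': "e' \<in> orth V" "f e' e' \<noteq> 0" "quad_char (f e' e') = -1"
    using square_classes[OF ex] by metis
  have cP: "real (card P) = q ^ (2 * k)" using P by (simp add: real_card_subspace)
  define s where "s = sig ^ k * disc_char V"
  have s: "s * s = 1"
  proof -
    have "s * s = (sig * sig) ^ k * (disc_char V * disc_char V)" by (simp add: s_def power_mult_distrib)
    thus ?thesis using sig_sq disc_char_sq[OF V(1)] by simp
  qed
  have "q * (q ^ (2 * k) * signed_count V P) = q ^ (2 * k) * (q - 1) * signed_border_count V P + q ^ (k + 1) * s * nonsing_count V P"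
    using step_even(2)[OF V P(1,2) e(1,2) P(4)] step_isotropic(2)[OF V(1) P(1-3) e(1,2)]
    by (simp add: cP e s_def mult.assoc)
  moreover have "- (q * (q ^ (2 * k) * signed_count V P)) = q ^ (2 * k) * (q - 1) * signed_border_count V P - q ^ (k + 1) * s * nonsing_count V P"
    using step_even(2)[OF V P(1,2) e'(1,2) P(4)] step_isotropic(2)[OF V(1) P(1-3) e'(1,2)]
    by (simp add: cP e' s_def mult.assoc)
  ultimately have x: "q * (q ^ (2 * k) * signed_count V P) = q ^ (k + 1) * s * nonsing_count V P" by linarith
  have "q ^ (k + 1) * (q ^ k * signed_count V P) = q * (q ^ (2 * k) * signed_count V P)"
    by (simp add: mult_2 power_add)
  hence "q ^ (k + 1) * (q ^ k * signed_count V P) = q ^ (k + 1) * (s * nonsing_count V P)" by (simp only: x mult.assoc)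
  hence x1: "q ^ k * signed_count V P = s * nonsing_count V P" using q_pos by simp
  thus "q ^ k * signed_count V P = sig ^ k * disc_char V * nonsing_count V P" by (simp add: s_def)
  have "q * (q ^ (2 * k) * nonsing_count V P) = q ^ (2 * k) * (q - 1) * border_count V P + s * (q ^ k * signed_count V P)"
    using step_even(1)[OF V P(1,2) e(1,2) P(4)] step_isotropic(1)[OF V(1) P(1-3) e(1,2)]
    by (simp add: cP s_def ac_simps)
  hence "q ^ (2 * k) * (q - 1) * border_count V P = q * (q ^ (2 * k) * nonsing_count V P) - (s * s) * nonsing_count V P"
    by (simp add: x1)
  thus "q ^ (2 * k) * (q - 1) * border_count V P = (q ^ (2 * k + 1) - 1) * nonsing_count V P"
    by (simp add: s algebra_simps)
qed

text \<open>The discriminant term x enters the equations for the two square classes with opposite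
  signs, so adding them removes it.\<close>

lemma isotropic_odd:
  assumes V: "vec.subspace V" "corank V = 0"
    and P: "vec.subspace P" "P \<subseteq> V" "\<forall>x\<in>P. \<forall>y\<in>P. f x y = 0" "vec.dim P = 2 * k + 1"
    and ex: "\<And>a. \<exists>e\<in>orth V. f e e = a"
  shows "(q - 1) * border_count V P = q * nonsing_count V P"
proof -
  obtain e e' where e: "e \<in> orth V" "f e e \<noteq> 0" "quad_char (f e e) = 1"
    and e': "e' \<in> orth V" "f e' e' \<noteq> 0" "quad_char (f e' e') = -1"
    using square_classes[OF ex] by metis
  have cP: "real (card P) = q ^ (2 * k + 1)" using P by (simp add: real_card_subspace)
  define x where "x = q ^ (k + 1) * sig ^ (k + 1) * disc_char V * signed_count V P"
  have "q * (q ^ (2 * k + 1) * nonsing_count V P) = q ^ (2 * k + 1) * (q - 1) * border_count V P - x"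
    using step_odd[OF V P(1,2) e(1,2) P(4)] step_isotropic(1)[OF V(1) P(1-3) e(1,2)]
    by (simp add: cP e x_def mult.assoc)
  moreover have "q * (q ^ (2 * k + 1) * nonsing_count V P) = q ^ (2 * k + 1) * (q - 1) * border_count V P + x"
    using step_odd[OF V P(1,2) e'(1,2) P(4)] step_isotropic(1)[OF V(1) P(1-3) e'(1,2)]
    by (simp add: cP e' x_def mult.assoc)
  ultimately have "q ^ (2 * k + 1) * ((q - 1) * border_count V P) = q ^ (2 * k + 1) * (q * nonsing_count V P)"
    by (simp add: algebra_simps)
  thus ?thesis using q_pos by simp
qed

text \<open>The power of q is the number of all complements. Splitting off a hyperbolic plane turns
  \<open>nonsing_count\<close> into a \<open>border_count\<close> for P0, which
  \<open>isotropic_even\<close> and \<open>isotropic_odd\<close> turn back into a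
  \<open>nonsing_count\<close>. Only the passage from an even i to i + 1 contributes a new factor,
  hence the bound (i + 1) div 2 in \<open>nonsing_prob\<close>.\<close>

theorem isotropic_count:
  assumes "vec.subspace V" "corank V = 0"
    and "vec.subspace P" "P \<subseteq> V" "\<forall>x\<in>P. \<forall>y\<in>P. f x y = 0" "vec.dim P = i"
  shows "nonsing_count V P = q ^ (i * (vec.dim V - i)) * nonsing_prob q i"
  using assms
proof (induction i arbitrary: V P)
  case 0
  hence P: "P = {0}" using vec.dim_eq_0[of P] vec.subspace_0 by blast
  have "complements V {0} = {V}"
  proof (intro subset_antisym subsetI)
    fix S assume S: "S \<in> complements V {0}"
    have "v \<in> S" if "v \<in> V" for v using complementsD(4)[OF S that] by auto
    thus "S \<in> {V}" using complementsD(2)[OF S] by blast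
  next
    fix S assume "S \<in> {V}"
    thus "S \<in> complements V {0}" using 0 vec.subspace_0[of V] by (auto simp: complements_def)
  qed
  thus ?case using 0 P by (simp add: nonsing_count_def nonsing_ind_def nonsing_prob_def)
next
  case (Suc i)
  obtain r r' V0 P0 where V0: "vec.subspace V0" "corank V0 = 0" and V: "V = adjoin r' (adjoin r V0)"
    and r: "r \<in> orth V0" "r' \<in> orth V0" "f r r = 0" "f r' r = 1"
    and P0: "vec.subspace P0" "P0 \<subseteq> V0" "\<forall>x\<in>P0. \<forall>y\<in>P0. f x y = 0" "vec.dim P0 = i"
    and P: "P = adjoin r P0"
    using isotropic_split[OF Suc.prems] .
  have ex: "\<exists>e\<in>orth V0. f e e = a" for a by (rule plane_value[OF r])
  define n where "n = vec.dim V0 - i"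
  have n: "vec.dim V0 = n + i" using vec.dim_subset[OF P0(2)] P0(4) by (simp add: n_def)
  have dV: "vec.dim V - Suc i = n + 1" using hyperbolic_adjoin(3)[OF V0 r] V n by simp
  have X: "nonsing_count V P = q ^ (n + i) * ((q - 1) * border_count V0 P0)"
    using step_hyperbolic(1)[OF V0 P0(1,2) r] by (simp add: V P n mult.assoc)
  have IH: "nonsing_count V0 P0 = q ^ (i * n) * nonsing_prob q i"
    using Suc.IH[OF V0 P0] by (simp add: n)
  show ?case
  proof (cases "even i")
    case True
    then obtain k where k: "i = 2 * k" by blast
    have "q ^ i * nonsing_count V P = q ^ (n + i) * (q ^ i * (q - 1) * border_count V0 P0)" by (simp add: X algebra_simps)
    also have "\<dots> = q ^ (n + i) * ((q ^ (i + 1) - 1) * nonsing_count V0 P0)"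
      using isotropic_even(2)[OF V0 P0(1-3) _ ex, of k] P0 k by simp
    finally have "q ^ i * nonsing_count V P = q ^ i * (q ^ n * ((q ^ (i + 1) - 1) * nonsing_count V0 P0))"
      by (simp add: power_add algebra_simps)
    hence 1: "nonsing_count V P = q ^ n * ((q ^ (i + 1) - 1) * (q ^ (i * n) * nonsing_prob q i))"
      using q_pos by (simp add: IH)
    have "(Suc i + 1) div 2 = Suc k" "(i + 1) div 2 = k" using k by auto
    hence p: "nonsing_prob q (Suc i) = nonsing_prob q i * (1 - 1 / q ^ (i + 1))"
      unfolding nonsing_prob_def by (simp add: k)
    have c: "q ^ (i + 1) * (1 - 1 / q ^ (i + 1)) = q ^ (i + 1) - 1"
      using q_pos by (simp add: right_diff_distrib)
    have "q ^ (Suc i * (n + 1)) = q ^ n * q ^ (i * n) * q ^ (i + 1)"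
      by (simp add: power_add[symmetric] algebra_simps)
    hence "q ^ (Suc i * (n + 1)) * nonsing_prob q (Suc i) =
        q ^ n * q ^ (i * n) * nonsing_prob q i * (q ^ (i + 1) * (1 - 1 / q ^ (i + 1)))"
      by (simp only: p ac_simps)
    hence "q ^ (Suc i * (n + 1)) * nonsing_prob q (Suc i) =
        q ^ n * q ^ (i * n) * nonsing_prob q i * (q ^ (i + 1) - 1)" by (simp only: c)
    thus ?thesis using 1 by (simp only: dV ac_simps)
  next
    case False
    then obtain k where k: "i = 2 * k + 1" by (elim oddE)
    have "nonsing_count V P = q ^ (n + i) * (q * nonsing_count V0 P0)"
      using isotropic_odd[OF V0 P0(1-3) _ ex, of k] P0 k by (simp only: X)
    hence "nonsing_count V P = q ^ (Suc i * (n + 1)) * nonsing_prob q i"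
      by (simp add: IH power_add algebra_simps)
    moreover have "(Suc i + 1) div 2 = (i + 1) div 2" using k by simp
    ultimately show ?thesis unfolding nonsing_prob_def dV by simp
  qed
qed

text \<open>V is an orthogonal sum of i hyperbolic planes, each of discriminant -1 up to
  squares.\<close>

lemma disc_char_split:
  assumes "vec.subspace V" "corank V = 0" and "vec.subspace P" "P \<subseteq> V" "\<forall>x\<in>P. \<forall>y\<in>P. f x y = 0"
    and "vec.dim P = i" "vec.dim V = 2 * i"
  shows "disc_char V = sig ^ i"
  using assms
proof (induction i arbitrary: V P)
  case 0
  hence "V = {0}" using vec.dim_eq_0[of V] vec.subspace_0[of V] by auto
  thus ?case by (simp add: disc_char_zero)
next
  case (Suc i)
  obtain r r' V0 P0 where V0: "vec.subspace V0" "corank V0 = 0" and V: "V = adjoin r' (adjoin r V0)"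
    and r: "r \<in> orth V0" "r' \<in> orth V0" "f r r = 0" "f r' r = 1"
    and P0: "vec.subspace P0" "P0 \<subseteq> V0" "\<forall>x\<in>P0. \<forall>y\<in>P0. f x y = 0" "vec.dim P0 = i"
    and P: "P = adjoin r P0"
    using isotropic_split[OF Suc.prems(1-6)] .
  have "vec.dim V0 = 2 * i" using hyperbolic_adjoin(3)[OF V0 r] V Suc.prems(7) by simp
  from Suc.IH[OF V0 P0 this] show ?case using hyperbolic_adjoin(2)[OF V0 r] V by simp
qed

text \<open>V is the orthogonal sum of a complement W of rad P in P and a space M of dimension
  \<open>2 * corank P\<close>. As M contains rad P as a totally isotropic subspace of half its
  dimension, its discriminant is given by \<open>disc_char_split\<close>.\<close>

lemma disc_char_extremal:
  assumes V: "vec.subspace V" "corank V = 0" and P: "vec.subspace P" "P \<subseteq> V"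
    and d: "vec.dim V = vec.dim P + corank P"
  shows "disc_char V = sig ^ corank P * disc_char P"
proof -
  obtain as m where a: "diag P as m" using diag_exists P by blast
  obtain W where W: "W \<subseteq> P" "diag W as 0" using nondegenerate_part[OF a] by blast
  have W1: "vec.subspace W" "corank W = 0" "disc_char W = disc_char P"
    using W a by (simp_all add: diag_subspace diag_corank diag_disc_char)
  define M where "M = V \<inter> orth W"
  have WV: "W \<subseteq> V" using W P by blast
  note dec = orth_decomp[OF V(1) W1(1,2) WV, folded M_def]
  have m: "corank P = m" "vec.dim P = length as + m" "vec.dim W = length as"
    using a W by (simp_all add: diag_corank diag_dim)
  have "rad P \<subseteq> M" using W P by (auto simp: M_def rad_def orth_def)
  moreover have "\<forall>x\<in>rad P. \<forall>y\<in>rad P. f x y = 0" by (auto simp: rad_def)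
  ultimately have "disc_char M = sig ^ m"
    using dec V m d by (intro disc_char_split[OF dec(1) _ subspace_rad[OF P(1)]]) (auto simp: corank_def)
  thus ?thesis using dec(5) W1 m by (simp add: mult.commute)
qed

text \<open>If all vectors orthogonal to P were isotropic, \<open>V \<inter> orth P\<close> would be
  contained in its own orthogonal complement, which is P, hence in rad P. Its dimension, dim V - dim
  P, would then be at most the corank of P.\<close>

lemma anisotropic_split:
  assumes V: "vec.subspace V" "corank V = 0" and P: "vec.subspace P" "P \<subseteq> V"
    and d: "vec.dim V > vec.dim P + corank P"
  obtains e V' where "V = adjoin e V'" "vec.subspace V'" "corank V' = 0" "P \<subseteq> V'" "e \<in> orth V'" "f e e \<noteq> 0"
    "vec.dim V = Suc (vec.dim V')"
proof -
  define A where "A = V \<inter> orth P"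
  have A: "vec.subspace A" unfolding A_def by (rule vec.subspace_inter[OF V(1) subspace_orth])
  have "\<exists>e\<in>A. f e e \<noteq> 0"
  proof (rule ccontr)
    assume "\<not> (\<exists>e\<in>A. f e e \<noteq> 0)"
    hence "\<forall>x\<in>A. f x x = 0" by blast
    hence "f x y = 0" if "x \<in> A" "y \<in> A" for x y by (rule isotropic_f_zero[OF A _ that])
    moreover have "A \<subseteq> V" by (simp add: A_def)
    ultimately have "A \<subseteq> V \<inter> orth A" unfolding orth_def by blast
    also have "\<dots> = P" unfolding A_def by (rule double_orth[OF V P])
    finally have "A \<subseteq> rad P" unfolding rad_eq by (auto simp: A_def)
    hence "vec.dim A \<le> corank P" unfolding corank_def by (rule vec.dim_subset)
    moreover have "vec.dim A + vec.dim P = vec.dim V" unfolding A_def by (rule dim_orth[OF V P])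
    ultimately show False using d by simp
  qed
  then obtain e where e: "e \<in> V" "e \<in> orth P" "f e e \<noteq> 0" unfolding A_def by blast
  define V' where "V' = V \<inter> orth {e}"
  have V': "vec.subspace V'" unfolding V'_def by (rule vec.subspace_inter[OF V(1) subspace_orth])
  have eq: "V = adjoin e V'" unfolding V'_def by (rule orth_split[OF V(1) e(1,3)])
  have o: "\<forall>y\<in>V'. f e y = 0"
  proof
    fix y assume "y \<in> V'"
    hence "f y e = 0" by (simp add: V'_def orth_def)
    thus "f e y = 0" by (simp only: f_sym[of e y])
  qed
  have eo: "e \<in> orth V'" using o by (auto simp: orth_def)
  have PV': "P \<subseteq> V'"
  proof
    fix p assume p: "p \<in> P"
    hence "f e p = 0" using e(2) by (simp add: orth_def)
    hence "f p e = 0" by (simp only: f_sym[of p e])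
    thus "p \<in> V'" using p P(2) by (auto simp: V'_def orth_def)
  qed
  have c: "corank V' = 0" using disc_char_adjoin_nonsing(2)[OF V' o e(3), folded eq] V(2) by (rule trans[OF sym])
  have "e \<notin> V'" using e by (auto simp: V'_def orth_def)
  from dim_adjoin[OF V' this, folded eq] have "vec.dim V = Suc (vec.dim V')" .
  from that[OF eq V' c PV' eo e(3) this] show thesis .
qed

text \<open>The contributions of \<open>signed_count\<close> and \<open>signed_border_count\<close> cancel, so
  \<open>nonsing_count\<close> alone satisfies a recursion.\<close>

lemma two_step:
  assumes V: "vec.subspace V" "corank V = 0" and P: "vec.subspace P" "P \<subseteq> V" "vec.dim P = 2 * k"
    and e': "e' \<in> orth V" "f e' e' \<noteq> 0" and e: "e \<in> orth (adjoin e' V)" "f e e \<noteq> 0"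
    and r: "r \<in> orth (adjoin e' V)" "r' \<in> orth (adjoin e' V)" "f r r = 0" "f r' r = 1"
    and s: "s \<in> orth (adjoin r' (adjoin r V))" "s' \<in> orth (adjoin r' (adjoin r V))" "f s s = 0" "f s' s = 1"
  defines "n \<equiv> vec.dim V"
  shows "q ^ (2 * n + 4) * nonsing_count (adjoin e (adjoin e' V)) P =
    q ^ (4 * k) * nonsing_count (adjoin s' (adjoin s (adjoin r' (adjoin r V)))) (adjoin s (adjoin r P)) + q ^ (2 * n + 2 * k + 3) * nonsing_count V P"
proof -
  define V1 where "V1 = adjoin e' V"
  define VH where "VH = adjoin r' (adjoin r V)"
  define \<eta> where "\<eta> = quad_char (f e' e')"
  have eV: "\<forall>y\<in>V. f e' y = 0" using e' by (auto simp: orth_def)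
  have V1: "vec.subspace V1" "corank V1 = 0" "disc_char V1 = \<eta> * disc_char V"
    using disc_char_adjoin_nonsing[OF V(1) eV e'(2)] V by (simp_all add: V1_def \<eta>_def)
  have d1: "vec.dim V1 = n + 1"
    unfolding V1_def n_def using dim_adjoin[OF V(1) orth_vector_notin[OF e']] by simp
  have PV1: "P \<subseteq> V1" using P adjoin_superset[of V e'] by (auto simp: V1_def)
  have anti: "orth V1 \<subseteq> orth V" using adjoin_superset[of V e'] by (auto simp: V1_def orth_def)
  have rV: "r \<in> orth V" "r' \<in> orth V" using r anti by (auto simp: V1_def)
  note hyp = hyperbolic_adjoin[OF V rV r(3,4), folded VH_def]
  have VH: "vec.subspace VH" by (simp add: VH_def)
  have P1: "vec.subspace (adjoin r P)" "adjoin r P \<subseteq> VH"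
    using adjoin_mono[OF P(2), of r] adjoin_superset[of "adjoin r V" r'] by (auto simp: VH_def)
  have dP1: "vec.dim (adjoin r P) = 2 * k + 1"
    using dim_adjoin[OF P(1), of r] hyp(4) P by auto
  have e'H: "e' \<in> orth VH"
  proof -
    have "f e' r = 0" "f e' r' = 0"
      using r adjoin_self[of e' V] f_sym[of e' r] f_sym[of e' r'] by (auto simp: orth_def)
    thus ?thesis unfolding VH_def orth_adjoin[OF subspace_adjoin] orth_adjoin[OF V(1)] using e' by auto
  qed
  \<comment> \<open>The same space arises from V1 by adding a hyperbolic plane and from
    \<open>VH\<close> by adding the anisotropic e'. Its count \<open>XP\<close> is therefore
    available from both \<open>step_hyperbolic\<close> and \<open>step_odd\<close>, which links the
    border counts c and d.\<close>
  have comm: "adjoin r' (adjoin r V1) = adjoin e' VH"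
    unfolding V1_def VH_def by (simp only: adjoin_commute[of r e'] adjoin_commute[of r' e'])
  define c where "c = (q - 1) * border_count V1 P"
  define d where "d = (q - 1) * border_count VH (adjoin r P)"
  define g where "g = (q - 1) * signed_border_count V P"
  \<comment> \<open>The sign attached to all discriminant terms below. It squares to 1, so that
    \<open>nonsing_count V P\<close> appears with a positive coefficient.\<close>
  define \<tau> where "\<tau> = sig ^ k * \<eta> * disc_char V"
  define XP where "XP = nonsing_count (adjoin e' VH) (adjoin r P)"
  have \<tau>: "\<tau> * \<tau> = 1"
  proof -
    have "\<tau> * \<tau> = (sig * sig) ^ k * (\<eta> * \<eta>) * (disc_char V * disc_char V)" by (simp add: \<tau>_def power_mult_distrib)
    thus ?thesis using sig_sq disc_char_sq[OF V(1)] quad_char_mult_self[OF e'(2)] by (simp add: \<eta>_def)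
  qed
  have a: "q * nonsing_count (adjoin e V1) P = q ^ (2 * k) * c + q ^ k * \<tau> * signed_count V1 P"
    using step_even(1)[OF V1(1,2) P(1) PV1 _ e(2) P(3)] e V1 by (simp add: V1_def[symmetric] c_def \<tau>_def ac_simps)
  have b: "XP = q ^ (n + 1) * c"
    using step_hyperbolic(1)[OF V1(1,2) P(1) PV1 _ _ r(3,4)] r d1 unfolding comm
    by (simp add: V1_def[symmetric] XP_def c_def mult.assoc)
  have signed_border_ind: "q * XP = q ^ (2 * k + 1) * d - q ^ (k + 1) * \<tau> * signed_count VH (adjoin r P)"
  proof -
    have "sig ^ (k + 1) * \<eta> * disc_char VH = (sig * sig) * \<tau>" by (simp add: hyp(2) \<tau>_def)
    hence "sig ^ (k + 1) * \<eta> * disc_char VH = \<tau>" by (simp only: sig_sq mult_1_left)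
    moreover have "q * XP = q ^ (2 * k + 1) * d - q ^ (k + 1) * (sig ^ (k + 1) * \<eta> * disc_char VH) * signed_count VH (adjoin r P)"
      using step_odd[OF VH hyp(1) P1 e'H e'(2) dP1] by (simp only: XP_def d_def \<eta>_def ac_simps)
    ultimately show ?thesis by (simp only:)
  qed
  have d1': "nonsing_count (adjoin s' (adjoin s VH)) (adjoin s (adjoin r P)) = q ^ (n + 2) * d"
    using step_hyperbolic(1)[OF VH hyp(1) P1 s[folded VH_def]] hyp(3) by (simp add: d_def n_def mult.assoc)
  have e1: "signed_count VH (adjoin r P) = q ^ n * g"
    using step_hyperbolic(2)[OF V P(1,2) rV r(3,4)] by (simp add: VH_def[symmetric] g_def n_def mult.assoc)
  have f1: "q * signed_count V1 P = q ^ (2 * k) * g + q ^ (k + 1) * \<tau> * nonsing_count V P"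
    using step_even(2)[OF V P(1,2) e' P(3)] by (simp add: V1_def[symmetric] g_def \<tau>_def \<eta>_def[symmetric] ac_simps)
  \<comment> \<open>The two values of \<open>XP\<close> are equated, which expresses c by d and
    g.\<close>
  have "q * (q ^ (n + 1) * c) = q ^ (2 * k + 1) * d - q ^ (k + 1) * \<tau> * (q ^ n * g)"
    using signed_border_ind b e1 by simp
  hence cc: "q ^ (n + 2) * c = q ^ (2 * k + 1) * d - q ^ (n + k + 1) * (\<tau> * g)"
    by (simp add: power_add algebra_simps)
  have "q * (q * nonsing_count (adjoin e V1) P) = q ^ (2 * k + 1) * c + q ^ k * \<tau> * (q * signed_count V1 P)"
    unfolding a by (simp add: algebra_simps)
  also have "\<dots> = q ^ (2 * k + 1) * c + q ^ (3 * k) * (\<tau> * g) + q ^ (2 * k + 1) * ((\<tau> * \<tau>) * nonsing_count V P)"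
  proof -
    have p: "q ^ (3 * k) = q ^ k * q ^ (2 * k)" "q ^ (2 * k + 1) = q ^ k * q ^ (k + 1)"
      by (simp only: power_add[symmetric], rule arg_cong[of _ _ "power q"], simp)+
    show ?thesis unfolding f1 p by (simp only: distrib_left ac_simps)
  qed
  finally have 1: "q ^ 2 * nonsing_count (adjoin e V1) P = q ^ (2 * k + 1) * c + q ^ (3 * k) * (\<tau> * g) + q ^ (2 * k + 1) * nonsing_count V P"
    by (simp add: \<tau> power2_eq_square mult.assoc)
  have pw: "q ^ (2 * n + 4) = q ^ (2 * n + 2) * q ^ 2" "q ^ (2 * n + 2) * q ^ (2 * k + 1) = q ^ (2 * k) * q ^ (n + 1) * q ^ (n + 2)"
    "q ^ (2 * k) * q ^ (n + 1) * q ^ (n + k + 1) = q ^ (2 * n + 2) * q ^ (3 * k)"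
    "q ^ (2 * k) * q ^ (n + 1) * q ^ (2 * k + 1) = q ^ (4 * k) * q ^ (n + 2)"
    "q ^ (2 * n + 2) * q ^ (2 * k + 1) = q ^ (2 * n + 2 * k + 3)"
    by (simp only: power_add[symmetric], rule arg_cong[of _ _ "power q"], simp)+
  \<comment> \<open>After multiplication by q^(2n+2) the border count c can be replaced by means of
    \<open>cc\<close>, and the two terms with \<tau> * g cancel.\<close>
  have "q ^ (2 * n + 4) * nonsing_count (adjoin e V1) P =
      q ^ (2 * n + 2) * (q ^ (2 * k + 1) * c + q ^ (3 * k) * (\<tau> * g) + q ^ (2 * k + 1) * nonsing_count V P)"
    unfolding pw(1) 1[symmetric] by simp
  also have "\<dots> = (q ^ (2 * n + 2) * q ^ (2 * k + 1)) * c + (q ^ (2 * n + 2) * q ^ (3 * k)) * (\<tau> * g)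
      + q ^ (2 * n + 2 * k + 3) * nonsing_count V P"
    unfolding pw(5)[symmetric] by (simp only: distrib_left mult.assoc)
  also have "(q ^ (2 * n + 2) * q ^ (2 * k + 1)) * c =
      q ^ (2 * k) * q ^ (n + 1) * (q ^ (2 * k + 1) * d - q ^ (n + k + 1) * (\<tau> * g))"
    unfolding pw(2) cc[symmetric] by (simp only: mult.assoc)
  also have "\<dots> = (q ^ (2 * k) * q ^ (n + 1) * q ^ (2 * k + 1)) * d
      - (q ^ (2 * k) * q ^ (n + 1) * q ^ (n + k + 1)) * (\<tau> * g)"
    by (simp only: right_diff_distrib mult.assoc)
  also have "\<dots> = q ^ (4 * k) * (q ^ (n + 2) * d) - (q ^ (2 * n + 2) * q ^ (3 * k)) * (\<tau> * g)"
    unfolding pw(3,4) by (simp only: mult.assoc)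
  finally show ?thesis unfolding d1' V1_def[symmetric] VH_def[symmetric] by simp
qed

end

section \<open>Solution of the recursion\<close>

text \<open>The Gaussian binomial coefficient, given by Pascal's rule because that is the shape of
  the recursion for the counts.\<close>

fun q_binomial :: "real \<Rightarrow> nat \<Rightarrow> nat \<Rightarrow> real" where
  "q_binomial Q 0 m = (if m = 0 then 1 else 0)"
| "q_binomial Q (Suc a) m = q_binomial Q a m + (if m = 0 then 0 else Q ^ (Suc a - m) * q_binomial Q a (m - 1))"

lemma q_binomial_eq_0: "a < m \<Longrightarrow> q_binomial Q a m = 0"
  by (induction a arbitrary: m) auto

lemma q_binomial_0_right: "q_binomial Q a 0 = 1"
  by (induction a) auto

text \<open>\<open>F n\<close> is the Q-factorial without its normalising power of Q - 1. With the
  denominators cleared, the induction needs no case where they vanish.\<close>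

lemma q_binomial_product:
  fixes Q :: real
  defines "F \<equiv> \<lambda>n. \<Prod>k<n. Q ^ Suc k - 1"
  shows "m \<le> a \<Longrightarrow> q_binomial Q a m * (F (a - m) * F m) = F a"
proof (induction a arbitrary: m)
  case 0
  thus ?case by (simp add: F_def)
next
  case (Suc a)
  have F: "F (Suc n) = F n * (Q ^ Suc n - 1)" for n by (simp add: F_def)
  show ?case
  proof (cases m)
    case 0
    thus ?thesis by (simp add: q_binomial_0_right[of Q "Suc a"] F_def del: q_binomial.simps)
  next
    case (Suc l)
    show ?thesis
    proof (cases "m \<le> a")
      case True
      then obtain b where b: "a = m + b" using le_Suc_ex by blast
      have 1: "q_binomial Q a m * (F b * F m) = F a" using Suc.IH[OF True] b by simp
      have 2: "q_binomial Q a l * (F (Suc b) * F l) = F a" using Suc.IH[of l] b \<open>m = Suc l\<close> by simp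
      have "q_binomial Q (Suc a) m * (F (Suc a - m) * F m) =
          (q_binomial Q a m + Q ^ Suc b * q_binomial Q a l) * (F (Suc b) * F m)"
        using b \<open>m = Suc l\<close> by simp
      also have "\<dots> = (q_binomial Q a m * (F b * F m)) * (Q ^ Suc b - 1)
          + Q ^ Suc b * (q_binomial Q a l * (F (Suc b) * F l)) * (Q ^ m - 1)"
        unfolding \<open>m = Suc l\<close> F[of l] F[of b] by (simp only: ring_distribs ac_simps)
      also have "\<dots> = F a * (Q ^ Suc b * Q ^ m - 1)" unfolding 1 2 by (simp add: algebra_simps)
      also have "Q ^ Suc b * Q ^ m = Q ^ Suc a" by (simp add: b power_add)
      finally show ?thesis by (simp add: F)
    next
      case False
      hence m: "m = Suc a" using Suc.prems by simp
      have "q_binomial Q a a * (F 0 * F a) = F a" using Suc.IH[of a] by simp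
      moreover have "F 0 = 1" by (simp add: F_def)
      ultimately have "(q_binomial Q a a * F a) * (Q ^ Suc a - 1) = F a * (Q ^ Suc a - 1)" by simp
      thus ?thesis using m \<open>F 0 = 1\<close> by (simp add: q_binomial_eq_0 F mult.assoc)
    qed
  qed
qed

text \<open>All three sums of the theorem have this form, with t equal to i - j or i - j + 1. The
  subtraction in \<open>B - m\<close> is truncated, so agreement with the sums of the theorem
  requires a \<le> B.\<close>

definition chi_sum :: "real \<Rightarrow> nat \<Rightarrow> nat \<Rightarrow> int \<Rightarrow> real" where
  "chi_sum q B a t = (\<Sum>m\<le>a. odd_prod q (B - m) * q_binomial (q ^ 2) a m * q powi (int m * (int m + t)))"

text \<open>Pascal's rule splits the sum in two; in the second part the index m is shifted by
  one.\<close>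

lemma chi_sum_Suc:
  assumes q: "q > 0"
  shows "chi_sum q B (Suc a) t = chi_sum q B a t + q powi (2 * int a + 1 + t) * chi_sum q (B - 1) a t"
proof -
  have "chi_sum q B (Suc a) t =
      (\<Sum>m\<le>Suc a. odd_prod q (B - m) * q_binomial (q ^ 2) a m * q powi (int m * (int m + t))) +
      (\<Sum>m\<le>Suc a. odd_prod q (B - m) * (if m = 0 then 0 else (q ^ 2) ^ (Suc a - m) * q_binomial (q ^ 2) a (m - 1))
         * q powi (int m * (int m + t)))"
    unfolding chi_sum_def by (simp only: q_binomial.simps ring_distribs sum.distrib)
  also have "(\<Sum>m\<le>Suc a. odd_prod q (B - m) * q_binomial (q ^ 2) a m * q powi (int m * (int m + t))) = chi_sum q B a t"
    by (simp add: chi_sum_def q_binomial_eq_0)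
  also have "(\<Sum>m\<le>Suc a. odd_prod q (B - m) * (if m = 0 then 0 else (q ^ 2) ^ (Suc a - m) * q_binomial (q ^ 2) a (m - 1))
         * q powi (int m * (int m + t))) =
      (\<Sum>m\<le>a. odd_prod q (B - 1 - m) * ((q ^ 2) ^ (a - m) * q_binomial (q ^ 2) a m) * q powi (int (Suc m) * (int (Suc m) + t)))"
    unfolding sum.atMost_Suc_shift by simp
  also have "\<dots> = (\<Sum>m\<le>a. q powi (2 * int a + 1 + t) * (odd_prod q (B - 1 - m) * q_binomial (q ^ 2) a m * q powi (int m * (int m + t))))"
  proof (rule sum.cong[OF refl])
    fix m assume "m \<in> {..a}"
    hence "(q ^ 2) ^ (a - m) = q powi (2 * (int a - int m))"
      by (simp add: power_mult[symmetric] of_nat_diff[symmetric] power_int_def nat_mult_distrib del: of_nat_diff)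
    hence "(q ^ 2) ^ (a - m) * q powi (int (Suc m) * (int (Suc m) + t)) =
        q powi (2 * (int a - int m) + int (Suc m) * (int (Suc m) + t))"
      using q by (subst power_int_add) simp_all
    \<comment> \<open>The terms linear in m that stem from Pascal's rule and from the index shift
      cancel, so that a factor independent of m can be taken out of the sum.\<close>
    also have "2 * (int a - int m) + int (Suc m) * (int (Suc m) + t) =
        (2 * int a + 1 + t) + int m * (int m + t)" by (simp add: algebra_simps)
    also have "q powi \<dots> = q powi (2 * int a + 1 + t) * q powi (int m * (int m + t))"
      using q by (subst power_int_add) auto
    finally show "odd_prod q (B - 1 - m) * ((q ^ 2) ^ (a - m) * q_binomial (q ^ 2) a m) * q powi (int (Suc m) * (int (Suc m) + t)) =
        q powi (2 * int a + 1 + t) * (odd_prod q (B - 1 - m) * q_binomial (q ^ 2) a m * q powi (int m * (int m + t)))"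
      by (simp only: ac_simps)
  qed
  finally show ?thesis by (simp add: chi_sum_def sum_distrib_left)
qed

text \<open>Here j is the dimension of P, and N that of its complements in the smallest of the three
  spaces. Dividing by the number of all complements, such as q^(j N), and multiplying by q^(B^2)
  transforms the recursion of \<open>two_step\<close> into that of
  \<open>chi_sum_Suc\<close>.\<close>

lemma recursion_arith:
  fixes q X X2 X3 Z2 Z3 :: real
  assumes q: "q > 0" and B: "2 * B = N + 1"
    and rec: "q ^ (2 * (j + N) + 4) * X = q ^ (2 * j) * X3 + q ^ (2 * (j + N) + j + 3) * X2"
    and X3: "X3 * q ^ ((B + 1) ^ 2) = q ^ ((j + 2) * (N + 2)) * Z3"
    and X2: "X2 * q ^ (B ^ 2) = q ^ (j * N) * Z2"
  shows "X * q ^ ((B + 1) ^ 2) = q ^ (j * (N + 2)) * (Z3 + q powi (int N + 1 - int j) * Z2)"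
proof -
  have "(B + 1) ^ 2 = B ^ 2 + 2 * B + 1" by (simp add: power2_eq_square)
  hence B2: "(B + 1) ^ 2 = B ^ 2 + (N + 2)" using B by simp
  have pe: "q ^ a = q ^ b" if "a = b" for a b :: nat using that by simp
  have powi: "q ^ j * q powi (int N + 1 - int j) = q ^ (N + 1)"
  proof -
    have "q ^ j * q powi (int N + 1 - int j) = q powi (int j + (int N + 1 - int j))"
      using q by (subst power_int_add) auto
    also have "int j + (int N + 1 - int j) = int (N + 1)" by simp
    finally show ?thesis by (simp only: power_int_of_nat)
  qed
  have "q ^ (2 * (j + N) + 4) * (X * q ^ ((B + 1) ^ 2)) =
      q ^ (2 * j) * (X3 * q ^ ((B + 1) ^ 2)) + q ^ (2 * (j + N) + j + 3) * q ^ (N + 2) * (X2 * q ^ (B ^ 2))"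
    unfolding mult.assoc[symmetric] rec B2 power_add[of q "B ^ 2"] by (simp add: algebra_simps)
  also have "\<dots> = (q ^ (2 * j) * q ^ ((j + 2) * (N + 2))) * Z3 + (q ^ (2 * (j + N) + j + 3) * q ^ (N + 2) * q ^ (j * N)) * Z2"
    unfolding X3 X2 by (simp only: mult.assoc)
  also have "q ^ (2 * j) * q ^ ((j + 2) * (N + 2)) = q ^ (2 * (j + N) + 4) * q ^ (j * (N + 2))"
    unfolding power_add[symmetric] by (rule pe) (simp add: algebra_simps)
  also have "q ^ (2 * (j + N) + j + 3) * q ^ (N + 2) * q ^ (j * N) = q ^ (2 * (j + N) + 4) * q ^ (j * N + j) * q ^ (N + 1)"
    unfolding power_add[symmetric] by (rule pe) (simp add: algebra_simps)
  also have "\<dots> = q ^ (2 * (j + N) + 4) * (q ^ (j * N + j) * q ^ j) * q powi (int N + 1 - int j)"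
    unfolding powi[symmetric] by (simp only: mult.assoc)
  also have "q ^ (j * N + j) * q ^ j = q ^ (j * (N + 2))"
    unfolding power_add[symmetric] by (rule pe) (simp add: algebra_simps)
  finally have "q ^ (2 * (j + N) + 4) * (X * q ^ ((B + 1) ^ 2)) =
      q ^ (2 * (j + N) + 4) * (q ^ (j * (N + 2)) * (Z3 + q powi (int N + 1 - int j) * Z2))"
    by (simp only: distrib_left mult.assoc)
  thus ?thesis using q by simp
qed

context sym_form
begin

text \<open>There are \<open>m\<close> hyperbolic planes that are orthogonal to \<open>V\<close> and to each other.\<close>

primrec room :: "nat \<Rightarrow> ('a ^ 'k) set \<Rightarrow> bool" where
  "room 0 V = True"
| "room (Suc m) V = (\<exists>r r'. r \<in> orth V \<and> r' \<in> orth V \<and> f r r = 0 \<and> f r' r = 1 \<and> room m (adjoin r' (adjoin r V)))"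

lemma orth_anti: "U \<subseteq> V \<Longrightarrow> orth V \<subseteq> orth U"
  by (auto simp: orth_def)

lemma room_mono: "room m V \<Longrightarrow> U \<subseteq> V \<Longrightarrow> room m U"
proof (induction m arbitrary: U V)
  case (Suc m)
  then obtain r r' where r: "r \<in> orth V" "r' \<in> orth V" "f r r = 0" "f r' r = 1" "room m (adjoin r' (adjoin r V))"
    by auto
  have "room m (adjoin r' (adjoin r U))"
    by (rule Suc.IH[OF r(5)]) (intro adjoin_mono Suc.prems)
  thus ?case using r orth_anti[OF Suc.prems(2)] by auto
qed simp

text \<open>The excess dim V - dim P - dim rad P is u + 2 for (V, P) and u for both (V2, P) and (V3,
  P3), although V3 is larger than V. V2 is obtained by removing two anisotropic vectors from V, V3
  by adding two hyperbolic planes to V2, and each of these planes contributes one isotropic vector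
  to P3. Each reduction therefore uses up two planes of \<open>room\<close>.\<close>

lemma two_step_reduction:
  assumes V: "vec.subspace V" "corank V = 0" and P: "vec.subspace P" "P \<subseteq> V" "vec.dim P = 2 * k" "corank P = i"
    and d: "vec.dim V = 2 * k + i + u + 2" and room: "room (u + 2) V"
  obtains V2 V3 P3 where "vec.subspace V2" "corank V2 = 0" "P \<subseteq> V2" "vec.dim V2 = 2 * k + i + u" "room u V2"
    "vec.subspace V3" "corank V3 = 0" "vec.dim V3 = 2 * k + i + u + 4" "room u V3"
    "vec.subspace P3" "P3 \<subseteq> V3" "vec.dim P3 = 2 * k + 2" "corank P3 = i + 2" "disc_char P3 = disc_char P"
    "q ^ (2 * (2 * k + i + u) + 4) * nonsing_count V P =
      q ^ (4 * k) * nonsing_count V3 P3 + q ^ (2 * (2 * k + i + u) + 2 * k + 3) * nonsing_count V2 P"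
proof -
  obtain e V1 where e: "V = adjoin e V1" "vec.subspace V1" "corank V1 = 0" "P \<subseteq> V1" "e \<in> orth V1" "f e e \<noteq> 0"
    "vec.dim V = Suc (vec.dim V1)"
    using anisotropic_split[OF V P(1,2)] d P by auto
  obtain e' V2 where e': "V1 = adjoin e' V2" "vec.subspace V2" "corank V2 = 0" "P \<subseteq> V2" "e' \<in> orth V2" "f e' e' \<noteq> 0"
    "vec.dim V1 = Suc (vec.dim V2)"
    using anisotropic_split[OF e(2,3) P(1) e(4)] d P e(7) by auto
  obtain r r' where r: "r \<in> orth V" "r' \<in> orth V" "f r r = 0" "f r' r = 1" "room (Suc u) (adjoin r' (adjoin r V))"
    using room by auto
  obtain s s' where s: "s \<in> orth (adjoin r' (adjoin r V))" "s' \<in> orth (adjoin r' (adjoin r V))" "f s s = 0" "f s' s = 1"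
    "room u (adjoin s' (adjoin s (adjoin r' (adjoin r V))))"
    using r(5) by auto
  have sub: "V1 \<subseteq> V" "V2 \<subseteq> V1" using e(1) e'(1) adjoin_superset by auto
  have sub2: "V2 \<subseteq> V" using sub by blast
  have r1: "r \<in> orth V1" "r' \<in> orth V1" and r2: "r \<in> orth V2" "r' \<in> orth V2"
    using r orth_anti[OF sub(1)] orth_anti[OF sub2] by auto
  define VH where "VH = adjoin r' (adjoin r V2)"
  have "VH \<subseteq> adjoin r' (adjoin r V)" unfolding VH_def by (intro adjoin_mono sub2)
  hence s2: "s \<in> orth VH" "s' \<in> orth VH" using s orth_anti by blast+
  define V3 where "V3 = adjoin s' (adjoin s VH)"
  define P3 where "P3 = adjoin s (adjoin r P)"
  note signed_ind = hyperbolic_adjoin[OF e'(2,3) r2 r(3,4), folded VH_def]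
  have VH: "vec.subspace VH" by (simp add: VH_def)
  note h2 = hyperbolic_adjoin[OF VH signed_ind(1) s2 s(3,4), folded V3_def]
  have V3sub: "V3 \<subseteq> adjoin s' (adjoin s (adjoin r' (adjoin r V)))" unfolding V3_def VH_def by (intro adjoin_mono sub2)
  have PV: "adjoin r P \<subseteq> VH" using adjoin_mono[OF e'(4), of r] adjoin_superset[of "adjoin r V2" r'] by (auto simp: VH_def)
  have PV3: "P3 \<subseteq> V3" using adjoin_mono[OF PV, of s] adjoin_superset[of "adjoin s VH" s'] by (auto simp: V3_def P3_def)
  have rP: "\<forall>y\<in>P. f r y = 0" "r \<notin> P" using r2 signed_ind(4) e'(4) by (auto simp: orth_def)
  have sP: "\<forall>y\<in>adjoin r P. f s y = 0" "s \<notin> adjoin r P" using s2 h2(4) PV by (auto simp: orth_def)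
  note signed_border_ind = disc_char_adjoin_sing[OF P(1) rP(1) r(3) rP(2)]
  note c2 = disc_char_adjoin_sing[OF subspace_adjoin sP(1) s(3) sP(2), folded P3_def]
  have dP: "vec.dim P3 = 2 * k + 2"
    unfolding P3_def using dim_adjoin[OF P(1) rP(2)] dim_adjoin[OF subspace_adjoin sP(2)] P(3) by simp
  have d2: "vec.dim V2 = 2 * k + i + u" using d e(7) e'(7) by simp
  have rm: "room u V3" "room u V2"
  proof -
    show "room u V3" by (rule room_mono[OF s(5) V3sub])
    thus "room u V2"
      by (rule room_mono) (auto simp: V3_def VH_def intro: adjoin_superset[THEN subsetD])
  qed
  have "q ^ (2 * vec.dim V2 + 4) * nonsing_count (adjoin e (adjoin e' V2)) P =
      q ^ (4 * k) * nonsing_count V3 P3 + q ^ (2 * vec.dim V2 + 2 * k + 3) * nonsing_count V2 P"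
    unfolding V3_def VH_def P3_def
    by (rule two_step[OF e'(2,3) P(1) e'(4) P(3) e'(5,6) e(5)[unfolded e'(1)] e(6)
          r1[unfolded e'(1)] r(3,4) s2[unfolded VH_def] s(3,4)])
  hence rec: "q ^ (2 * (2 * k + i + u) + 4) * nonsing_count V P =
      q ^ (4 * k) * nonsing_count V3 P3 + q ^ (2 * (2 * k + i + u) + 2 * k + 3) * nonsing_count V2 P"
    by (simp only: d2 e'(1)[symmetric] e(1)[symmetric])
  show thesis
    by (rule that[OF e'(2,3,4) d2 rm(2) _ h2(1) _ rm(1) _ PV3 dP _ _ rec])
      (use signed_border_ind c2 P signed_ind h2 d2 in \<open>simp_all add: V3_def P3_def\<close>)
qed

text \<open>At excess 0 the orthogonal complement of P is rad P, so duality reduces the count to a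
  totally isotropic subspace.\<close>

lemma extremal_count:
  assumes V: "vec.subspace V" "corank V = 0" and P: "vec.subspace P" "P \<subseteq> V" "corank P = i"
    and d: "vec.dim V = vec.dim P + i"
  shows "nonsing_count V P = q ^ (i * vec.dim P) * nonsing_prob q i" "V \<inter> orth P = rad P"
proof -
  have A: "vec.subspace (V \<inter> orth P)" by (rule vec.subspace_inter[OF V(1) subspace_orth])
  have "rad P \<subseteq> V \<inter> orth P" using P(2) by (auto simp: rad_eq)
  moreover have "vec.dim (V \<inter> orth P) \<le> vec.dim (rad P)"
    using dim_orth[OF V P(1,2)] P(3) d by (simp add: corank_def)
  ultimately show eq: "V \<inter> orth P = rad P"
    using subspace_eqI[OF subspace_rad[OF P(1)] A] by blast
  have "nonsing_count V (rad P) = q ^ (i * (vec.dim V - i)) * nonsing_prob q i"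
    using P by (intro isotropic_count[OF V subspace_rad[OF P(1)]]) (auto simp: rad_def corank_def)
  thus "nonsing_count V P = q ^ (i * vec.dim P) * nonsing_prob q i"
    unfolding dual(1)[OF V P(1,2)] eq by (simp add: d)
qed

text \<open>The excess is 2a, and \<open>extremal_count\<close> settles a = 0. The induction
  generalises over k and l because V3 has k + 1 and l + 1; the shift 2l + 1 - 2k is the same in both
  branches, so they supply the two terms of \<open>chi_sum_Suc\<close>.\<close>

lemma count_odd:
  assumes "vec.subspace V" "corank V = 0" "vec.subspace P" "P \<subseteq> V" "vec.dim P = 2 * k"
    "corank P = 2 * l + 1" "vec.dim V = 2 * k + (2 * l + 1) + 2 * a" "room (2 * a) V"
  shows "nonsing_count V P * q ^ ((l + 1 + a) ^ 2) =
    q ^ (2 * k * (2 * l + 1 + 2 * a)) * chi_sum q (l + 1 + a) a (int (2 * l + 1) - int (2 * k))"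
  using assms
proof (induction a arbitrary: V P k l)
  case 0
  have "(2 * l + 1 + 1) div 2 = l + 1" by simp
  hence p: "q ^ ((l + 1) ^ 2) * nonsing_prob q (2 * l + 1) = odd_prod q (l + 1)"
    unfolding nonsing_prob_def by (simp only: odd_prod_nonsing_prob[OF q_pos])
  have "nonsing_count V P = q ^ (2 * k * (2 * l + 1)) * nonsing_prob q (2 * l + 1)"
    using extremal_count(1)[OF 0(1-4,6)] 0 by (simp add: mult.commute)
  hence "nonsing_count V P * q ^ ((l + 1) ^ 2) = q ^ (2 * k * (2 * l + 1)) * (q ^ ((l + 1) ^ 2) * nonsing_prob q (2 * l + 1))"
    by (simp only: ac_simps)
  thus ?case unfolding p by (simp add: chi_sum_def)
next
  case (Suc a)
  have d: "vec.dim V = 2 * k + (2 * l + 1) + 2 * a + 2" "room (2 * a + 2) V" using Suc.prems by simp_all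
  obtain V2 V3 P3 where V2: "vec.subspace V2" "corank V2 = 0" "P \<subseteq> V2" "vec.dim V2 = 2 * k + (2 * l + 1) + 2 * a" "room (2 * a) V2"
    and V3: "vec.subspace V3" "corank V3 = 0" "vec.dim V3 = 2 * k + (2 * l + 1) + 2 * a + 4" "room (2 * a) V3"
    and P3: "vec.subspace P3" "P3 \<subseteq> V3" "vec.dim P3 = 2 * k + 2" "corank P3 = 2 * l + 1 + 2"
    and rec: "q ^ (2 * (2 * k + (2 * l + 1) + 2 * a) + 4) * nonsing_count V P =
      q ^ (4 * k) * nonsing_count V3 P3 + q ^ (2 * (2 * k + (2 * l + 1) + 2 * a) + 2 * k + 3) * nonsing_count V2 P"
    using two_step_reduction[OF Suc.prems(1-6) d] .
  define t where "t = int (2 * l + 1) - int (2 * k)"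
  have t3: "int (2 * (l + 1) + 1) - int (2 * (k + 1)) = t" by (simp add: t_def)
  have IH3: "nonsing_count V3 P3 * q ^ ((l + 1 + a + 1) ^ 2) =
      q ^ ((2 * k + 2) * (2 * l + 1 + 2 * a + 2)) * chi_sum q (l + 1 + a + 1) a t"
    using Suc.IH[of V3 P3 "k + 1" "l + 1"] V3 P3 unfolding t3 by (simp add: algebra_simps)
  have IH2: "nonsing_count V2 P * q ^ ((l + 1 + a) ^ 2) = q ^ (2 * k * (2 * l + 1 + 2 * a)) * chi_sum q (l + 1 + a) a t"
    using Suc.IH[OF V2(1,2) Suc.prems(3) V2(3) Suc.prems(5,6) V2(4,5)] by (simp only: t_def)
  have "nonsing_count V P * q ^ ((l + 1 + a + 1) ^ 2) = q ^ (2 * k * (2 * l + 1 + 2 * a + 2)) *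
      (chi_sum q (l + 1 + a + 1) a t + q powi (int (2 * l + 1 + 2 * a) + 1 - int (2 * k)) * chi_sum q (l + 1 + a) a t)"
  proof (rule recursion_arith[OF q_pos _ _ IH3 IH2])
    show "q ^ (2 * (2 * k + (2 * l + 1 + 2 * a)) + 4) * nonsing_count V P =
        q ^ (2 * (2 * k)) * nonsing_count V3 P3 + q ^ (2 * (2 * k + (2 * l + 1 + 2 * a)) + 2 * k + 3) * nonsing_count V2 P"
      using rec by (simp add: add.assoc)
  qed simp
  also have "int (2 * l + 1 + 2 * a) + 1 - int (2 * k) = 2 * int a + 1 + t" by (simp add: t_def)
  finally show ?case
    using chi_sum_Suc[OF q_pos, of "l + 1 + Suc a" a t] unfolding t_def[symmetric]
    by (simp add: algebra_simps)
qed

text \<open>The excess is 2a + 1. At excess 1, an anisotropic vector is removed and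
  \<open>step_even\<close> applies to an extremal pair (V', P). Its border count comes from adding a
  hyperbolic plane, its signed count from duality and \<open>isotropic_even\<close>; the latter is
  the source of the second sum and of its sign.\<close>

lemma count_even:
  assumes "vec.subspace V" "corank V = 0" "vec.subspace P" "P \<subseteq> V" "vec.dim P = 2 * k"
    "corank P = 2 * l" "vec.dim V = 2 * k + 2 * l + (2 * a + 1)" "room (2 * a + 1) V"
  shows "nonsing_count V P * q ^ ((l + 1 + a) ^ 2) =
    q ^ (2 * k * (2 * l + 2 * a + 1)) * (chi_sum q (l + 1 + a) a (int (2 * l) - int (2 * k) + 1) +
      sig ^ (k + l) * disc_char P * q powi (int l - int k) * chi_sum q (l + a) a (int (2 * l) - int (2 * k) + 1))"
  using assms
proof (induction a arbitrary: V P k l)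
  case 0
  have cP: "vec.dim V > vec.dim P + corank P" using 0 by simp
  obtain e V' where e: "V = adjoin e V'" and V': "vec.subspace V'" "corank V' = 0" "P \<subseteq> V'"
    and eo: "e \<in> orth V'" "f e e \<noteq> 0" and dV: "vec.dim V = Suc (vec.dim V')"
    using anisotropic_split[OF 0(1-4) cP] .
  have d': "vec.dim V' = vec.dim P + 2 * l" using dV 0 by simp
  obtain r r' where r: "r \<in> orth V" "r' \<in> orth V" "f r r = 0" "f r' r = 1" using 0(8) by auto
  have "V' \<subseteq> V" unfolding e by (rule adjoin_superset)
  hence r: "r \<in> orth V'" "r' \<in> orth V'" "f r r = 0" "f r' r = 1" using r orth_anti by blast+
  define VH where "VH = adjoin r' (adjoin r V')"
  note h = hyperbolic_adjoin[OF V'(1,2) r, folded VH_def]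
  have rP: "\<forall>y\<in>P. f r y = 0" "r \<notin> P" using r(1) h(4) V'(3) by (auto simp: orth_def)
  have cP1: "corank (adjoin r P) = 2 * l + 1" "vec.dim (adjoin r P) = 2 * k + 1"
    using disc_char_adjoin_sing(2)[OF 0(3) rP(1) r(3) rP(2)] dim_adjoin[OF 0(3) rP(2)] 0 by auto
  have PV: "adjoin r P \<subseteq> VH" using adjoin_mono[OF V'(3), of r] adjoin_superset[of "adjoin r V'" r'] by (auto simp: VH_def)
  have VHs: "vec.subspace VH" by (simp add: VH_def)
  \<comment> \<open>\<open>VH\<close> has dimension (2k + 1) + (2l + 1), so the pair is again
    extremal, now with odd corank.\<close>
  have "nonsing_count VH (adjoin r P) = q ^ ((2 * l + 1) * (2 * k + 1)) * nonsing_prob q (2 * l + 1)"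
    using extremal_count(1)[OF VHs h(1) subspace_adjoin PV cP1(1)] h(3) d' 0(5) cP1 by simp
  moreover have "nonsing_count VH (adjoin r P) = q ^ (2 * k + 2 * l) * ((q - 1) * border_count V' P)"
    using step_hyperbolic(1)[OF V'(1,2) 0(3) V'(3) r] d' 0(5) by (simp add: VH_def[symmetric] mult.assoc)
  moreover have "q ^ ((2 * l + 1) * (2 * k + 1)) = q ^ (2 * k + 2 * l) * q ^ (4 * k * l + 1)"
    unfolding power_add[symmetric] by (rule arg_cong[of _ _ "power q"]) (simp add: algebra_simps)
  ultimately have C: "(q - 1) * border_count V' P = q ^ (4 * k * l + 1) * nonsing_prob q (2 * l + 1)"
    using q_pos by (simp add: mult.assoc)
  note ex = extremal_count[OF V'(1,2) 0(3) V'(3) 0(6) d']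
  define R where "R = rad P"
  have R: "vec.subspace R" "R \<subseteq> V'" "\<forall>x\<in>R. \<forall>y\<in>R. f x y = 0" "vec.dim R = 2 * l"
    using 0 V'(3) subspace_rad[OF 0(3)] by (auto simp: R_def rad_def corank_def)
  have pv: "\<exists>e\<in>orth V'. f e e = a" for a by (rule plane_value[OF r])
  have XR: "nonsing_count V' R = q ^ (4 * k * l) * nonsing_prob q (2 * l)"
  proof -
    have "nonsing_count V' R = nonsing_count V' P" unfolding dual(1)[OF V'(1,2) 0(3) V'(3)] ex(2) R_def ..
    also have "\<dots> = q ^ (2 * l * (2 * k)) * nonsing_prob q (2 * l)" using ex(1) 0(5) by simp
    also have "2 * l * (2 * k) = 4 * k * l" by simp
    finally show ?thesis .
  qed
  have sV: "disc_char V' = disc_char P"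
  proof -
    have "disc_char V' = (sig * sig) ^ l * disc_char P"
      using disc_char_extremal[OF V'(1,2) 0(3) V'(3)] d' 0(6) by (simp add: power_mult power2_eq_square)
    thus ?thesis by (simp add: sig_sq)
  qed
  have ss: "disc_char V' * disc_char V' = 1" by (rule disc_char_sq[OF V'(1)])
  have X1R: "q ^ l * signed_count V' R = sig ^ l * disc_char V' * nonsing_count V' R"
    by (rule isotropic_even(1)[OF V'(1,2) R pv])
  \<comment> \<open>Duality moves the signed count from P to its radical, where
    \<open>isotropic_even\<close> determines it.\<close>
  have "signed_count V' P = disc_char V' * signed_count V' R" unfolding dual(2)[OF V'(1,2) 0(3) V'(3)] ex(2) R_def ..
  hence X1P: "q ^ l * (disc_char V' * signed_count V' P) = sig ^ l * disc_char P * nonsing_count V' R"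
    using X1R ss sV by (metis (no_types, lifting) mult.assoc mult.commute mult_1_left)
  have main: "q * nonsing_count V P = q ^ (2 * k) * (q ^ (4 * k * l + 1) * nonsing_prob q (2 * l + 1))
      + q ^ k * sig ^ k * (disc_char V' * signed_count V' P)"
    using step_even(1)[OF V'(1,2) 0(3) V'(3) eo 0(5)] unfolding e C[symmetric] by (simp only: mult.assoc)
  define p where "p = odd_prod q l"
  have pl: "q ^ ((l + 1) ^ 2) * nonsing_prob q (2 * l + 1) = odd_prod q (l + 1)"
    "q ^ (l ^ 2) * nonsing_prob q (2 * l) = p"
  proof -
    have "(2 * l + 1 + 1) div 2 = l + 1" "(2 * l + 1) div 2 = l" by simp_all
    thus "q ^ ((l + 1) ^ 2) * nonsing_prob q (2 * l + 1) = odd_prod q (l + 1)"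
      "q ^ (l ^ 2) * nonsing_prob q (2 * l) = p"
      unfolding nonsing_prob_def p_def by (simp_all only: odd_prod_nonsing_prob[OF q_pos])
  qed
  have B2: "q ^ ((l + 1) ^ 2) = q ^ (l ^ 2) * q ^ (2 * l + 1)"
    unfolding power_add[symmetric] by (rule arg_cong[of _ _ "power q"]) (simp add: power2_eq_square)
  have powi: "q ^ k * q ^ (l + 1) = q * (q ^ (2 * k) * q powi (int l - int k))"
  proof -
    have "q ^ (2 * k) * q powi (int l - int k) = q powi (int (2 * k)) * q powi (int l - int k)"
      by (simp only: power_int_of_nat)
    also have "\<dots> = q powi (int (2 * k) + (int l - int k))"
      using q_pos by (subst power_int_add) simp_all
    also have "int (2 * k) + (int l - int k) = int (k + l)" by simp
    finally have "q ^ (2 * k) * q powi (int l - int k) = q ^ (k + l)" by (simp only: power_int_of_nat)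
    thus ?thesis by (simp add: power_add)
  qed
  have "q * (nonsing_count V P * q ^ ((l + 1) ^ 2)) =
      q ^ (2 * k) * q ^ (4 * k * l + 1) * (q ^ ((l + 1) ^ 2) * nonsing_prob q (2 * l + 1))
      + q ^ k * sig ^ k * (disc_char V' * signed_count V' P) * (q ^ (l ^ 2) * q ^ (2 * l + 1))"
    unfolding B2[symmetric] mult.assoc[symmetric] main by (simp only: ring_distribs ac_simps)
  also have "q ^ k * sig ^ k * (disc_char V' * signed_count V' P) * (q ^ (l ^ 2) * q ^ (2 * l + 1)) =
      q ^ k * sig ^ k * (q ^ l * (disc_char V' * signed_count V' P)) * q ^ (l ^ 2) * q ^ (l + 1)"
  proof -
    have "q ^ (2 * l + 1) = q ^ l * q ^ (l + 1)" by (simp add: power_add mult_2)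
    thus ?thesis by (simp only: ac_simps)
  qed
  also have "\<dots> = (q ^ k * q ^ (l + 1)) * q ^ (4 * k * l) * (sig ^ (k + l) * disc_char P) * (q ^ (l ^ 2) * nonsing_prob q (2 * l))"
    unfolding X1P XR power_add[of sig] by (simp only: ac_simps)
  also have "\<dots> = q * (q ^ (2 * k) * q ^ (4 * k * l)) * (sig ^ (k + l) * disc_char P * q powi (int l - int k) * p)"
    unfolding powi pl by (simp only: ac_simps)
  also have "q ^ (2 * k) * q ^ (4 * k * l + 1) * (q ^ ((l + 1) ^ 2) * nonsing_prob q (2 * l + 1)) =
      q * (q ^ (2 * k) * q ^ (4 * k * l)) * odd_prod q (l + 1)"
    unfolding pl by simp
  also have "q ^ (2 * k) * q ^ (4 * k * l) = q ^ (2 * k * (2 * l + 1))"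
    unfolding power_add[symmetric] by (rule arg_cong[of _ _ "power q"]) (simp add: algebra_simps)
  finally have "q * (nonsing_count V P * q ^ ((l + 1) ^ 2)) = q * (q ^ (2 * k * (2 * l + 1)) *
      (odd_prod q (l + 1) + sig ^ (k + l) * disc_char P * q powi (int l - int k) * p))"
    by (simp only: distrib_left mult.assoc)
  hence "nonsing_count V P * q ^ ((l + 1) ^ 2) = q ^ (2 * k * (2 * l + 1)) *
      (odd_prod q (l + 1) + sig ^ (k + l) * disc_char P * q powi (int l - int k) * p)"
    using q_pos by simp
  thus ?case by (simp add: chi_sum_def p_def)
next
  case (Suc a)
  have d: "vec.dim V = 2 * k + 2 * l + (2 * a + 1) + 2" "room (2 * a + 1 + 2) V" using Suc.prems by simp_all
  obtain V2 V3 P3 where V2: "vec.subspace V2" "corank V2 = 0" "P \<subseteq> V2" "vec.dim V2 = 2 * k + 2 * l + (2 * a + 1)" "room (2 * a + 1) V2"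
    and V3: "vec.subspace V3" "corank V3 = 0" "vec.dim V3 = 2 * k + 2 * l + (2 * a + 1) + 4" "room (2 * a + 1) V3"
    and P3: "vec.subspace P3" "P3 \<subseteq> V3" "vec.dim P3 = 2 * k + 2" "corank P3 = 2 * l + 2" "disc_char P3 = disc_char P"
    and rec: "q ^ (2 * (2 * k + 2 * l + (2 * a + 1)) + 4) * nonsing_count V P =
      q ^ (4 * k) * nonsing_count V3 P3 + q ^ (2 * (2 * k + 2 * l + (2 * a + 1)) + 2 * k + 3) * nonsing_count V2 P"
    using two_step_reduction[OF Suc.prems(1-6) d] .
  define t where "t = int (2 * l) - int (2 * k) + 1"
  define w where "w = sig ^ (k + l) * disc_char P * q powi (int l - int k)"
  have t3: "int (2 * (l + 1)) - int (2 * (k + 1)) + 1 = t" by (simp add: t_def)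
  \<comment> \<open>As k and l both grow by 1, the sign and the power of q in front of the second
    sum are the same for P3 as for P.\<close>
  have w3: "sig ^ (k + 1 + (l + 1)) * disc_char P3 * q powi (int (l + 1) - int (k + 1)) = w"
  proof -
    have "sig ^ (k + 1 + (l + 1)) = (sig * sig) * sig ^ (k + l)" by simp
    thus ?thesis unfolding w_def P3(5) by (simp add: sig_sq)
  qed
  have IH3: "nonsing_count V3 P3 * q ^ ((l + a + 1 + 1) ^ 2) =
      q ^ ((2 * k + 2) * (2 * l + 2 * a + 1 + 2)) * (chi_sum q (l + a + 1 + 1) a t + w * chi_sum q (l + a + 1) a t)"
    using Suc.IH[of V3 P3 "k + 1" "l + 1"] V3 P3(1-4) unfolding t3 w3 by (simp add: algebra_simps)
  have IH2: "nonsing_count V2 P * q ^ ((l + a + 1) ^ 2) =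
      q ^ (2 * k * (2 * l + 2 * a + 1)) * (chi_sum q (l + a + 1) a t + w * chi_sum q (l + a) a t)"
    using Suc.IH[OF V2(1,2) Suc.prems(3) V2(3) Suc.prems(5,6) V2(4,5)]
    unfolding t_def[symmetric] w_def[symmetric] by (simp add: ac_simps)
  have "nonsing_count V P * q ^ ((l + a + 1 + 1) ^ 2) = q ^ (2 * k * (2 * l + 2 * a + 1 + 2)) *
      (chi_sum q (l + a + 1 + 1) a t + w * chi_sum q (l + a + 1) a t
       + q powi (int (2 * l + 2 * a + 1) + 1 - int (2 * k)) * (chi_sum q (l + a + 1) a t + w * chi_sum q (l + a) a t))"
  proof (rule recursion_arith[OF q_pos _ _ IH3 IH2])
    show "q ^ (2 * (2 * k + (2 * l + 2 * a + 1)) + 4) * nonsing_count V P =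
        q ^ (2 * (2 * k)) * nonsing_count V3 P3 + q ^ (2 * (2 * k + (2 * l + 2 * a + 1)) + 2 * k + 3) * nonsing_count V2 P"
      using rec by (simp add: add.assoc)
  qed simp
  also have "int (2 * l + 2 * a + 1) + 1 - int (2 * k) = 2 * int a + 1 + t" by (simp add: t_def)
  also have "chi_sum q (l + a + 1 + 1) a t + w * chi_sum q (l + a + 1) a t
       + q powi (2 * int a + 1 + t) * (chi_sum q (l + a + 1) a t + w * chi_sum q (l + a) a t) =
      chi_sum q (l + a + 1 + 1) (Suc a) t + w * chi_sum q (l + a + 1) (Suc a) t"
    unfolding chi_sum_Suc[OF q_pos] by (simp add: algebra_simps)
  finally show ?case unfolding t_def[symmetric] w_def[symmetric] by (simp add: algebra_simps)
qed


section \<open>The type of a subspace and the final count\<close>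

text \<open>Count the isotropic vectors of V. Those orthogonal to T are the vectors of T, by
  maximality; among the others they form a proportion 1/q. Comparison with
  \<open>level_count\<close> at t = 0 gives the sign of the discriminant in terms of dim T.\<close>

lemma disc_char_maximal_isotropic:
  assumes V: "vec.subspace V" "corank V = 0" "vec.dim V = 2 * h"
    and T: "vec.subspace T" "T \<subseteq> V" "\<forall>x\<in>T. f x x = 0"
    and max: "\<And>v. v \<in> V \<Longrightarrow> v \<in> orth T \<Longrightarrow> f v v = 0 \<Longrightarrow> v \<in> T"
  shows "vec.dim T = h \<Longrightarrow> sig ^ h * disc_char V = 1" and "vec.dim T + 1 = h \<Longrightarrow> sig ^ h * disc_char V = -1"
proof -
  define A where "A = V \<inter> orth T"
  have A: "vec.subspace A" unfolding A_def by (rule vec.subspace_inter[OF V(1) subspace_orth])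
  have TT: "f x y = 0" if "x \<in> T" "y \<in> T" for x y by (rule isotropic_f_zero[OF T(1,3) that])
  have TA: "T \<subseteq> A" using T(2) TT by (auto simp: A_def orth_def)
  define B where "B = V - A"
  have shift: "v + t \<in> B" if "v \<in> B" "t \<in> T" for v t
  proof -
    have "v + t \<in> V" using that T(2) by (auto simp: B_def intro: vec.subspace_add[OF V(1)])
    moreover have "v + t \<notin> A"
    proof
      assume "v + t \<in> A"
      hence "(v + t) - t \<in> A" using that TA by (intro vec.subspace_diff[OF A]) auto
      thus False using that by (simp add: B_def)
    qed
    ultimately show ?thesis by (simp add: B_def)
  qed
  \<comment> \<open>On the coset v + T the norm is f v v + 2 f t v, which is a non-constant affine
    function of t because v is not orthogonal to T.\<close>
  have inner: "q * real (card {t\<in>T. f (v + t) (v + t) = 0}) = real (card T)" if v: "v \<in> B" for v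
  proof -
    obtain t0 where t0: "t0 \<in> T" "f v t0 \<noteq> 0" using v by (auto simp: B_def A_def orth_def)
    hence t0: "t0 \<in> T" "f t0 v \<noteq> 0" by (simp_all only: f_sym[of v t0] not_False_eq_True)
    have "f (v + t) (v + t) = 0 \<longleftrightarrow> f t v = - f v v / 2" if "t \<in> T" for t
    proof -
      define c where "c = f v v / 2"
      have "f (v + t) (v + t) = f v v + 2 * f t v" using TT[OF that that] by (simp add: f_simps f_sym[of v t])
      moreover have "f v v = 2 * c" using two by (simp add: c_def)
      ultimately have e: "f (v + t) (v + t) = 2 * (c + f t v)" by (simp add: ring_distribs)
      have z: "2 * z = 0 \<longleftrightarrow> z = 0" for z :: 'a using two by simp
      show ?thesis unfolding e z by (simp add: c_def add_eq_0_iff)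
    qed
    hence "{t\<in>T. f (v + t) (v + t) = 0} = {t\<in>T. f t v = - f v v / 2}" by (intro Collect_cong conj_cong refl)
    thus ?thesis using functional_fibre[OF T(1) t0, of "- f v v / 2"] by (simp only:)
  qed
  \<comment> \<open>Translations by vectors of T permute B, so the count over B may be averaged over
    them.\<close>
  have "q * (real (card T) * real (card {v\<in>B. f v v = 0})) =
      q * (\<Sum>t\<in>T. \<Sum>v\<in>B. if f v v = 0 then 1 else 0)"
    by (simp add: sum.inter_filter[symmetric])
  also have "(\<Sum>t\<in>T. \<Sum>v\<in>B. if f v v = 0 then 1 else (0::real)) =
      (\<Sum>t\<in>T. \<Sum>v\<in>B. if f (v + t) (v + t) = 0 then 1 else 0)"
  proof (rule sum.cong[OF refl])
    fix t assume t: "t \<in> T"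
    show "(\<Sum>v\<in>B. if f v v = 0 then 1 else (0::real)) = (\<Sum>v\<in>B. if f (v + t) (v + t) = 0 then 1 else 0)"
      by (rule sum.reindex_bij_witness[of _ "\<lambda>v. v + t" "\<lambda>v. v + (- t)"])
        (use shift t vec.subspace_neg[OF T(1) t] in \<open>simp_all del: add_uminus_conv_diff\<close>)
  qed
  also have "\<dots> = (\<Sum>v\<in>B. \<Sum>t\<in>T. if f (v + t) (v + t) = 0 then 1 else 0)" by (rule sum.swap)
  also have "q * \<dots> = (\<Sum>v\<in>B. q * real (card {t\<in>T. f (v + t) (v + t) = 0}))"
    by (simp add: sum.inter_filter[symmetric] sum_distrib_left)
  also have "\<dots> = real (card B) * real (card T)" using inner by simp
  finally have "real (card T) * (q * real (card {v\<in>B. f v v = 0})) = real (card T) * real (card B)"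
    by (simp add: algebra_simps)
  moreover have "T \<noteq> {}" using vec.subspace_0[OF T(1)] by auto
  ultimately have cB: "q * real (card {v\<in>B. f v v = 0}) = real (card B)" by simp
  have "{v\<in>V. f v v = 0} = T \<union> {v\<in>B. f v v = 0}"
    using max T TA by (auto simp: B_def A_def)
  moreover have "T \<inter> {v\<in>B. f v v = 0} = {}" using TA by (auto simp: B_def)
  ultimately have "card {v\<in>V. f v v = 0} = card T + card {v\<in>B. f v v = 0}"
    by (simp add: card_Un_disjoint)
  hence "q * real (card {v\<in>V. f v v = 0}) = q * real (card T) + real (card B)"
    using cB by (simp add: ring_distribs)
  moreover have "real (card B) = real (card V) - real (card A)"
    unfolding B_def by (subst card_Diff_subset) (auto simp: A_def of_nat_diff card_mono)
  moreover have dA: "vec.dim A + vec.dim T = 2 * h"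
    using dim_orth[OF V(1,2) T(1,2)] V(3) by (simp add: A_def)
  ultimately have eq: "sig ^ h * disc_char V * ((q - 1) * q ^ h) = q * q ^ vec.dim T - q ^ vec.dim A"
    using level_count(1)[OF V(1,2,3), of 0]
    by (simp add: real_card_subspace V A T algebra_simps)
  have q1: "(q - 1) * q ^ h \<noteq> 0"
  proof -
    have "card {0::'a, 1} \<le> CARD('a)" by (intro card_mono) auto
    thus ?thesis by (simp add: q_eq)
  qed
  show "sig ^ h * disc_char V = 1" if "vec.dim T = h"
  proof -
    have "vec.dim A = h" using that dA by simp
    hence "sig ^ h * disc_char V * ((q - 1) * q ^ h) = 1 * ((q - 1) * q ^ h)" using eq that by (simp add: algebra_simps)
    thus ?thesis using q1 by (simp only: mult_cancel_right) simp
  qed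
  show "sig ^ h * disc_char V = -1" if h: "vec.dim T + 1 = h"
  proof -
    have "vec.dim A = h + 1" using that dA by simp
    moreover have "q * q ^ vec.dim T = q ^ h" using h by (metis power_Suc Suc_eq_plus1)
    ultimately have "sig ^ h * disc_char V * ((q - 1) * q ^ h) = (-1) * ((q - 1) * q ^ h)" using eq by (simp add: algebra_simps)
    thus ?thesis using q1 by (simp only: mult_cancel_right) simp
  qed
qed

text \<open>T represents a maximal isotropic subspace of P modulo its radical. Intersecting with a
  complement S of the radical leads back to the non-degenerate case: \<open>U = T \<inter> S\<close>
  has dimension dim T - corank P and inherits maximality.\<close>

lemma disc_char_maximal_isotropic_radical:
  assumes P: "vec.subspace P" "vec.dim P = corank P + 2 * h"
    and T: "vec.subspace T" "rad P \<subseteq> T" "T \<subseteq> P" "\<forall>x\<in>T. f x x = 0"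
    and max: "\<And>U. vec.subspace U \<Longrightarrow> rad P \<subseteq> U \<Longrightarrow> U \<subseteq> P \<Longrightarrow> \<forall>x\<in>U. f x x = 0 \<Longrightarrow> vec.dim U \<le> vec.dim T"
  shows "vec.dim T = corank P + h \<Longrightarrow> sig ^ h * disc_char P = 1"
    and "vec.dim T + 1 = corank P + h \<Longrightarrow> sig ^ h * disc_char P = -1"
proof -
  obtain as m where a: "diag P as m" using diag_exists P by blast
  obtain S where S: "S \<subseteq> P" "diag S as 0" "\<forall>v\<in>P. \<exists>s\<in>S. v - s \<in> rad P" using nondegenerate_part[OF a] by blast
  have S1: "vec.subspace S" "corank S = 0" "disc_char S = disc_char P" "vec.dim S = 2 * h"
    using S a P by (simp_all add: diag_subspace diag_corank diag_disc_char diag_dim)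
  have SR: "S \<inter> rad P \<subseteq> {0}"
  proof -
    have "S \<inter> rad P \<subseteq> rad S" using S(1) by (auto simp: rad_def)
    thus ?thesis using S1 corank_0_iff by simp
  qed
  define U where "U = T \<inter> S"
  have U: "vec.subspace U" "U \<subseteq> S" "\<forall>x\<in>U. f x x = 0"
    unfolding U_def using vec.subspace_inter[OF T(1) S1(1)] T(4) by auto
  have dec: "\<exists>s\<in>U. t - s \<in> rad P" if t: "t \<in> T" for t
  proof -
    obtain s where s: "s \<in> S" "t - s \<in> rad P" using S(3) t T(3) by blast
    have "t - s \<in> T" using s T(2) by blast
    hence "t - (t - s) \<in> T" by (rule vec.subspace_diff[OF T(1) t])
    thus ?thesis using s by (auto simp: U_def)
  qed
  have "U \<inter> rad P = {0}"
    using SR vec.subspace_0[OF U(1)] vec.subspace_0[OF subspace_rad[OF P(1)]] by (auto simp: U_def)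
  hence "U \<in> complements T (rad P)" using U dec by (auto simp: complements_def U_def)
  hence dT: "vec.dim T = vec.dim U + corank P"
    using dim_complements[OF T(1) subspace_rad[OF P(1)] T(2)] by (simp add: corank_def)
  \<comment> \<open>Such a v is orthogonal to T = U + rad P, so if it were outside T,
    \<open>adjoin v T\<close> would contradict the maximality of T.\<close>
  have mx: "v \<in> U" if v: "v \<in> S" "v \<in> orth U" "f v v = 0" for v
  proof -
    have vT: "f v t = 0" if t: "t \<in> T" for t
    proof -
      obtain s where s: "s \<in> U" "t - s \<in> rad P" using dec t by blast
      have "f v s = 0" using v s by (auto simp: orth_def)
      moreover have "f (t - s) v = 0" using s(2) v(1) S(1) by (auto simp: rad_def)
      hence "f v (t - s) = 0" by (simp only: f_sym[of v])
      ultimately show ?thesis by (simp add: f_simps)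
    qed
    have "v \<in> T"
    proof (rule ccontr)
      assume n: "v \<notin> T"
      have "vec.dim (adjoin v T) \<le> vec.dim T"
      proof (rule max)
        show "rad P \<subseteq> adjoin v T" using T(2) adjoin_superset by blast
        show "adjoin v T \<subseteq> P" using v(1) S(1) T(3) P(1) by (intro adjoin_minimal) auto
        show "\<forall>x\<in>adjoin v T. f x x = 0" using v(3) T(4) vT by (auto simp: adjoin_iff[OF T(1)] Q_orth_sum)
      qed simp
      thus False using dim_adjoin[OF T(1) n] by simp
    qed
    thus ?thesis using v(1) by (simp add: U_def)
  qed
  note base = disc_char_maximal_isotropic[OF S1(1,2,4) U, unfolded S1(3)]
  show "sig ^ h * disc_char P = 1" if "vec.dim T = corank P + h"
    by (rule base(1)[OF mx]) (use that dT in simp_all)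
  show "sig ^ h * disc_char P = -1" if "vec.dim T + 1 = corank P + h"
    by (rule base(2)[OF mx]) (use that dT in simp_all)
qed

end

lemma sym_form_assoc_form:
  fixes Q :: "'a::{field,finite} ^ 'n \<Rightarrow> 'a"
  assumes Q: "quadratic_form Q" and odd: "odd CARD('a)"
  shows "sym_form (assoc_form Q) (real CARD('a)) (quad_char (-1::'a))" "assoc_form Q v v = Q v"
proof -
  have lin: "Vector_Spaces.linear (*s) (*) (assoc_form Q u)" for u
    using Q by (simp add: quadratic_form_def)
  have sym: "assoc_form Q x y = assoc_form Q y x" for x y
    by (simp add: assoc_form_def add.commute algebra_simps)
  have add: "assoc_form Q x (y + z) = assoc_form Q x y + assoc_form Q x z"
    and scale: "assoc_form Q x (c *s y) = c * assoc_form Q x y" for x y z c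
  proof -
    interpret L: Vector_Spaces.linear "(*s)" "(*)" "assoc_form Q x" by (rule lin)
    show "assoc_form Q x (y + z) = assoc_form Q x y + assoc_form Q x z" by (rule L.add)
    show "assoc_form Q x (c *s y) = c * assoc_form Q x y" by (rule L.scale)
  qed
  note two = two_neq_0[OF odd]
  show "sym_form (assoc_form Q) (real CARD('a)) (quad_char (-1::'a))"
  proof
    show "assoc_form Q (x + y) z = assoc_form Q x z + assoc_form Q y z" for x y z
      using add[of z x y] by (simp only: sym[of z])
    show "assoc_form Q (c *s x) z = c * assoc_form Q x z" for c x z
      using scale[of z c x] by (simp only: sym[of z])
  qed (use sym two in auto)
  have "Q (2 *s v) = 2 ^ 2 * Q v" using Q by (simp add: quadratic_form_def)
  moreover have "v + v = 2 *s v" by (simp add: vec_eq_iff)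
  ultimately have "Q (v + v) - Q v - Q v = 2 * Q v" by simp
  thus "assoc_form Q v v = Q v" using two by (simp add: assoc_form_def)
qed

section \<open>Embedding into a space with room for hyperbolic planes\<close>

lemma (in sym_form) room_le: "room m V \<Longrightarrow> l \<le> m \<Longrightarrow> room l V"
proof (induction l arbitrary: m V)
  case (Suc l)
  then obtain m' where "m = Suc m'" by (cases m) auto
  with Suc show ?case by auto
qed simp

text \<open>Every step of the recursion adjoins hyperbolic planes, so it has to take place in a larger
  ambient space.\<close>

lemma hyperbolic_extension:
  fixes f :: "'a::{field,finite} ^ 'n \<Rightarrow> 'a ^ 'n \<Rightarrow> 'a"
  assumes f: "sym_form f q sig"
  obtains g :: "'a ^ ('n + 'n + 'n) \<Rightarrow> 'a ^ ('n + 'n + 'n) \<Rightarrow> 'a" and T :: "'a ^ 'n \<Rightarrow> 'a ^ ('n + 'n + 'n)"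
  where "sym_form g q sig" "\<And>x y. T (x + y) = T x + T y" "\<And>c x. T (c *s x) = c *s T x" "inj T"
    "\<And>x y. g (T x) (T y) = f x y" "sym_form.room g CARD('n) (range T)"
proof -
  interpret F: sym_form f q sig by (rule f)
  define pr :: "'a ^ ('n + 'n + 'n) \<Rightarrow> 'a ^ 'n" where "pr = (\<lambda>x. \<chi> k. x $ Inl k)"
  define a :: "'n \<Rightarrow> 'n + 'n + 'n" where "a = (\<lambda>k. Inr (Inl k))"
  define b :: "'n \<Rightarrow> 'n + 'n + 'n" where "b = (\<lambda>k. Inr (Inr k))"
  \<comment> \<open>f on the first block of coordinates, plus one hyperbolic plane for each index k,
    with the axis vectors of \<open>a k\<close> and \<open>b k\<close> as basis.\<close>
  define g where "g = (\<lambda>x y. f (pr x) (pr y) + (\<Sum>k\<in>UNIV. x $ a k * y $ b k + x $ b k * y $ a k))"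
  define T :: "'a ^ 'n \<Rightarrow> 'a ^ ('n + 'n + 'n)" where "T = (\<lambda>v. \<chi> z. case z of Inl k \<Rightarrow> v $ k | Inr _ \<Rightarrow> 0)"
  have pr: "pr (x + y) = pr x + pr y" "pr (c *s x) = c *s pr x" for x y c
    by (simp_all add: pr_def vec_eq_iff)
  have G: "sym_form g q sig"
  proof
    show "g x y = g y x" for x y
      unfolding g_def by (simp only: F.f_sym[of "pr x"]) (simp add: ac_simps)
    show "g (x + y) z = g x z + g y z" for x y z
      unfolding g_def pr by (simp add: F.f_add sum.distrib[symmetric] ring_distribs ac_simps)
    show "g (c *s x) z = c * g x z" for c x z
      unfolding g_def pr by (simp add: F.f_scale sum_distrib_left ring_distribs ac_simps)
  qed (use F.two F.q_eq F.sig_eq in auto)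
  interpret G: sym_form g q sig by (rule G)
  have T: "T (x + y) = T x + T y" "T (c *s x) = c *s T x" for x y c
    by (simp_all add: T_def vec_eq_iff split: sum.split)
  have prT: "pr (T x) = x" for x by (simp add: pr_def T_def vec_eq_iff)
  have Tab: "T x $ a k = 0" "T x $ b k = 0" for x k by (simp_all add: T_def a_def b_def)
  have inj: "inj T" by (rule inj_on_inverseI[of _ pr]) (rule prT)
  have iso: "g (T x) (T y) = f x y" for x y by (simp add: g_def prT Tab)
  \<comment> \<open>Enlarging L by one index l makes a plane available: its two axis vectors are
    orthogonal to \<open>W (insert l L)\<close> and lie in \<open>W L\<close>.\<close>
  define W where "W = (\<lambda>L::'n set. {x :: 'a ^ ('n + 'n + 'n). \<forall>k\<in>L. x $ a k = 0 \<and> x $ b k = 0})"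
  have W: "vec.subspace (W L)" for L by (rule vec.subspaceI) (auto simp: W_def)
  have ab: "a k \<noteq> b l" "b l \<noteq> a k" "a k = a l \<longleftrightarrow> k = l" "b k = b l \<longleftrightarrow> k = l"
    "Inl m \<noteq> a k" "Inl m \<noteq> b k" for k l m
    by (auto simp: a_def b_def)
  have pra: "pr (axis (a k) 1) = 0" "pr (axis (b k) 1) = 0" for k
    using ab by (auto simp: pr_def vec_eq_iff axis_def)
  have ga: "g (axis (a k) 1) x = x $ b k" and gb: "g (axis (b k) 1) x = x $ a k" for k x
    unfolding g_def pra by (simp_all add: F.f_zero axis_def ab if_distrib[of "\<lambda>z. z * _"] cong: if_cong)
  have "G.room (card L) (W L)" for L
  proof -
    have "finite L" by simp
    thus ?thesis
    proof (induction L)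
      case (insert l L)
      let ?r = "axis (a l) (1::'a)" and ?r' = "axis (b l) (1::'a)"
      have "?r \<in> G.orth (W (insert l L))" "?r' \<in> G.orth (W (insert l L))"
        by (auto simp: G.orth_def ga gb W_def)
      moreover have "g ?r ?r = 0" "g ?r' ?r = 1" by (simp_all add: ga gb) (simp_all add: axis_def ab)
      moreover have "G.room (card L) (adjoin ?r' (adjoin ?r (W (insert l L))))"
      proof (rule G.room_mono[OF insert.IH])
        have "?r \<in> W L" "?r' \<in> W L" using insert.hyps by (auto simp: W_def axis_def ab)
        thus "adjoin ?r' (adjoin ?r (W (insert l L))) \<subseteq> W L"
          by (intro adjoin_minimal W) (auto simp: W_def)
      qed
      ultimately show ?case using insert.hyps by auto
    qed simp
  qed
  from this[of UNIV] have "G.room CARD('n) (W UNIV)" .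
  hence "G.room CARD('n) (range T)" by (rule G.room_mono) (auto simp: W_def Tab)
  from that[OF G T inj iso this] show thesis .
qed



text \<open>A non-degenerate whole space leaves no vectors orthogonal to it, so the counts are
  transported to its isometric copy \<open>range T\<close>. The \<open>CARD('k)\<close> planes found
  there are enough, since the excess is at most \<open>CARD('k)\<close>.\<close>

lemma (in sym_form) count_in_whole_space:
  assumes nd: "corank UNIV = 0" and P: "vec.subspace P" "vec.dim P = 2 * k"
  shows "corank P = 2 * l + 1 \<Longrightarrow> CARD('k) = 2 * k + (2 * l + 1) + 2 * a \<Longrightarrow>
      nonsing_count UNIV P * q ^ ((l + 1 + a) ^ 2) =
        q ^ (2 * k * (2 * l + 1 + 2 * a)) * chi_sum q (l + 1 + a) a (int (2 * l + 1) - int (2 * k))"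
    and "corank P = 2 * l \<Longrightarrow> CARD('k) = 2 * k + 2 * l + (2 * a + 1) \<Longrightarrow>
      nonsing_count UNIV P * q ^ ((l + 1 + a) ^ 2) =
        q ^ (2 * k * (2 * l + 2 * a + 1)) * (chi_sum q (l + 1 + a) a (int (2 * l) - int (2 * k) + 1) +
          sig ^ (k + l) * disc_char P * q powi (int l - int k) * chi_sum q (l + a) a (int (2 * l) - int (2 * k) + 1))"
proof -
  have ax: "sym_form f q sig" by unfold_locales
  obtain g :: "'a ^ ('k + 'k + 'k) \<Rightarrow> 'a ^ ('k + 'k + 'k) \<Rightarrow> 'a" and T :: "'a ^ 'k \<Rightarrow> 'a ^ ('k + 'k + 'k)"
    where G: "sym_form g q sig" and T: "\<And>x y. T (x + y) = T x + T y" "\<And>c x. T (c *s x) = c *s T x" "inj T"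
    and iso: "\<And>x y. g (T x) (T y) = f x y" and room: "sym_form.room g CARD('k) (range T)"
    using hyperbolic_extension[OF ax] by metis
  interpret G: sym_form g q sig by (rule G)
  have U: "vec.subspace (UNIV :: ('a ^ 'k) set)" by simp
  have dim: "vec.dim (T ` S) = vec.dim S" if "vec.subspace S" for S
    using card_image[OF inj_on_subset[OF T(3) subset_UNIV], of S] that
    by (intro dim_eqI_card image_adjoin(1)[of T, OF T(1,2)]) (simp_all add: card_subspace)
  have X: "G.nonsing_count (range T) (T ` P) = nonsing_count UNIV P"
    using nonsing_count_isometry[OF G T iso U P(1)] by simp
  have cP: "G.corank (T ` P) = corank P" "G.disc_char (T ` P) = disc_char P"
    using h_isometry(1,2)[OF G T iso P(1)] by simp_all
  have cV: "G.corank (range T) = 0" using h_isometry(1)[OF G T iso U] nd by simp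
  have V: "vec.subspace (range T)" and P': "vec.subspace (T ` P)"
    using image_adjoin(1)[of T, OF T(1,2)] U P(1) by auto
  have dV: "vec.dim (range T) = CARD('k)" by (rule trans[OF dim[OF U] vec_dim_card])
  have dP: "vec.dim (T ` P) = 2 * k" using dim[OF P(1)] P(2) by simp
  have sub: "T ` P \<subseteq> range T" by auto
  show "nonsing_count UNIV P * q ^ ((l + 1 + a) ^ 2) =
        q ^ (2 * k * (2 * l + 1 + 2 * a)) * chi_sum q (l + 1 + a) a (int (2 * l + 1) - int (2 * k))"
    if "corank P = 2 * l + 1" "CARD('k) = 2 * k + (2 * l + 1) + 2 * a"
    unfolding X[symmetric]
    by (rule G.count_odd[OF V cV P' sub dP])
      (use that cP dV in \<open>simp_all add: G.room_le[OF room] del: G.room.simps\<close>)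
  show "nonsing_count UNIV P * q ^ ((l + 1 + a) ^ 2) =
        q ^ (2 * k * (2 * l + 2 * a + 1)) * (chi_sum q (l + 1 + a) a (int (2 * l) - int (2 * k) + 1) +
          sig ^ (k + l) * disc_char P * q powi (int l - int k) * chi_sum q (l + a) a (int (2 * l) - int (2 * k) + 1))"
    if "corank P = 2 * l" "CARD('k) = 2 * k + 2 * l + (2 * a + 1)"
    unfolding X[symmetric] cP(2)[symmetric]
    by (rule G.count_even[OF V cV P' sub dP])
      (use that cP dV in \<open>simp_all add: G.room_le[OF room] del: G.room.simps\<close>)
qed


section \<open>Translation into the functions of the statement\<close>

lemma chi_prod_int: "chi_prod 1 (int k) q = odd_prod q k"
proof -
  have "2 * (int l + 1) - 1 = int (2 * l + 1)" for l by simp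
  hence e: "q powi (2 * (int l + 1) - 1) = q ^ (2 * l + 1)" for l by (simp only: power_int_of_nat)
  have "(\<Prod>l<k. q powi (2 * (int l + 1) - 1) - 1) = (\<Prod>z\<in>{1..int k}. q powi (2 * z - 1) - 1)"
    by (rule prod.reindex_bij_witness[of _ "\<lambda>z. nat (z - 1)" "\<lambda>l. int l + 1"]) auto
  thus ?thesis by (simp only: chi_prod_def odd_prod_def e)
qed

lemma psi_minus_int:
  "psi_minus (int b + 1) (int a) Q = (\<Prod>k\<in>{b..<a}. Q ^ Suc k - 1)"
  unfolding psi_minus_def
  by (rule prod.reindex_bij_witness[of _ "\<lambda>l. int l + 1" "\<lambda>z. nat (z - 1)"])
    (auto simp: power_int_def nat_add_distrib nat_diff_distrib)

lemma gauss_binomial_int: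
  assumes Q: "Q > 1" and m: "m \<le> a"
  shows "gauss_binomial (int a) (int m) Q = q_binomial Q a m"
proof -
  define F where "F = (\<lambda>n. \<Prod>k<n. Q ^ Suc k - 1)"
  have F0: "F n \<noteq> 0" for n
  proof -
    have "1 < Q ^ Suc k" for k using Q by (simp only: one_less_power zero_less_Suc)
    hence "Q ^ Suc k - 1 \<noteq> 0" for k by (metis diff_gt_0_iff_gt less_irrefl)
    thus ?thesis by (auto simp: F_def simp del: power_Suc)
  qed
  have "psi_minus 1 (int m) Q = F m" using psi_minus_int[of 0 m Q] by (simp add: F_def lessThan_atLeast0)
  moreover have "F (a - m) * psi_minus (int a - int m + 1) (int a) Q = F a"
  proof -
    have "int a - int m = int (a - m)" using m by simp
    moreover have "{..<a} = {..<a - m} \<union> {a - m..<a}" using m by auto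
    moreover have "(\<Prod>k\<in>{..<a - m} \<union> {a - m..<a}. Q ^ Suc k - 1) =
        (\<Prod>k<a - m. Q ^ Suc k - 1) * (\<Prod>k\<in>{a - m..<a}. Q ^ Suc k - 1)"
      by (rule prod.union_disjoint) auto
    ultimately show ?thesis unfolding F_def by (simp only: psi_minus_int)
  qed
  moreover have "q_binomial Q a m * (F (a - m) * F m) = F a" unfolding F_def by (rule q_binomial_product[OF m])
  ultimately have "F (a - m) * psi_minus (int a - int m + 1) (int a) Q = F (a - m) * (q_binomial Q a m * psi_minus 1 (int m) Q)"
    by (simp only: ac_simps)
  hence "psi_minus (int a - int m + 1) (int a) Q = q_binomial Q a m * psi_minus 1 (int m) Q" using F0 by simp
  moreover have "psi_minus 1 (int m) Q \<noteq> 0" using F0 \<open>psi_minus 1 (int m) Q = F m\<close> by simp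
  ultimately show ?thesis using m by (simp add: gauss_binomial_def)
qed

text \<open>The function s stands for the second factor of the exponent, so that the rule matches
  the exponents as they are written in the theorem.\<close>

lemma chi_sum_int:
  assumes q: "q > 1" and aB: "a \<le> B"
    and A: "A = int a" and B': "B' = int B" and s: "\<And>m. s m = m + t"
  shows "(\<Sum>m = 0..A. chi_prod 1 (B' - m) q * gauss_binomial A m (q ^ 2) * q powi (m * s m)) = chi_sum q B a t"
proof -
  have q2: "q ^ 2 > 1" using q by (rule one_less_power) simp
  have "(\<Sum>m = 0..A. chi_prod 1 (B' - m) q * gauss_binomial A m (q ^ 2) * q powi (m * s m)) =
      (\<Sum>m\<le>a. chi_prod 1 (B' - int m) q * gauss_binomial A (int m) (q ^ 2) * q powi (int m * s (int m)))"
    by (rule sum.reindex_bij_witness[of _ int nat]) (auto simp: A)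
  also have "\<dots> = chi_sum q B a t"
    unfolding chi_sum_def
  proof (rule sum.cong[OF refl])
    fix m assume "m \<in> {..a}"
    hence m: "m \<le> a" by simp
    have "B' - int m = int (B - m)" using m aB B' by simp
    thus "chi_prod 1 (B' - int m) q * gauss_binomial A (int m) (q ^ 2) * q powi (int m * s (int m)) =
        odd_prod q (B - m) * q_binomial (q ^ 2) a m * q powi (int m * (int m + t))"
      by (simp only: chi_prod_int A gauss_binomial_int[OF q2 m] s)
  qed
  finally show ?thesis .
qed

text \<open>The exponent in the theorem is a real expression with fractions and may be negative,
  while the counts are known in the form X q^M = q^L R with natural exponents.\<close>

lemma solve_count:
  fixes q X R :: real
  assumes q: "q > 0" and X: "X * q ^ M = q ^ L * R" and E: "E = real L - real M"
  shows "X = q powr E * R"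
proof -
  have "q ^ L = q ^ M * q powr E" unfolding E using q by (simp add: powr_diff powr_realpow)
  hence "q ^ M * X = q ^ M * (q powr E * R)" using X by (simp add: ac_simps)
  thus ?thesis using q by simp
qed

text \<open>The dimensions add up to n, so trivial intersection already makes S a complement and the
  span the whole space. The types impose no further condition: k is odd, and the whole space has
  type 0.\<close>

lemma gamma_count_eq_nonsing_count:
  fixes Q :: "'a::{field,finite} ^ 'n \<Rightarrow> 'a"
  assumes Q: "quadratic_form_of_type Q 0" and q: "odd CARD('a)"
    and P: "vec.subspace P" and k: "k + vec.dim P = CARD('n)" "odd k"
  shows "real (gamma_count Q P k 0 0) = sym_form.nonsing_count (assoc_form Q) UNIV P"
proof -
  let ?f = "assoc_form Q"
  have qf: "quadratic_form Q" and r0: "radical Q UNIV = {0}" and t0: "has_type Q UNIV 0"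
    using Q by (auto simp: quadratic_form_of_type_def)
  interpret F: sym_form ?f "real CARD('a)" "quad_char (-1::'a)" by (rule sym_form_assoc_form(1)[OF qf q])
  have rad: "F.rad S = radical Q S" for S by (simp add: F.rad_def radical_def)
  have U: "vec.subspace (UNIV :: ('a ^ 'n) set)" by simp
  have "{S. singular_space Q 0 k S \<and> has_type Q S 0 \<and> S \<inter> P = {0} \<and>
      singular_space Q 0 (k + vec.dim P) (vec.span (P \<union> S)) \<and> has_type Q (vec.span (P \<union> S)) 0} =
      {S \<in> complements UNIV P. F.corank S = 0}" (is "?L = ?R")
  proof (intro subset_antisym subsetI)
    fix S assume "S \<in> ?L"
    hence S: "vec.subspace S" "vec.dim S = k" "vec.dim (radical Q S) = 0" "S \<inter> P = {0}"
      by (auto simp: singular_space_def)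
    hence "S \<in> complements UNIV P" using k by (intro complements_dimI U P) (auto simp: vec_dim_card simp del: vec.dim_UNIV)
    thus "S \<in> ?R" using S by (simp add: F.corank_def rad)
  next
    fix S assume "S \<in> ?R"
    hence S: "S \<in> complements UNIV P" "F.corank S = 0" by auto
    note S' = complementsD[OF S(1)]
    have d: "vec.dim S = k" using dim_complements[OF U P _ S(1)] k by (simp add: vec_dim_card del: vec.dim_UNIV)
    have r: "vec.dim (radical Q S) = 0" using S(2) by (simp add: F.corank_def rad)
    have "v \<in> vec.span (P \<union> S)" for v
    proof -
      obtain s where "s \<in> S" "v - s \<in> P" using S'(4)[of v] by blast
      hence "(v - s) + s \<in> vec.span (P \<union> S)" by (intro vec.span_add) (auto simp: vec.span_base)
      thus ?thesis by simp
    qed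
    hence sp: "vec.span (P \<union> S) = UNIV" by blast
    have "has_type Q S 0" using k(2) by (simp add: has_type_def d r del: vec.dim_eq_0)
    moreover have "singular_space Q 0 (k + vec.dim P) UNIV"
      using k r0 by (simp add: singular_space_def vec_dim_card del: vec.dim_UNIV)
    moreover have "singular_space Q 0 k S" using S'(1) d r by (simp add: singular_space_def del: vec.dim_eq_0)
    ultimately show "S \<in> ?L" unfolding mem_Collect_eq sp using S'(3) t0 by blast
  qed
  thus ?thesis
    by (simp add: gamma_count_def F.nonsing_count_def F.nonsing_ind_def sum.inter_filter[symmetric])
qed

text \<open>The link between the type, defined by dimensions of isotropic subspaces, and the
  discriminant, in which the counts are expressed.\<close>

lemma has_type_disc_char:
  fixes Q :: "'a::{field,finite} ^ 'n \<Rightarrow> 'a"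
  assumes Q: "quadratic_form Q" and q: "odd CARD('a)"
    and P: "vec.subspace P" "vec.dim P = vec.dim (radical Q P) + 2 * h" and t: "has_type Q P \<delta>"
  shows "real_of_int \<delta> = quad_char (-1::'a) ^ h * sym_form.disc_char (assoc_form Q) P"
proof -
  let ?f = "assoc_form Q"
  interpret F: sym_form ?f "real CARD('a)" "quad_char (-1::'a)" by (rule sym_form_assoc_form(1)[OF Q q])
  have Qf: "?f v v = Q v" for v by (rule sym_form_assoc_form(2)[OF Q q])
  have rad: "F.rad S = radical Q S" for S by (simp add: F.rad_def radical_def)
  define D where "D = {vec.dim W - vec.dim (radical Q P) | W.
      vec.subspace W \<and> radical Q P \<subseteq> W \<and> W \<subseteq> P \<and> (\<forall>v\<in>W. Q v = 0)}"
  have fin: "finite D" unfolding D_def by simp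
  have R: "vec.subspace (radical Q P)" using F.subspace_rad[OF P(1)] by (simp add: rad)
  \<comment> \<open>The radical itself is one of the isotropic subspaces considered, so
    \<open>D\<close> is non-empty and its maximum is attained.\<close>
  have "Q v = 0" if "v \<in> radical Q P" for v
    using that unfolding Qf[of v, symmetric] by (simp add: radical_def)
  hence "vec.dim (radical Q P) - vec.dim (radical Q P) \<in> D"
    unfolding D_def using R by (intro CollectI exI[of _ "radical Q P"]) (auto simp: radical_def)
  hence "D \<noteq> {}" by blast
  hence "Max D \<in> D" using fin by (rule Max_in[rotated])
  then obtain T where T: "Max D = vec.dim T - vec.dim (radical Q P)" "vec.subspace T" "radical Q P \<subseteq> T" "T \<subseteq> P"
    "\<forall>v\<in>T. Q v = 0"
    unfolding D_def by auto
  have RT: "vec.dim (radical Q P) \<le> vec.dim W" if "radical Q P \<subseteq> W" for W using that by (rule vec.dim_subset)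
  have max: "vec.dim W \<le> vec.dim T"
    if W: "vec.subspace W" "radical Q P \<subseteq> W" "W \<subseteq> P" "\<forall>v\<in>W. Q v = 0" for W
  proof -
    have "vec.dim W - vec.dim (radical Q P) \<le> Max D" by (rule Max_ge[OF fin]) (use W in \<open>auto simp: D_def\<close>)
    thus ?thesis using T(1) RT[OF T(3)] RT[OF W(2)] by linarith
  qed
  note base = F.disc_char_maximal_isotropic_radical[unfolded F.corank_def rad Qf, OF P T(2-5)]
  have M: "max_isotropic_dim Q P = Max D" by (simp add: max_isotropic_dim_def D_def)
  have "(\<delta> = 1 \<and> Max D = h) \<or> (\<delta> = -1 \<and> int (Max D) = int h - 1)"
    using t unfolding has_type_def M Let_def P(2) by auto
  thus ?thesis
  proof
    assume a: "\<delta> = 1 \<and> Max D = h"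
    hence "vec.dim T = vec.dim (radical Q P) + h" using T(1) RT[OF T(3)] by linarith
    hence "quad_char (-1::'a) ^ h * F.disc_char P = 1" by (rule base(1)[rotated]) (rule max)
    thus ?thesis using a by simp
  next
    assume a: "\<delta> = -1 \<and> int (Max D) = int h - 1"
    hence "vec.dim T + 1 = vec.dim (radical Q P) + h" using T(1) RT[OF T(3)] by linarith
    hence "quad_char (-1::'a) ^ h * F.disc_char P = -1" by (rule base(2)[rotated]) (rule max)
    thus ?thesis using a by simp
  qed
qed

theorem corollary4p16:
  fixes Q :: "'a::{field,finite} ^ 'n \<Rightarrow> 'a"
    and q :: nat
    and n j i \<delta> \<mu> :: int
  assumes "q = CARD('a)" and "odd q"
    and "n = int CARD('n)"
    and "quadratic_form_of_type Q 0"
    and "0 \<le> i" and "i \<le> j" and "i + j \<le> n"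
    and "odd n" and "even j"
    and "\<delta> \<in> {0, 1, -1}" and "\<mu> \<in> {1, -1}"
    and "(j - i - \<delta>) mod 2 = 1"
  shows
    "(even i \<longrightarrow>
       (\<forall>P. singular_space Q (nat i) (nat j) P \<and> has_type Q P \<delta> \<longrightarrow>
         real (gamma_count Q P (nat (n - j)) 0 0) =
           real q powr (3/2 * j * n - 1/4 * n^2 - 5/4 * j^2 - 1/2 * n + 1/2 * j - 1/4) *
           ((\<Sum>m = 0..(n - j - i - 1) div 2.
               chi_prod 1 ((n - j + 1) div 2 - m) (real q) *
               gauss_binomial ((n - j - i - 1) div 2) m ((real q)^2) *
               real q powi (m * (m - j + i + 1)))
            + \<delta> * real q powr (1/2 * (i - j)) *
              (\<Sum>m = 0..(n - j - i - 1) div 2.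
               chi_prod 1 ((n - j - 1) div 2 - m) (real q) *
               gauss_binomial ((n - j - i - 1) div 2) m ((real q)^2) *
               real q powi (m * (m - j + i + 1)))))) \<and>
     (odd i \<longrightarrow>
       (\<forall>P. singular_space Q (nat i) (nat j) P \<and> has_type Q P 0 \<and> has_perp_type Q P \<mu> \<longrightarrow>
         real (gamma_count Q P (nat (n - j)) 0 0) =
           real q powr (3/2 * j * n - 1/4 * n^2 - 5/4 * j^2 - 1/2 * n + 1/2 * j - 1/4) *
           (\<Sum>m = 0..(n - j - i) div 2.
              chi_prod 1 ((n - j + 1) div 2 - m) (real q) *
              gauss_binomial ((n - j - i) div 2) m ((real q)^2) *
              real q powi (m * (m - j + i)))))"
proof -
  have qf: "quadratic_form Q" and r0: "radical Q UNIV = {0}"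
    using assms(4) by (auto simp: quadratic_form_of_type_def)
  have odd: "odd CARD('a)" using assms(1,2) by simp
  interpret F: sym_form "assoc_form Q" "real q" "quad_char (-1::'a)"
    using sym_form_assoc_form(1)[OF qf odd] assms(1) by simp
  have rad: "F.rad S = radical Q S" for S by (simp add: F.rad_def radical_def)
  have nd: "F.corank UNIV = 0" by (simp add: F.corank_def rad r0)
  have "card {0::'a, 1} \<le> CARD('a)" by (intro card_mono) auto
  hence q1: "real q > 1" and q0: "real q > 0" using assms(1) by simp_all
  obtain k where k: "j = 2 * int k"
  proof -
    obtain z where "j = 2 * z" using \<open>even j\<close> by blast
    thus thesis using assms(5,6) by (intro that[of "nat z"]) simp
  qed
  have X: "real (gamma_count Q P (nat (n - j)) 0 0) = F.nonsing_count UNIV P"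
    if "vec.subspace P" "vec.dim P = nat j" for P
  proof (rule gamma_count_eq_nonsing_count[OF assms(4) odd that(1)])
    show "nat (n - j) + vec.dim P = CARD('n)" using that(2) assms(3,5,6,7) by linarith
    have "odd (n - j)" "n - j \<ge> 0" using assms(5,6,7,8,9) by auto
    thus "odd (nat (n - j))" by (simp add: even_nat_iff)
  qed
  show ?thesis
  proof (intro conjI impI allI)
    fix P assume i: "even i" and P: "singular_space Q (nat i) (nat j) P \<and> has_type Q P \<delta>"
    obtain l where l: "i = 2 * int l"
    proof -
      obtain z where "i = 2 * z" using i by blast
      thus thesis using assms(5) by (intro that[of "nat z"]) simp
    qed
    \<comment> \<open>The excess n - j - i is odd here and equals 2a + 1.\<close>
    obtain a where a: "n = 2 * int k + 2 * int l + 2 * int a + 1"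
    proof -
      obtain z where "n = 2 * z + 1" using \<open>odd n\<close> by (elim oddE)
      thus thesis using k l assms(7) by (intro that[of "nat (z - int k - int l)"]) simp
    qed
    have P': "vec.subspace P" "vec.dim P = 2 * k" "vec.dim (radical Q P) = 2 * l"
      using P k l by (simp_all add: singular_space_def nat_mult_distrib)
    have lk: "l \<le> k" using assms(6) k l by simp
    have cnt: "F.nonsing_count UNIV P * real q ^ ((l + 1 + a) ^ 2) =
        real q ^ (2 * k * (2 * l + 2 * a + 1)) * (chi_sum (real q) (l + 1 + a) a (int (2 * l) - int (2 * k) + 1) +
          quad_char (-1::'a) ^ (k + l) * F.disc_char P * real q powi (int l - int k) *
            chi_sum (real q) (l + a) a (int (2 * l) - int (2 * k) + 1))"
    proof (rule F.count_in_whole_space(2)[OF nd P'(1,2)])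
      show "F.corank P = 2 * l" by (simp add: F.corank_def rad P')
      show "CARD('n) = 2 * k + 2 * l + (2 * a + 1)" using assms(3) a by simp
    qed
    have disc_char: "quad_char (-1::'a) ^ (k + l) * F.disc_char P = real_of_int \<delta>"
    proof -
      have "real_of_int \<delta> = quad_char (-1::'a) ^ (k - l) * F.disc_char P"
        by (rule has_type_disc_char[OF qf odd P'(1)]) (use P P' lk in auto)
      \<comment> \<open>P modulo its radical has dimension 2(k - l), whereas the count contains the
        exponent k + l; they differ by the even number 2l.\<close>
      moreover have "quad_char (-1::'a) ^ (k + l) = quad_char (-1::'a) ^ (k - l) * (quad_char (-1::'a) * quad_char (-1::'a)) ^ l"
      proof -
        have e: "k + l = (k - l) + (l + l)" using lk by simp
        show ?thesis by (subst e) (simp only: power_add power_mult_distrib)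
      qed
      ultimately show ?thesis by (simp only: F.sig_sq power_one mult_1_right)
    qed
    have pw: "real q powi (int l - int k) = real q powr (1/2 * (i - j))"
    proof -
      have "(1/2 * (i - j) :: real) = real_of_int (int l - int k)"
        unfolding k l by (simp add: diff_divide_distrib)
      thus ?thesis using q0 powr_real_of_int'[of "real q" "int l - int k"] by (simp only:) simp
    qed
    have h: "(n - j - i - 1) div 2 = int a" "(n - j + 1) div 2 = int (l + 1 + a)" "(n - j - 1) div 2 = int (l + a)"
      using a k l by simp_all
    have s: "m - j + i + 1 = m + (int (2 * l) - int (2 * k) + 1)" for m using k l by simp
    have S1: "(\<Sum>m = 0..(n - j - i - 1) div 2. chi_prod 1 ((n - j + 1) div 2 - m) (real q) *
          gauss_binomial ((n - j - i - 1) div 2) m ((real q)^2) * real q powi (m * (m - j + i + 1))) =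
        chi_sum (real q) (l + 1 + a) a (int (2 * l) - int (2 * k) + 1)"
      by (rule chi_sum_int[OF q1 _ h(1,2) s]) simp
    have S2: "(\<Sum>m = 0..(n - j - i - 1) div 2. chi_prod 1 ((n - j - 1) div 2 - m) (real q) *
          gauss_binomial ((n - j - i - 1) div 2) m ((real q)^2) * real q powi (m * (m - j + i + 1))) =
        chi_sum (real q) (l + a) a (int (2 * l) - int (2 * k) + 1)"
      by (rule chi_sum_int[OF q1 _ h(1,3) s]) simp
    \<comment> \<open>With 2k = j and 2l + 2a + 1 = n - j, the right-hand side is j(n - j) minus the
      square of (n - j + 1)/2.\<close>
    have E: "3/2 * j * n - 1/4 * n^2 - 5/4 * j^2 - 1/2 * n + 1/2 * j - 1/4 =
        real (2 * k * (2 * l + 2 * a + 1)) - real ((l + 1 + a) ^ 2)"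
      unfolding k a by (simp add: power2_eq_square field_simps)
    show "real (gamma_count Q P (nat (n - j)) 0 0) =
           real q powr (3/2 * j * n - 1/4 * n^2 - 5/4 * j^2 - 1/2 * n + 1/2 * j - 1/4) *
           ((\<Sum>m = 0..(n - j - i - 1) div 2.
               chi_prod 1 ((n - j + 1) div 2 - m) (real q) *
               gauss_binomial ((n - j - i - 1) div 2) m ((real q)^2) *
               real q powi (m * (m - j + i + 1)))
            + \<delta> * real q powr (1/2 * (i - j)) *
              (\<Sum>m = 0..(n - j - i - 1) div 2.
               chi_prod 1 ((n - j - 1) div 2 - m) (real q) *
               gauss_binomial ((n - j - i - 1) div 2) m ((real q)^2) *
               real q powi (m * (m - j + i + 1))))"
      unfolding S1 S2
      using solve_count[OF q0 cnt E] X[OF P'(1)] P'(2) k by (simp add: disc_char pw)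
  next
    fix P assume i: "odd i"
      and P: "singular_space Q (nat i) (nat j) P \<and> has_type Q P 0 \<and> has_perp_type Q P \<mu>"
    obtain l where l: "i = 2 * int l + 1"
    proof -
      obtain z where "i = 2 * z + 1" using i by (elim oddE)
      thus thesis using assms(5) by (intro that[of "nat z"]) simp
    qed
    obtain a where a: "n = 2 * int k + (2 * int l + 1) + 2 * int a"
    proof -
      obtain z where "n = 2 * z + 1" using \<open>odd n\<close> by (elim oddE)
      thus thesis using k l assms(7) by (intro that[of "nat (z - int k - int l)"]) simp
    qed
    have P': "vec.subspace P" "vec.dim P = 2 * k" "vec.dim (radical Q P) = 2 * l + 1"
      using P k l by (simp_all add: singular_space_def nat_mult_distrib nat_add_distrib)
    have cnt: "F.nonsing_count UNIV P * real q ^ ((l + 1 + a) ^ 2) =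
        real q ^ (2 * k * (2 * l + 1 + 2 * a)) * chi_sum (real q) (l + 1 + a) a (int (2 * l + 1) - int (2 * k))"
    proof (rule F.count_in_whole_space(1)[OF nd P'(1,2)])
      show "F.corank P = 2 * l + 1" by (simp add: F.corank_def rad P')
      show "CARD('n) = 2 * k + (2 * l + 1) + 2 * a" using assms(3) a by simp
    qed
    have h: "(n - j - i) div 2 = int a" "(n - j + 1) div 2 = int (l + 1 + a)"
      using a k l by simp_all
    have s: "m - j + i = m + (int (2 * l + 1) - int (2 * k))" for m using k l by simp
    have S: "(\<Sum>m = 0..(n - j - i) div 2. chi_prod 1 ((n - j + 1) div 2 - m) (real q) *
          gauss_binomial ((n - j - i) div 2) m ((real q)^2) * real q powi (m * (m - j + i))) =
        chi_sum (real q) (l + 1 + a) a (int (2 * l + 1) - int (2 * k))"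
      by (rule chi_sum_int[OF q1 _ h s]) simp
    have E: "3/2 * j * n - 1/4 * n^2 - 5/4 * j^2 - 1/2 * n + 1/2 * j - 1/4 =
        real (2 * k * (2 * l + 1 + 2 * a)) - real ((l + 1 + a) ^ 2)"
      unfolding k a by (simp add: power2_eq_square field_simps)
    show "real (gamma_count Q P (nat (n - j)) 0 0) =
           real q powr (3/2 * j * n - 1/4 * n^2 - 5/4 * j^2 - 1/2 * n + 1/2 * j - 1/4) *
           (\<Sum>m = 0..(n - j - i) div 2.
              chi_prod 1 ((n - j + 1) div 2 - m) (real q) *
              gauss_binomial ((n - j - i) div 2) m ((real q)^2) *
              real q powi (m * (m - j + i)))"
      unfolding S using solve_count[OF q0 cnt E] X[OF P'(1)] P'(2) k by simp
  qed
qed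

end
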